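(* Let $N \geq 5$ be an integer and let $p > 1$ be real. Let $x_0$ be the largest real root of the polynomial $$H(x) = x^4 - \frac{32p(p+1)}{(p-1)^2}x^2 + \frac{32p(p+1)(p+3)}{(p-1)^3}x -\frac{64p(p+1)^2}{(p-1)^4}.$$ If $N < 2 + 2x_0$, then the equation $$\Delta^2 u = u^p, \quad u>0 \quad \text{in } \mathbb{R}^N$$ has no classical stable solution. Moreover, $x_0 > 5$ for every $p > 1$. Consequently, if $5 \le N \leq 12$, this equation has no classical stable solution for any $p > 1$.
   Context: A classical solution is a function $u \in C^4(\mathbb{R}^N)$ satisfying the equation (and $u>0$) pointwise. A solution $u$ is called stable if $$\Lambda(\phi) := \int_{\mathbb{R}^N} |\Delta \phi|^2\, dx - p\int_{\mathbb{R}^N} u^{p-1}\phi^2\, dx \geq 0 \quad \text{for every } \phi \in H^2(\mathbb{R}^N).$$ *)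

theory Defs
  imports "HOL-Analysis.Analysis" "HOL-Computational_Algebra.Polynomial"
begin

definition partial_deriv :: "'a::euclidean_space \<Rightarrow> ('a \<Rightarrow> real) \<Rightarrow> 'a \<Rightarrow> real" where
  "partial_deriv b f = (\<lambda>x. frechet_derivative f (at x) b)"

fun C_class :: "nat \<Rightarrow> ('a::euclidean_space \<Rightarrow> real) \<Rightarrow> bool" where
  "C_class 0 f \<longleftrightarrow> continuous_on UNIV f"
| "C_class (Suc k) f \<longleftrightarrow>
     (\<forall>x. f differentiable (at x)) \<and> (\<forall>b\<in>Basis. C_class k (partial_deriv b f))"

definition laplacian :: "('a::euclidean_space \<Rightarrow> real) \<Rightarrow> 'a \<Rightarrow> real" where
  "laplacian f = (\<lambda>x. \<Sum>b\<in>Basis. partial_deriv b (partial_deriv b f) x)"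

definition classical_solution :: "real \<Rightarrow> ('a::euclidean_space \<Rightarrow> real) \<Rightarrow> bool" where
  "classical_solution p u \<longleftrightarrow>
     C_class 4 u \<and> (\<forall>x. u x > 0 \<and> laplacian (laplacian u) x = u x powr p)"

definition test_function :: "('a::euclidean_space \<Rightarrow> real) \<Rightarrow> bool" where
  "test_function \<eta> \<longleftrightarrow> (\<forall>k. C_class k \<eta>) \<and> compact (closure {x. \<eta> x \<noteq> 0})"

definition locally_integrable :: "('a::euclidean_space \<Rightarrow> real) \<Rightarrow> bool" where
  "locally_integrable f \<longleftrightarrow> (\<forall>K. compact K \<longrightarrow> set_integrable lebesgue K f)"

text \<open>Weak derivatives are determined only up to null sets, so they are treated as a relation
  between functions rather than as an operator.\<close>

definition weak_partial_deriv ::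
    "'a::euclidean_space \<Rightarrow> ('a \<Rightarrow> real) \<Rightarrow> ('a \<Rightarrow> real) \<Rightarrow> bool" where
  "weak_partial_deriv b f g \<longleftrightarrow> locally_integrable f \<and> locally_integrable g \<and>
     (\<forall>\<eta>. test_function \<eta> \<longrightarrow>
        (LINT x|lebesgue. f x * partial_deriv b \<eta> x) = - (LINT x|lebesgue. g x * \<eta> x))"

definition square_integrable :: "('a::euclidean_space \<Rightarrow> real) \<Rightarrow> bool" where
  "square_integrable f \<longleftrightarrow>
     f \<in> borel_measurable lebesgue \<and> integrable lebesgue (\<lambda>x. (f x)\<^sup>2)"

text \<open>\<open>sobolev k\<close> is \<open>H\<^sup>k = W\<^sup>k\<^sup>,\<^sup>2\<close> on the whole space.\<close>

fun sobolev :: "nat \<Rightarrow> ('a::euclidean_space \<Rightarrow> real) \<Rightarrow> bool" where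
  "sobolev 0 f \<longleftrightarrow> square_integrable f"
| "sobolev (Suc k) f \<longleftrightarrow>
     square_integrable f \<and> (\<forall>b\<in>Basis. \<exists>g. weak_partial_deriv b f g \<and> sobolev k g)"

definition weak_laplacian :: "('a::euclidean_space \<Rightarrow> real) \<Rightarrow> ('a \<Rightarrow> real) \<Rightarrow> bool" where
  "weak_laplacian f w \<longleftrightarrow>
     (\<exists>g h. (\<forall>b\<in>Basis. weak_partial_deriv b f (g b) \<and> weak_partial_deriv b (g b) (h b)) \<and>
            w = (\<lambda>x. \<Sum>b\<in>Basis. h b x))"

text \<open>The quadratic form \<open>\<Lambda>(\<phi>)\<close>, where \<open>w\<close> is a version of \<open>\<Delta>\<phi>\<close>. It is extended-real valued because
  \<open>u\<^sup>p\<^sup>-\<^sup>1 \<phi>\<^sup>2\<close> need not be integrable for \<open>\<phi> \<in> H\<^sup>2\<close>, in which case \<open>\<Lambda>(\<phi>) = -\<infinity>\<close>;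
  the first integral is finite, so \<open>\<infinity> - \<infinity>\<close> does not occur.\<close>

definition stability_form ::
    "real \<Rightarrow> ('a::euclidean_space \<Rightarrow> real) \<Rightarrow> ('a \<Rightarrow> real) \<Rightarrow> ('a \<Rightarrow> real) \<Rightarrow> ereal" where
  "stability_form p u \<phi> w =
     enn2ereal (\<integral>\<^sup>+x. ennreal (\<bar>w x\<bar>\<^sup>2) \<partial>lebesgue)
     - ereal p * enn2ereal (\<integral>\<^sup>+x. ennreal (u x powr (p - 1) * (\<phi> x)\<^sup>2) \<partial>lebesgue)"

definition stable_solution :: "real \<Rightarrow> ('a::euclidean_space \<Rightarrow> real) \<Rightarrow> bool" where
  "stable_solution p u \<longleftrightarrow> classical_solution p u \<and>
     (\<forall>\<phi> w. sobolev 2 \<phi> \<and> weak_laplacian \<phi> w \<longrightarrow> stability_form p u \<phi> w \<ge> 0)"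

definition H_poly :: "real \<Rightarrow> real poly" where
  "H_poly p =
     [: - (64 * p * (p + 1)\<^sup>2 / (p - 1) ^ 4),
        32 * p * (p + 1) * (p + 3) / (p - 1) ^ 3,
        - (32 * p * (p + 1) / (p - 1)\<^sup>2),
        0,
        1 :]"

text \<open>For \<open>p > 1\<close> the root set is finite and nonempty, since \<open>H_poly p\<close> is monic of degree 4 with
  negative value at 0.\<close>

definition x0 :: "real \<Rightarrow> real" where
  "x0 p = Max {x. poly (H_poly p) x = 0}"

end

theory Submission
  imports Defs
begin

text \<open>Write \<open>v = - \<Delta>u\<close>, \<open>X = u\<^bsup>(p+1)/2\<^esup>\<close> and let \<open>\<chi>(x) = (1 - |x|\<^sup>2)\<^sub>+\<close>. Every estimate is proved on the unit
  ball, uniformly in the solution, and is then applied to the dilations \<open>R\<^bsup>4/(p-1)\<^esup> u(a + R x)\<close>, which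
  are again (stable) solutions; letting \<open>R \<rightarrow> \<infinity>\<close> turns a bound into a sign.

  In this way \<open>v > 0\<close> follows from testing the equation with powers of \<open>\<chi>\<close> and the mean value property of the
  subharmonic function \<open>\<Delta>u\<close>, and \<open>(2/(p+1))\<^bsup>1/2\<^esup> X \<le> v\<close> from a Keller--Osserman argument. The inequality
  \<open>\<Delta>\<^sup>2 \<ge> p u\<^bsup>p-1\<^esup>\<close> of quadratic forms implies \<open>- \<Delta> \<ge> p\<^bsup>1/2\<^esup> u\<^bsup>(p-1)/2\<^esup>\<close> by operator monotonicity of the square
  root. Testing the latter with \<open>u\<^bsup>(p+1)s/4\<^esup> \<chi>\<^bsup>m\<^esup>\<close> and \<open>v\<^bsup>s/2\<^esup> \<chi>\<^bsup>m\<^esup>\<close> in the system \<open>- \<Delta>u = v\<close>, \<open>- \<Delta>v = u\<^bsup>p\<^esup>\<close>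
  bounds \<open>\<integral> u\<^bsup>(p-1)/2\<^esup> X\<^bsup>s\<^esup> \<chi>\<^bsup>2m\<^esup>\<close> by \<open>\<integral> v\<^bsup>s\<^esup> \<chi>\<^bsup>2m-2\<^esup>\<close> whenever \<open>H\<close> is negative at \<open>x = s (p+1)/(p-1)\<close>. For
  \<open>s > 2\<close>, moving the Laplacian from \<open>u\<close> to \<open>v\<^bsup>s-1\<^esup>\<close> bounds \<open>\<integral> v\<^bsup>s\<^esup> \<chi>\<^bsup>2m-2\<^esup>\<close> back in terms of \<open>u\<close>, so that the first
  integral is bounded uniformly. Its scaling exponent is \<open>2 + 2x - N\<close>, which is positive for \<open>x\<close> close
  enough to \<open>x\<^sub>0\<close>.\<close>

subsection \<open>Calculus of partial derivatives\<close>

text \<open>Powers of \<open>u\<close> are poor test functions for a fourth-order form, because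
  their bilaplacian brings derivative terms without a sign. For the form of
  \<open>- \<Delta>\<close> they are good ones: \<open>u\<close> and \<open>v\<close> can be tested
  separately, with constants \<open>4 (e - 1) / e^2\<close>, where \<open>e = (p + 1) s / 2\<close>,
  and \<open>4 (s - 1) / s^2\<close>. The two estimates are coupled by \<open>X^(s-1) v\<close> and
  \<open>X v^(s-1)\<close>, and they close when \<open>p\<close> times the product of the constants
  exceeds 1. Clearing denominators gives \<open>H(x) < 0\<close>, and \<open>s > 2\<close> means
  \<open>x > 2 (p + 1) / (p - 1)\<close>, a point below \<open>x\<^sub>0\<close>. Nothing is known
  about the growth of \<open>u\<close>, so terms in which derivatives fall on the cutoff cannot be
  discarded. They are absorbed: the main terms contain higher powers of \<open>u\<close> or
  \<open>v\<close>, and this surplus pays for the powers of \<open>\<chi>\<close> lost by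
  differentiation. Operator monotonicity is proved for bounded symmetric operators on compactly
  supported continuous functions, by a minimizing sequence rather than by spectral calculus; hence
  \<open>- \<Delta>\<close> is mollified first.\<close>

lemma partial_deriv_eq:
  assumes "(f has_derivative f') (at x)"
  shows "partial_deriv b f x = f' b"
  using frechet_derivative_at[OF assms] by (simp add: partial_deriv_def)

text \<open>Derivatives are carried as sums over \<open>Basis\<close> of
  \<open>(h \<bullet> b) * partial_deriv b f x\<close>; this reads off one coordinate.\<close>

lemma sum_inner_Basis:
  "b \<in> Basis \<Longrightarrow> (\<Sum>i\<in>Basis. (b \<bullet> i) * (g i :: real)) = g b"
  by (simp add: inner_Basis if_distrib[of "\<lambda>c. c * _"] sum.delta cong: if_cong)

lemma has_derivative_partial_deriv:
  fixes f :: "'a::euclidean_space \<Rightarrow> real"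
  assumes "f differentiable (at x)"
  shows "(f has_derivative (\<lambda>h. \<Sum>b\<in>Basis. (h \<bullet> b) * partial_deriv b f x)) (at x)"
proof -
  let ?D = "frechet_derivative f (at x)"
  have D: "(f has_derivative ?D) (at x)"
    using assms frechet_derivative_works by blast
  then have lin: "linear ?D"
    by (rule has_derivative_linear)
  have "?D h = (\<Sum>b\<in>Basis. (h \<bullet> b) * ?D b)" for h
  proof -
    have "?D h = ?D (\<Sum>b\<in>Basis. (h \<bullet> b) *\<^sub>R b)"
      by (simp only: euclidean_representation)
    then show ?thesis
      by (simp only: linear_sum[OF lin] linear_cmul[OF lin] real_scaleR_def)
  qed
  then have "?D = (\<lambda>h. \<Sum>b\<in>Basis. (h \<bullet> b) * partial_deriv b f x)"
    unfolding partial_deriv_def by (rule ext)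
  with D show ?thesis
    by simp
qed

lemma C_class_Suc_partial: "C_class (Suc k) f \<Longrightarrow> b \<in> Basis \<Longrightarrow> C_class k (partial_deriv b f)"
  by simp

text \<open>The closure properties below are inductions on \<open>k\<close> through this rule: an
  explicit derivative \<open>D\<close> replaces the Frechet operator, and only its coordinates
  \<open>D x b\<close> have to be of class \<open>k\<close>.\<close>

lemma C_class_SucI:
  assumes "\<And>x. (f has_derivative D x) (at x)" "\<And>b. b \<in> Basis \<Longrightarrow> C_class k (\<lambda>x. D x b)"
  shows "C_class (Suc k) f"
proof -
  have "partial_deriv b f = (\<lambda>x. D x b)" for b
    using partial_deriv_eq[OF assms(1)] by blast
  then show ?thesis
    using assms by (auto simp: differentiable_def)
qed

lemma C_class_continuous: "C_class k f \<Longrightarrow> continuous_on UNIV f"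
  by (cases k) (auto intro!: continuous_at_imp_continuous_on differentiable_imp_continuous_within)

lemma C_class_Suc_imp: "C_class (Suc k) f \<Longrightarrow> C_class k f"
proof (induction k arbitrary: f)
  case 0
  then show ?case
    using C_class_continuous by fastforce
next
  case (Suc k)
  then show ?case
    by (metis C_class.simps(2))
qed

lemma C_class_mono: "C_class n f \<Longrightarrow> k \<le> n \<Longrightarrow> C_class k f"
  by (induction n) (use C_class_Suc_imp le_Suc_eq in blast)+

lemma C_class_2D: "C_class 2 f \<Longrightarrow> C_class (Suc (Suc 0)) f"
  by (simp only: numeral_2_eq_2)

lemma C_class_has_derivative:
  assumes "C_class k f" "0 < k"
  shows "(f has_derivative (\<lambda>h. \<Sum>b\<in>Basis. (h \<bullet> b) * partial_deriv b f x)) (at x)"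
  using assms by (intro has_derivative_partial_deriv) (cases k; auto)

lemma C_class_const [simp]: "C_class k (\<lambda>x. c)"
proof (induction k arbitrary: c)
  case (Suc k)
  show ?case
    by (rule C_class_SucI[where D="\<lambda>_ _. 0"]) (use Suc in auto)
qed simp

lemma C_class_add:
  "C_class k f \<Longrightarrow> C_class k g \<Longrightarrow> C_class k (\<lambda>x. f x + g x)"
proof (induction k arbitrary: f g)
  case 0
  then show ?case by (simp add: continuous_on_add)
next
  case (Suc k)
  show ?case
    by (rule C_class_SucI, rule has_derivative_add[OF C_class_has_derivative[OF Suc.prems(1)] C_class_has_derivative[OF Suc.prems(2)]])
      (use Suc in \<open>auto simp: sum_inner_Basis\<close>)
qed

lemma C_class_mult:
  "C_class k f \<Longrightarrow> C_class k g \<Longrightarrow> C_class k (\<lambda>x. f x * g x)"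
proof (induction k arbitrary: f g)
  case 0
  then show ?case by (simp add: continuous_on_mult)
next
  case (Suc k)
  note fg = Suc.prems[THEN C_class_Suc_imp]
  have "((\<lambda>x. f x * g x) has_derivative
      (\<lambda>h. f x * (\<Sum>b\<in>Basis. (h \<bullet> b) * partial_deriv b g x) + (\<Sum>b\<in>Basis. (h \<bullet> b) * partial_deriv b f x) * g x)) (at x)" for x
    by (intro has_derivative_mult C_class_has_derivative[OF Suc.prems(1)] C_class_has_derivative[OF Suc.prems(2)]) auto
  then show ?case
  proof (rule C_class_SucI)
    fix b :: 'a assume b: "b \<in> Basis"
    have "C_class k (\<lambda>x. f x * partial_deriv b g x + partial_deriv b f x * g x)"
      using Suc.prems[THEN C_class_Suc_partial[OF _ b]] fg by (intro C_class_add Suc.IH)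
    then show "C_class k (\<lambda>x. f x * (\<Sum>i\<in>Basis. (b \<bullet> i) * partial_deriv i g x)
        + (\<Sum>i\<in>Basis. (b \<bullet> i) * partial_deriv i f x) * g x)"
      by (simp only: sum_inner_Basis[OF b])
  qed
qed

lemma C_class_cmult: "C_class k f \<Longrightarrow> C_class k (\<lambda>x. c * f x)"
  by (intro C_class_mult C_class_const)

lemma C_class_uminus: "C_class k f \<Longrightarrow> C_class k (\<lambda>x. - f x)"
  using C_class_cmult[of k f "-1"] by simp

lemma C_class_sum: "(\<And>i. i \<in> I \<Longrightarrow> C_class k (f i)) \<Longrightarrow> C_class k (\<lambda>x. \<Sum>i\<in>I. f i x)"
  by (induction I rule: infinite_finite_induct) (auto intro: C_class_add)

lemma has_derivative_powr_const:
  assumes "(f has_derivative f') (at x)" "f x > (0::real)"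
  shows "((\<lambda>x. f x powr a) has_derivative (\<lambda>h. a * f x powr (a - 1) * f' h)) (at x)"
  using has_derivative_powr[OF assms(1) has_derivative_const[of a] assms(2)] assms(2)
  by (auto elim!: has_derivative_eq_rhs simp: fun_eq_iff powr_diff field_simps)

lemma C_class_powr:
  "C_class k f \<Longrightarrow> (\<And>x. f x > 0) \<Longrightarrow> C_class k (\<lambda>x. f x powr a)"
proof (induction k arbitrary: a)
  case 0
  then show ?case by (auto intro!: continuous_on_powr continuous_on_const simp: order.strict_iff_order)
next
  case (Suc k)
  note f = C_class_Suc_imp[OF Suc.prems(1)]
  show ?case
    by (rule C_class_SucI, rule has_derivative_powr_const[OF C_class_has_derivative[OF Suc.prems(1)] Suc.prems(2)], simp,
      simp only: sum_inner_Basis)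
      (intro C_class_mult C_class_const Suc.IH f Suc.prems(2) C_class_Suc_partial[OF Suc.prems(1)])
qed

lemma C_class_inner [simp]: "C_class k (\<lambda>x. (x - a) \<bullet> b)"
proof (cases k)
  case (Suc n)
  have "C_class (Suc n) (\<lambda>x. (x - a) \<bullet> b)"
    by (rule C_class_SucI[where D="\<lambda>x h. h \<bullet> b"]) (auto intro!: derivative_eq_intros)
  then show ?thesis using Suc by simp
qed (auto intro!: continuous_intros)

lemma C_class_laplacian: "C_class (Suc (Suc k)) f \<Longrightarrow> C_class k (laplacian f)"
  unfolding laplacian_def by (rule C_class_sum) simp

lemma partial_deriv_add:
  assumes "C_class (Suc k) f" "C_class (Suc l) g" "b \<in> Basis"
  shows "partial_deriv b (\<lambda>x. f x + g x) = (\<lambda>x. partial_deriv b f x + partial_deriv b g x)"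
  by (rule ext, subst partial_deriv_eq[OF has_derivative_add[OF C_class_has_derivative[OF assms(1)] C_class_has_derivative[OF assms(2)]]])
    (use assms in \<open>auto simp: sum_inner_Basis\<close>)

lemma partial_deriv_mult:
  assumes "C_class (Suc k) f" "C_class (Suc l) g" "b \<in> Basis"
  shows "partial_deriv b (\<lambda>x. f x * g x) = (\<lambda>x. f x * partial_deriv b g x + partial_deriv b f x * g x)"
  by (rule ext, subst partial_deriv_eq[OF has_derivative_mult[OF C_class_has_derivative[OF assms(1)] C_class_has_derivative[OF assms(2)]]])
    (use assms in \<open>auto simp: sum_inner_Basis\<close>)

lemma partial_deriv_const [simp]: "partial_deriv b (\<lambda>x. c) = (\<lambda>x. 0)"
  by (simp add: partial_deriv_def)

lemma partial_deriv_cmult: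
  assumes "C_class (Suc k) f" "b \<in> Basis"
  shows "partial_deriv b (\<lambda>x. c * f x) = (\<lambda>x. c * partial_deriv b f x)"
  using partial_deriv_mult[OF C_class_const[of "Suc 0"] assms, of c] by simp

lemma partial_deriv_powr:
  assumes "C_class (Suc k) f" "\<And>x. f x > 0" "b \<in> Basis"
  shows "partial_deriv b (\<lambda>x. f x powr a) = (\<lambda>x. a * f x powr (a - 1) * partial_deriv b f x)"
  by (rule ext, subst partial_deriv_eq[OF has_derivative_powr_const[OF C_class_has_derivative[OF assms(1)] assms(2)]])
    (use assms in \<open>auto simp: sum_inner_Basis\<close>)

section \<open>Gradient products, and the Laplacian of products and powers\<close>

definition grad_dot :: "('a::euclidean_space \<Rightarrow> real) \<Rightarrow> ('a \<Rightarrow> real) \<Rightarrow> 'a \<Rightarrow> real" where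
  "grad_dot f g = (\<lambda>x. \<Sum>b\<in>Basis. partial_deriv b f x * partial_deriv b g x)"

lemma laplacian_cmult:
  assumes "C_class 2 f"
  shows "laplacian (\<lambda>x. c * f x) = (\<lambda>x. c * laplacian f x)"
proof -
  from C_class_2D[OF assms] show ?thesis
    unfolding laplacian_def
    by (simp add: partial_deriv_cmult[of "Suc 0" f] partial_deriv_cmult[of 0 "partial_deriv _ f"] sum_distrib_left)
qed

lemma laplacian_add:
  assumes "C_class 2 f" "C_class 2 g"
  shows "laplacian (\<lambda>x. f x + g x) = (\<lambda>x. laplacian f x + laplacian g x)"
proof -
  note fg = assms[THEN C_class_2D]
  have "partial_deriv b (\<lambda>x. partial_deriv b f x + partial_deriv b g x)
      = (\<lambda>x. partial_deriv b (partial_deriv b f) x + partial_deriv b (partial_deriv b g) x)"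
    if "b \<in> Basis" for b
    using that fg by (intro partial_deriv_add[of 0 _ 0]) auto
  then show ?thesis
    unfolding laplacian_def using partial_deriv_add[OF fg] by (simp add: sum.distrib)
qed

lemma laplacian_mult:
  assumes "C_class 2 f" "C_class 2 g"
  shows "laplacian (\<lambda>x. f x * g x) = (\<lambda>x. laplacian f x * g x + 2 * grad_dot f g x + f x * laplacian g x)"
proof -
  note fg = assms[THEN C_class_2D]
  note fg1 = fg[THEN C_class_Suc_imp]
  have "partial_deriv b (partial_deriv b (\<lambda>x. f x * g x))
      = (\<lambda>x. partial_deriv b (partial_deriv b f) x * g x + 2 * (partial_deriv b f x * partial_deriv b g x)
           + f x * partial_deriv b (partial_deriv b g) x)"
    if b: "b \<in> Basis" for b
  proof -
    note p = fg[THEN C_class_Suc_partial[OF _ b]]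
    show ?thesis
      by (simp only: partial_deriv_mult[OF fg b] partial_deriv_add[OF C_class_mult C_class_mult b, OF fg1(1) p(2) p(1) fg1(2)]
          partial_deriv_mult[OF fg1(1) p(2) b] partial_deriv_mult[OF p(1) fg1(2) b])
        (simp add: fun_eq_iff)
  qed
  then show ?thesis
    unfolding laplacian_def grad_dot_def by (simp add: sum.distrib sum_distrib_left sum_distrib_right)
qed

lemma grad_dot_mult_left:
  assumes "C_class (Suc k) f" "C_class (Suc l) g"
  shows "grad_dot (\<lambda>x. f x * g x) h = (\<lambda>x. f x * grad_dot g h x + g x * grad_dot f h x)"
  unfolding grad_dot_def using partial_deriv_mult[OF assms]
  by (simp add: sum_distrib_left sum.distrib[symmetric] algebra_simps)

lemma grad_dot_commute: "grad_dot f g = grad_dot g f"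
  unfolding grad_dot_def by (simp add: mult.commute)

lemma grad_dot_powr_left:
  assumes "C_class (Suc k) f" "\<And>x. f x > 0"
  shows "grad_dot (\<lambda>x. f x powr a) g = (\<lambda>x. a * f x powr (a - 1) * grad_dot f g x)"
  unfolding grad_dot_def using partial_deriv_powr[OF assms]
  by (simp add: sum_distrib_left algebra_simps)

lemma grad_dot_self_nonneg: "grad_dot f f x \<ge> 0"
  unfolding grad_dot_def by (intro sum_nonneg) auto

lemma grad_dot_cauchy_schwarz: "(grad_dot f g x)\<^sup>2 \<le> grad_dot f f x * grad_dot g g x"
  unfolding grad_dot_def power2_eq_square[symmetric] by (rule Cauchy_Schwarz_ineq_sum)

lemma laplacian_powr:
  assumes "C_class 2 f" "\<And>x. f x > 0"
  shows "laplacian (\<lambda>x. f x powr a)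
       = (\<lambda>x. a * f x powr (a - 1) * laplacian f x + a * (a - 1) * f x powr (a - 2) * grad_dot f f x)"
proof -
  note f = C_class_2D[OF assms(1)]
  note f1 = C_class_Suc_imp[OF f]
  have "partial_deriv b (partial_deriv b (\<lambda>x. f x powr a))
      = (\<lambda>x. a * f x powr (a - 1) * partial_deriv b (partial_deriv b f) x
          + a * (a - 1) * f x powr (a - 2) * (partial_deriv b f x * partial_deriv b f x))"
    if b: "b \<in> Basis" for b
  proof -
    note p = C_class_Suc_partial[OF f b]
    show ?thesis
      by (simp only: partial_deriv_powr[OF f assms(2) b] mult.assoc
          partial_deriv_cmult[OF C_class_mult[OF C_class_powr[OF f1 assms(2)] p] b]
          partial_deriv_mult[OF C_class_powr[OF f1 assms(2)] p b] partial_deriv_powr[OF f1 assms(2) b])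
        (simp add: fun_eq_iff algebra_simps)
  qed
  then show ?thesis
    unfolding laplacian_def grad_dot_def by (simp add: sum.distrib sum_distrib_left)
qed

section \<open>Second derivatives along the axes at a maximum\<close>

lemma has_derivative_along_line:
  fixes f :: "'a::euclidean_space \<Rightarrow> real"
  assumes "C_class (Suc k) f" "b \<in> Basis"
  shows "((\<lambda>t. f (x + t *\<^sub>R b)) has_real_derivative partial_deriv b f (x + t *\<^sub>R b)) (at t)"
proof -
  have "((\<lambda>t. x + t *\<^sub>R b) has_derivative (\<lambda>h. h *\<^sub>R b)) (at t)"
    by (auto intro!: derivative_eq_intros)
  from has_derivative_compose[OF this C_class_has_derivative[OF assms(1)]]
  show ?thesis
    using assms(2)
    by (auto simp: has_field_derivative_def sum_inner_Basis mult_commute_abs mult.assoc sum_distrib_left[symmetric])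
qed

text \<open>The Laplacian contains only pure second derivatives, so the one-variable test along each
  axis replaces the Hessian: a positive second derivative would make \<open>f\<close> increase
  strictly away from its maximum.\<close>

lemma global_max_partial_deriv:
  fixes f :: "'a::euclidean_space \<Rightarrow> real"
  assumes f: "C_class 2 f" and max: "\<And>y. f y \<le> f x" and b: "b \<in> Basis"
  shows "partial_deriv b f x = 0" "partial_deriv b (partial_deriv b f) x \<le> 0"
proof -
  note f2 = C_class_2D[OF f]
  let ?g = "\<lambda>t. f (x + t *\<^sub>R b)" and ?g' = "\<lambda>t. partial_deriv b f (x + t *\<^sub>R b)"
  note d1 = has_derivative_along_line[OF f2 b, of x]
  note d2 = has_derivative_along_line[OF C_class_Suc_partial[OF f2 b] b, of x 0]
  have zero: "?g' 0 = 0"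
    by (rule DERIV_local_max[OF d1, of 1]) (auto intro: max)
  then show "partial_deriv b f x = 0" by simp
  show "partial_deriv b (partial_deriv b f) x \<le> 0"
  proof (rule ccontr)
    assume "\<not> ?thesis"
    then have "0 < partial_deriv b (partial_deriv b f) (x + 0 *\<^sub>R b)" by simp
    from DERIV_pos_inc_right[OF d2 this] obtain d where d: "d > 0" "\<And>h. 0 < h \<Longrightarrow> h < d \<Longrightarrow> ?g' h > 0"
      using zero by auto
    have "?g 0 < ?g (d / 2)"
      by (rule DERIV_pos_imp_increasing_open[of 0 "d/2"])
        (use d in \<open>auto intro!: continuous_at_imp_continuous_on DERIV_isCont[OF d1] exI[of _ "?g' _"] d1\<close>)
    with max[of "x + (d / 2) *\<^sub>R b"] show False by simp
  qed
qed

lemma global_max_laplacian: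
  assumes "C_class 2 f" "\<And>y. f y \<le> f x"
  shows "laplacian f x \<le> 0" "grad_dot f g x = 0"
  using global_max_partial_deriv[OF assms] by (auto simp: laplacian_def grad_dot_def intro: sum_nonpos)

subsection \<open>Integration of compactly supported functions\<close>

text \<open>The space of continuous functions with compact support. In finite dimension boundedness
  of the nonvanishing set is equivalent to compactness of its closure, and it passes to subsets
  directly.\<close>

definition Cc :: "('a::euclidean_space \<Rightarrow> real) \<Rightarrow> bool" where
  "Cc f \<longleftrightarrow> continuous_on UNIV f \<and> bounded {x. f x \<noteq> 0}"

lemma CcI: "continuous_on UNIV f \<Longrightarrow> bounded {x. g x \<noteq> (0::real)} \<Longrightarrow> (\<And>x. g x = 0 \<Longrightarrow> f x = 0) \<Longrightarrow> Cc f"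
  unfolding Cc_def by (auto elim: bounded_subset)

lemma Cc_continuous: "Cc f \<Longrightarrow> continuous_on UNIV f"
  by (simp add: Cc_def)

lemma C_class_Cc: "C_class k f \<Longrightarrow> bounded {x. f x \<noteq> 0} \<Longrightarrow> Cc f"
  by (simp add: Cc_def C_class_continuous)

lemma Cc_zero_outside:
  assumes "Cc f"
  obtains r where "0 < r" "\<And>x. r \<le> norm x \<Longrightarrow> f x = 0"
proof -
  obtain r where "\<And>x. f x \<noteq> 0 \<Longrightarrow> norm x \<le> r"
    using assms by (auto simp: Cc_def bounded_iff)
  then have "\<And>x. \<bar>r\<bar> + 1 \<le> norm x \<Longrightarrow> f x = 0"
    by force
  then show thesis
    by (rule that[rotated]) auto
qed

lemma Cc_bounded:
  assumes "Cc f"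
  obtains B where "0 < B" "\<And>x. \<bar>f x\<bar> \<le> B"
proof -
  obtain r where r: "0 < r" "\<And>x. r \<le> norm x \<Longrightarrow> f x = 0"
    using Cc_zero_outside[OF assms] by blast
  have "compact (f ` cball 0 r)"
    using assms by (intro compact_continuous_image) (auto simp: Cc_def intro: continuous_on_subset)
  then obtain B where B: "\<And>y. y \<in> f ` cball 0 r \<Longrightarrow> norm y \<le> B"
    using compact_imp_bounded bounded_iff by metis
  have "\<bar>f x\<bar> \<le> \<bar>B\<bar> + 1" for x
  proof (cases "norm x \<le> r")
    case True
    then have "norm (f x) \<le> B" by (intro B) auto
    then show ?thesis by simp
  qed (use r in simp)
  then show thesis
    by (rule that[rotated]) auto
qed

lemma Cc_integrable:
  assumes "Cc f"
  shows "integrable lborel f"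
proof -
  obtain r where r: "0 < r" "\<And>x. r \<le> norm x \<Longrightarrow> f x = 0"
    using Cc_zero_outside[OF assms] by blast
  have "integrable lborel (\<lambda>x. indicator (cball 0 r) x *\<^sub>R f x)"
    by (rule borel_integrable_compact) (use assms in \<open>auto simp: Cc_def intro: continuous_on_subset\<close>)
  moreover have "(\<lambda>x. indicator (cball 0 r) x *\<^sub>R f x) = f"
    using r by (fastforce simp: indicator_def)
  ultimately show ?thesis by simp
qed

lemma Cc_mult_left: "continuous_on UNIV g \<Longrightarrow> Cc f \<Longrightarrow> Cc (\<lambda>x. g x * f x)"
  by (rule CcI[of _ f]) (auto simp: Cc_def intro: continuous_on_mult)

lemma Cc_mult_right: "Cc f \<Longrightarrow> continuous_on UNIV g \<Longrightarrow> Cc (\<lambda>x. f x * g x)"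
  using Cc_mult_left[of g f] by (simp add: mult.commute)

lemma Cc_mult: "Cc f \<Longrightarrow> Cc g \<Longrightarrow> Cc (\<lambda>x. f x * g x)"
  by (intro Cc_mult_right) (auto simp: Cc_def)

lemma Cc_cmult: "Cc f \<Longrightarrow> Cc (\<lambda>x. c * f x)"
  by (intro Cc_mult_left) auto

lemma Cc_add:
  assumes "Cc f" "Cc g"
  shows "Cc (\<lambda>x. f x + g x)"
proof -
  have "bounded ({x. f x \<noteq> 0} \<union> {x. g x \<noteq> 0})"
    using assms by (simp add: Cc_def)
  then have "bounded {x. f x + g x \<noteq> 0}"
    by (rule bounded_subset) auto
  then show ?thesis
    using assms by (simp add: Cc_def continuous_on_add)
qed

lemma Cc_uminus: "Cc f \<Longrightarrow> Cc (\<lambda>x. - f x)"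
  using Cc_cmult[of f "-1"] by simp

lemma Cc_sum: "(\<And>i. i \<in> I \<Longrightarrow> Cc (f i)) \<Longrightarrow> Cc (\<lambda>x. \<Sum>i\<in>I. f i x)"
  by (induction I rule: infinite_finite_induct) (simp_all add: Cc_add, simp_all add: Cc_def)

lemma Cc_power2: "Cc f \<Longrightarrow> Cc (\<lambda>x. (f x)\<^sup>2)"
  unfolding power2_eq_square by (rule Cc_mult)

lemma partial_deriv_zero_outside:
  assumes "x \<notin> closure {x. f x \<noteq> 0}"
  shows "partial_deriv b f x = 0"
proof -
  have "(f has_derivative (\<lambda>h. 0)) (at x)"
    by (rule has_derivative_transform_within_open[of "\<lambda>_. 0" _ _ _ "- closure {x. f x \<noteq> 0}"])
      (use assms closure_subset[of "{x. f x \<noteq> 0}"] in auto)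
  then show ?thesis
    by (simp add: partial_deriv_eq)
qed

lemma bounded_support_partial_deriv:
  assumes "bounded {x. f x \<noteq> 0}"
  shows "bounded {x. partial_deriv b f x \<noteq> 0}"
  using bounded_closure[OF assms] by (rule bounded_subset) (use partial_deriv_zero_outside in blast)

lemma Cc_partial_deriv:
  assumes "C_class (Suc k) f" "bounded {x. f x \<noteq> 0}" "b \<in> Basis"
  shows "Cc (partial_deriv b f)"
  unfolding Cc_def using assms bounded_support_partial_deriv C_class_continuous[OF C_class_Suc_partial] by blast

lemma continuous_grad_dot:
  "C_class (Suc k) f \<Longrightarrow> C_class (Suc l) g \<Longrightarrow> continuous_on UNIV (grad_dot f g)"
  unfolding grad_dot_def
  by (intro continuous_on_sum continuous_on_mult C_class_continuous[OF C_class_Suc_partial])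

lemma Cc_grad_dot:
  assumes "C_class (Suc k) f" "C_class (Suc l) g" "bounded {x. f x \<noteq> 0}"
  shows "Cc (grad_dot f g)"
  unfolding grad_dot_def
  by (intro Cc_sum Cc_mult_right Cc_partial_deriv[OF assms(1,3)] C_class_continuous[OF C_class_Suc_partial[OF assms(2)]])

lemma Cc_laplacian:
  assumes "C_class 2 f" "bounded {x. f x \<noteq> 0}"
  shows "Cc (laplacian f)"
proof -
  note f = C_class_2D[OF assms(1)]
  show ?thesis
    unfolding laplacian_def
    by (intro Cc_sum Cc_partial_deriv[OF C_class_Suc_partial[OF f] bounded_support_partial_deriv[OF assms(2)]])
qed

lemma continuous_laplacian: "C_class 2 f \<Longrightarrow> continuous_on UNIV (laplacian f)"
  by (rule C_class_continuous[OF C_class_laplacian[OF C_class_2D]])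

text \<open>The mean value inequality bounds the remainder quotient by \<open>2 * g\<close>, so
  dominated convergence applies along every sequence of increments tending to 0.\<close>

lemma has_derivative_integral_dominated:
  fixes f :: "'a::euclidean_space \<Rightarrow> 'b \<Rightarrow> real"
  assumes der: "\<And>x y. ((\<lambda>x. f x y) has_derivative f' x y) (at x)"
    and int_f: "\<And>x. integrable M (f x)" and int_f': "\<And>h. integrable M (\<lambda>y. f' a y h)"
    and bound: "\<And>x y h. dist x a < 1 \<Longrightarrow> \<bar>f' x y h\<bar> \<le> g y * norm h" and int_g: "integrable M g"
  shows "((\<lambda>x. \<integral>y. f x y \<partial>M) has_derivative (\<lambda>h. \<integral>y. f' a y h \<partial>M)) (at a)"
  unfolding has_derivative_at
proof
  have lin: "linear (f' x y)" for x y
    using der has_derivative_linear by blast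
  have "linear (\<lambda>h. \<integral>y. f' a y h \<partial>M)"
    by (rule linearI) (simp_all add: linear_add[OF lin] linear_cmul[OF lin] int_f')
  then show "bounded_linear (\<lambda>h. \<integral>y. f' a y h \<partial>M)"
    by (simp add: linear_conv_bounded_linear)
  \<comment> \<open>Putting 0 for \<open>norm h \<ge> 1\<close> makes the bound \<open>2 * g\<close>
    valid for every \<open>h\<close>, so that sequences of increments need no truncation.\<close>
  define q where "q h y = (if norm h < 1 then \<bar>f (a + h) y - f a y - f' a y h\<bar> / norm h else 0)" for h y
  have q_meas: "q h \<in> borel_measurable M" for h
    unfolding q_def using int_f int_f' by (auto dest!: borel_measurable_integrable)
  have q_bound: "\<bar>q h y\<bar> \<le> 2 * g y" for h y
  proof (cases "norm h < 1 \<and> h \<noteq> 0")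
    case True
    have "norm (f (a + h) y - f a y) \<le> g y * norm (a + h - a)"
    proof (rule differentiable_bound[of "ball a 1" _ "\<lambda>x. f' x y"])
      show "onorm (f' x y) \<le> g y" if "x \<in> ball a 1" for x
        by (rule onorm_le) (use that bound in \<open>auto simp: dist_commute\<close>)
      show "((\<lambda>x. f x y) has_derivative f' x y) (at x within ball a 1)" for x
        using der by (rule has_derivative_at_withinI)
    qed (use True in \<open>auto simp: dist_norm\<close>)
    moreover have "\<bar>f' a y h\<bar> \<le> g y * norm h"
      by (rule bound) simp
    ultimately have "\<bar>f (a + h) y - f a y - f' a y h\<bar> \<le> 2 * g y * norm h"
      by simp
    then show ?thesis
      using True by (simp add: q_def field_simps)
  next
    case False
    \<comment> \<open>Testing \<open>bound\<close> on a unit vector shows that \<open>g\<close> is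
      nonnegative.\<close>
    obtain b :: 'a where "b \<in> Basis" using nonempty_Basis by blast
    then have "0 \<le> g y" using order_trans[OF abs_ge_zero bound[of a y b]] by simp
    then show ?thesis using False by (auto simp: q_def)
  qed
  have q_lim: "(\<lambda>h. q h y) \<midarrow>0\<rightarrow> 0" for y
  proof -
    have "(\<lambda>h. norm (f (a + h) y - f a y - f' a y h) / norm h) \<midarrow>0\<rightarrow> 0"
      using der[of y a] by (simp add: has_derivative_at)
    moreover have "\<forall>\<^sub>F h in at 0. norm (f (a + h) y - f a y - f' a y h) / norm h = q h y"
      unfolding eventually_at by (rule exI[of _ 1]) (auto simp: q_def)
    ultimately show ?thesis
      by (rule Lim_transform_eventually)
  qed
  have q_int: "(\<lambda>h. \<integral>y. q h y \<partial>M) \<midarrow>0\<rightarrow> 0"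
    unfolding tendsto_at_iff_sequentially comp_def
  proof (intro allI impI)
    fix X :: "nat \<Rightarrow> 'a" assume X: "\<forall>i. X i \<in> UNIV - {0}" "X \<longlonglongrightarrow> 0"
    have "(\<lambda>i. \<integral>y. q (X i) y \<partial>M) \<longlonglongrightarrow> (\<integral>y. 0 \<partial>M)"
    proof (rule integral_dominated_convergence[where w="\<lambda>y. 2 * g y"])
      show "AE y in M. (\<lambda>i. q (X i) y) \<longlonglongrightarrow> 0"
        using q_lim X unfolding tendsto_at_iff_sequentially comp_def by auto
    qed (use q_meas q_bound int_g in auto)
    then show "(\<lambda>i. \<integral>y. q (X i) y \<partial>M) \<longlonglongrightarrow> 0" by simp
  qed
  show "(\<lambda>h. norm ((\<integral>y. f (a + h) y \<partial>M) - (\<integral>y. f a y \<partial>M) - (\<integral>y. f' a y h \<partial>M)) / norm h) \<midarrow>0\<rightarrow> 0"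
  proof (rule tendsto_sandwich[OF _ _ tendsto_const q_int])
    show "\<forall>\<^sub>F h in at 0. norm ((\<integral>y. f (a + h) y \<partial>M) - (\<integral>y. f a y \<partial>M) - (\<integral>y. f' a y h \<partial>M)) / norm h \<le> (\<integral>y. q h y \<partial>M)"
      unfolding eventually_at
    proof (intro exI[of _ "1::real"] conjI ballI impI)
      fix h :: 'a assume h: "h \<noteq> 0 \<and> dist h 0 < 1"
      have "norm ((\<integral>y. f (a + h) y \<partial>M) - (\<integral>y. f a y \<partial>M) - (\<integral>y. f' a y h \<partial>M))
          = norm (\<integral>y. f (a + h) y - f a y - f' a y h \<partial>M)"
        by (simp add: int_f int_f')
      also have "\<dots> \<le> (\<integral>y. norm (f (a + h) y - f a y - f' a y h) \<partial>M)"
        by (rule integral_norm_bound)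
      also have "\<dots> = norm h * (\<integral>y. q h y \<partial>M)"
        using h by (simp add: q_def)
      finally show "norm ((\<integral>y. f (a + h) y \<partial>M) - (\<integral>y. f a y \<partial>M) - (\<integral>y. f' a y h \<partial>M)) / norm h \<le> (\<integral>y. q h y \<partial>M)"
        using h by (simp add: field_simps)
    qed simp
  qed (simp add: always_eventually)
qed

section \<open>Translation invariance and integration by parts\<close>

lemma integral_lborel_shift:
  fixes f :: "'a::euclidean_space \<Rightarrow> real"
  assumes "f \<in> borel_measurable borel"
  shows "(LBINT x. f (x + c)) = (LBINT x. f x)"
proof -
  have "(LBINT x. f x) = (\<integral>x. f x \<partial>distr lborel borel ((+) c))"
    by (simp add: lborel_distr_plus)
  also have "\<dots> = (LBINT x. f (c + x))"
    by (rule integral_distr) (use assms in auto)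
  finally show ?thesis by (simp add: add.commute)
qed

lemma Cc_shift:
  assumes "Cc f"
  shows "Cc (\<lambda>x. f (x + c))"
proof -
  obtain r where r: "0 < r" "\<And>x. r \<le> norm x \<Longrightarrow> f x = 0"
    using Cc_zero_outside[OF assms] by blast
  have "norm x \<le> r + norm c" if "f (x + c) \<noteq> 0" for x
  proof -
    have "norm (x + c) < r" using r(2) that not_le by blast
    then show ?thesis using norm_diff_ineq[of x c] by simp
  qed
  then have "bounded {x. f (x + c) \<noteq> 0}"
    by (auto simp: bounded_iff)
  then show ?thesis
    using assms unfolding Cc_def by (auto intro!: continuous_on_compose2[of UNIV f] continuous_intros)
qed

lemma integrable_indicator_cball: "integrable lborel (\<lambda>x::'a::euclidean_space. (B::real) * indicator (cball 0 r) x)"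
  by (intro integrable_mult_right integrable_real_indicator emeasure_compact_finite) auto

text \<open>By translation invariance the integral of \<open>F (x + t *\<^sub>R b)\<close> is
  constant in \<open>t\<close>, and its derivative at 0 is the integral in question. No iterated
  integration along lines is needed.\<close>

lemma integral_partial_deriv_eq_0:
  fixes F :: "'a::euclidean_space \<Rightarrow> real"
  assumes F: "C_class (Suc k) F" "bounded {x. F x \<noteq> 0}" and b: "b \<in> Basis"
  shows "(LBINT x. partial_deriv b F x) = 0"
proof -
  have Fc: "Cc F"
    using C_class_Cc F by blast
  have pc: "Cc (partial_deriv b F)"
    by (rule Cc_partial_deriv[OF F b])
  obtain B where B: "0 < B" "\<And>x. \<bar>partial_deriv b F x\<bar> \<le> B"
    using Cc_bounded[OF pc] by blast
  obtain r where r: "0 < r" "\<And>x. r \<le> norm x \<Longrightarrow> partial_deriv b F x = 0"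
    using Cc_zero_outside[OF pc] by blast
  have "((\<lambda>t. LBINT x. F (x + t *\<^sub>R b)) has_derivative (\<lambda>h. LBINT x. h * partial_deriv b F (x + 0 *\<^sub>R b))) (at (0::real))"
  \<comment> \<open>For \<open>\<bar>t\<bar> < 1\<close> the shifted derivative vanishes outside
    radius \<open>r + 1\<close>, which gives a common majorant.\<close>
  proof (rule has_derivative_integral_dominated[where g="\<lambda>x. B * indicator (cball 0 (r + 1)) x"])
    show "((\<lambda>t. F (x + t *\<^sub>R b)) has_derivative (\<lambda>h. h * partial_deriv b F (x + t *\<^sub>R b))) (at t)" for t x
      using has_derivative_along_line[OF F(1) b, of x t] by (simp add: has_field_derivative_def mult_commute_abs)
    show "integrable lborel (\<lambda>x. F (x + t *\<^sub>R b))" for t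
      by (intro Cc_integrable Cc_shift Fc)
    show "integrable lborel (\<lambda>x. h * partial_deriv b F (x + 0 *\<^sub>R b))" for h
      by (intro integrable_mult_right Cc_integrable Cc_shift pc)
    show "integrable lborel (\<lambda>x::'a. B * indicator (cball 0 (r + 1)) x)"
      by (rule integrable_indicator_cball)
    show "\<bar>h * partial_deriv b F (x + t *\<^sub>R b)\<bar> \<le> B * indicator (cball 0 (r + 1)) x * norm h"
      if "dist t 0 < 1" for t x and h :: real
    proof (cases "norm x \<le> r + 1")
      case True
      then show ?thesis
        using B(2)[of "x + t *\<^sub>R b"] mult_left_mono[of "\<bar>partial_deriv b F (x + t *\<^sub>R b)\<bar>" B "\<bar>h\<bar>"]
        by (simp add: abs_mult mult.commute)
    next
      case False
      have "norm (t *\<^sub>R b) < 1"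
        using that b by simp
      then have "r \<le> norm (x + t *\<^sub>R b)"
        using False norm_diff_ineq[of x "t *\<^sub>R b"] by simp
      then show ?thesis
        using r(2) B(1) by (simp add: indicator_def)
    qed
  qed
  moreover have "(\<lambda>t. LBINT x. F (x + t *\<^sub>R b)) = (\<lambda>t. LBINT x. F x)"
    using Fc by (intro ext integral_lborel_shift) (simp add: Cc_def borel_measurable_continuous_onI)
  ultimately have "((\<lambda>t. LBINT x. F x) has_derivative (\<lambda>h. LBINT x. h * partial_deriv b F (x + 0 *\<^sub>R b))) (at (0::real))"
    by simp
  from has_derivative_unique[OF this has_derivative_const]
  show ?thesis
    by (simp add: fun_eq_iff) (metis zero_neq_one)
qed

lemma integral_by_parts_partial_deriv:
  fixes f g :: "'a::euclidean_space \<Rightarrow> real"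
  assumes f: "C_class (Suc k) f" "bounded {x. f x \<noteq> 0}" and g: "C_class (Suc l) g" and b: "b \<in> Basis"
  shows "(LBINT x. f x * partial_deriv b g x) = - (LBINT x. partial_deriv b f x * g x)"
proof -
  have f1: "C_class (Suc 0) f" and g1: "C_class (Suc 0) g"
    using f(1) g by (auto intro: C_class_mono simp del: C_class.simps)
  have fc: "Cc f"
    using C_class_Cc f by blast
  have "0 = (LBINT x. partial_deriv b (\<lambda>x. f x * g x) x)"
    by (rule integral_partial_deriv_eq_0[symmetric, OF C_class_mult[OF f1 g1] _ b])
      (rule bounded_subset[OF f(2)], auto)
  also have "\<dots> = (LBINT x. f x * partial_deriv b g x + partial_deriv b f x * g x)"
    by (simp only: partial_deriv_mult[OF f1 g1 b])
  also have "\<dots> = (LBINT x. f x * partial_deriv b g x) + (LBINT x. partial_deriv b f x * g x)"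
    by (intro Bochner_Integration.integral_add Cc_integrable Cc_mult_right fc Cc_partial_deriv[OF f b]
        C_class_continuous[OF g] C_class_continuous[OF C_class_Suc_partial[OF g b]])
  finally show ?thesis by simp
qed

lemma green_first:
  fixes f g :: "'a::euclidean_space \<Rightarrow> real"
  assumes f: "C_class (Suc k) f" "bounded {x. f x \<noteq> 0}" and g: "C_class 2 g"
  shows "(LBINT x. f x * laplacian g x) = - (LBINT x. grad_dot f g x)"
proof -
  note g2 = C_class_2D[OF g]
  note p = C_class_Suc_partial[OF g2]
  have fc: "Cc f"
    using C_class_Cc f by blast
  have "(LBINT x. f x * laplacian g x) = (\<Sum>b\<in>Basis. LBINT x. f x * partial_deriv b (partial_deriv b g) x)"
    unfolding laplacian_def sum_distrib_left
    by (intro Bochner_Integration.integral_sum Cc_integrable Cc_mult_right[OF fc] C_class_continuous[OF C_class_Suc_partial[OF p]])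
  also have "\<dots> = (\<Sum>b\<in>Basis. - (LBINT x. partial_deriv b f x * partial_deriv b g x))"
    by (intro sum.cong refl integral_by_parts_partial_deriv[OF f p])
  also have "\<dots> = - (LBINT x. grad_dot f g x)"
    unfolding grad_dot_def
    by (subst Bochner_Integration.integral_sum)
      (auto simp: sum_negf simp del: C_class.simps intro!: Cc_integrable Cc_mult_right Cc_partial_deriv[OF f] C_class_continuous[OF C_class_Suc_partial[OF g2]])
  finally show ?thesis .
qed

lemma green_second:
  fixes f g :: "'a::euclidean_space \<Rightarrow> real"
  assumes f: "C_class 2 f" "bounded {x. f x \<noteq> 0}" and g: "C_class 2 g"
  shows "(LBINT x. f x * laplacian g x) = (LBINT x. laplacian f x * g x)"
proof -
  note f2 = C_class_2D[OF f(1)] and g2 = C_class_2D[OF g]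
  note pf = C_class_Suc_partial[OF f2] and pg = C_class_Suc_partial[OF g2]
  note bf = bounded_support_partial_deriv[OF f(2)]
  have "(LBINT x. laplacian f x * g x) = (\<Sum>b\<in>Basis. LBINT x. partial_deriv b (partial_deriv b f) x * g x)"
    unfolding laplacian_def sum_distrib_right
    by (intro Bochner_Integration.integral_sum Cc_integrable Cc_mult_right Cc_partial_deriv[OF pf bf] C_class_continuous[OF g])
  also have "\<dots> = (\<Sum>b\<in>Basis. - (LBINT x. partial_deriv b f x * partial_deriv b g x))"
    by (intro sum.cong refl) (simp only: integral_by_parts_partial_deriv[OF pf bf g2] minus_minus)
  also have "\<dots> = - (LBINT x. grad_dot f g x)"
    unfolding grad_dot_def
    by (subst Bochner_Integration.integral_sum)
      (auto simp: sum_negf simp del: C_class.simps intro!: Cc_integrable Cc_mult_right Cc_partial_deriv[OF f2 f(2)] C_class_continuous[OF pg])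
  also have "\<dots> = (LBINT x. f x * laplacian g x)"
    by (simp only: green_first[OF f2 f(2) g])
  finally show ?thesis by simp
qed

lemma Cc_integral_pos:
  assumes f: "Cc f" and nonneg: "\<And>x. 0 \<le> f x" and pos: "0 < f a"
  shows "0 < (LBINT x. f x)"
proof -
  have "isCont f a"
    using Cc_continuous[OF f] by (simp add: continuous_on_eq_continuous_at)
  then obtain d where d: "0 < d" "\<And>x. dist x a < d \<Longrightarrow> dist (f x) (f a) < f a / 2"
    using pos unfolding continuous_at_eps_delta by (meson half_gt_zero)
  have int: "integrable lborel (\<lambda>x. (f a / 2) * indicator (ball a d) x)"
    by (intro integrable_mult_right integrable_real_indicator emeasure_bounded_finite) auto
  have "0 < f a / 2 * measure lborel (ball a d)"
    using d(1) pos content_ball_pos[of d a] by simp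
  also have "\<dots> = (LBINT x. (f a / 2) * indicator (ball a d) x)"
    by simp
  also have "\<dots> \<le> (LBINT x. f x)"
  proof (rule integral_mono[OF int Cc_integrable[OF f]])
    show "(f a / 2) * indicator (ball a d) x \<le> f x" for x
      using d(2)[of x] nonneg[of x] by (auto simp: indicator_def dist_commute dist_real_def abs_if split: if_splits)
  qed
  finally show ?thesis .
qed

subsection \<open>Powers of a radial cutoff, and dilations\<close>

text \<open>Powers of this function serve as cutoffs instead of smooth ones: their derivatives are
  explicit in lower powers of the same function, so a derivative on the cutoff costs a known number
  of factors \<open>bump\<close>.\<close>

definition bump :: "'a::euclidean_space \<Rightarrow> real" where
  "bump x = max 0 (1 - x \<bullet> x)"

lemma bump_nonneg [simp]: "0 \<le> bump x"
  by (simp add: bump_def)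

lemma bump_le_1 [simp]: "bump x \<le> 1"
  by (simp add: bump_def)

lemma bump_0 [simp]: "bump 0 = 1"
  by (simp add: bump_def)

lemma bump_minus [simp]: "bump (- x) = bump x"
  by (simp add: bump_def)

lemma bump_eq_0: "1 \<le> norm x \<Longrightarrow> bump x = 0"
  using power_mono[of 1 "norm x" 2] by (simp add: bump_def dot_square_norm)

lemma norm_le_1_if_bump: "bump x \<noteq> 0 \<Longrightarrow> norm x \<le> 1"
  using bump_eq_0[of x] by linarith

lemma bump_power_antimono: "i \<le> j \<Longrightarrow> bump x ^ j \<le> bump x ^ i"
  by (rule power_decreasing) auto

lemma bump_power_mono_scaleR: "1 \<le> R \<Longrightarrow> bump x \<le> bump (x /\<^sub>R R)"
proof -
  assume "1 \<le> R"
  then have "inverse R * inverse R \<le> 1"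
    by (metis inverse_le_1_iff mult_le_one inverse_nonnegative_iff_nonnegative order.trans zero_le_one)
  then have "(inverse R * inverse R) * (x \<bullet> x) \<le> 1 * (x \<bullet> x)"
    by (rule mult_right_mono) auto
  then show ?thesis by (simp add: bump_def)
qed

lemma continuous_on_bump: "continuous_on UNIV bump"
  unfolding bump_def by (intro continuous_intros)

lemma bounded_support_bump_power: "0 < k \<Longrightarrow> bounded {x. bump x ^ k \<noteq> 0}"
  by (rule boundedI[of _ 1]) (auto simp: norm_le_1_if_bump)

lemma Cc_bump_power: "0 < k \<Longrightarrow> Cc (\<lambda>x. bump x ^ k)"
  unfolding Cc_def using bounded_support_bump_power by (auto intro!: continuous_intros continuous_on_bump)

lemma has_real_derivative_max_power:
  assumes "0 < M"
  shows "((\<lambda>t::real. max 0 t ^ Suc M) has_real_derivative real (Suc M) * max 0 t ^ M) (at t)"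
proof -
  consider "t > 0" | "t < 0" | "t = 0" by linarith
  then show ?thesis
  proof cases
    case 1
    show ?thesis
      by (rule has_field_derivative_transform_within_open[of "\<lambda>t. t ^ Suc M" _ _ "{0<..}"])
        (use 1 DERIV_pow[of "Suc M" t] in auto)
  next
    case 2
    show ?thesis
      by (rule has_field_derivative_transform_within_open[of "\<lambda>t. 0" _ _ "{..<0}"])
        (use 2 assms in \<open>auto intro!: derivative_eq_intros\<close>)
  next
    case 3
    \<comment> \<open>At 0 the difference quotient of \<open>max 0 t ^ Suc M\<close> is
      \<open>max 0 z ^ M\<close>, and it tends to 0 because \<open>M\<close> is positive; for
      \<open>M = 0\<close> the kink would remain.\<close>
    have "isCont (\<lambda>z::real. max 0 z ^ M) 0"
      by (intro continuous_intros)
    then show ?thesis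
      unfolding 3 CARAT_DERIV using assms
      by (intro exI[of _ "\<lambda>z. max 0 z ^ M"]) (auto simp: max_def)
  qed
qed

lemma has_derivative_bump_power:
  assumes "0 < M"
  shows "((\<lambda>x. bump x ^ Suc M) has_derivative (\<lambda>h. real (Suc M) * bump x ^ M * (- 2 * (x \<bullet> h)))) (at x)"
proof -
  have "((\<lambda>x. 1 - x \<bullet> x) has_derivative (\<lambda>h. - 2 * (x \<bullet> h))) (at x)"
    by (auto intro!: derivative_eq_intros simp: inner_commute)
  from has_derivative_compose[OF this has_real_derivative_max_power[OF assms, unfolded has_field_derivative_def]]
  show ?thesis unfolding bump_def .
qed

text \<open>The strict inequality is sharp for \<open>k > 0\<close>: the derivatives of order
  \<open>k\<close> of \<open>bump ^ k\<close> jump across the unit sphere.\<close>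

lemma C_class_bump_power: "k < M \<Longrightarrow> C_class k (\<lambda>x::'a::euclidean_space. bump x ^ M)"
proof (induction k arbitrary: M)
  case 0
  then show ?case by (auto intro!: continuous_intros continuous_on_bump)
next
  case (Suc k)
  then obtain n where n: "M = Suc n" "0 < n" "k < n" by (cases M) auto
  show ?case
    unfolding n(1)
  proof (rule C_class_SucI[OF has_derivative_bump_power[OF n(2)]])
    show "C_class k (\<lambda>x. real (Suc n) * bump x ^ n * (- 2 * (x \<bullet> b)))" for b :: 'a
      using C_class_inner[of k 0 b] Suc.IH[OF n(3)] by (intro C_class_mult C_class_const) auto
  qed
qed

lemma partial_deriv_bump_power:
  "0 < M \<Longrightarrow> partial_deriv b (\<lambda>x. bump x ^ Suc M) = (\<lambda>x. real (Suc M) * bump x ^ M * (- 2 * (x \<bullet> b)))"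
  using partial_deriv_eq[OF has_derivative_bump_power] by blast

lemma sum_inner_Basis_square: "(\<Sum>b\<in>Basis. (x \<bullet> b) * (x \<bullet> b)) = x \<bullet> x"
  by (rule euclidean_inner[symmetric])

text \<open>Where \<open>bump\<close> does not vanish, \<open>x \<bullet> x = 1 - bump x\<close>.
  This is what makes the Laplacian of a power of \<open>bump\<close> a combination of powers of
  \<open>bump\<close>.\<close>

lemma bump_power_inner_self: "0 < m \<Longrightarrow> bump x ^ m * (x \<bullet> x) = bump x ^ m - bump x ^ Suc m"
  by (cases "bump x = 0") (auto simp: bump_def max_def algebra_simps split: if_splits)

lemma laplacian_bump_power:
  assumes "0 < m"
  shows "laplacian (\<lambda>x::'a::euclidean_space. bump x ^ (m + 2))
    = (\<lambda>x. 4 * real (m + 2) * real (m + 1) * bump x ^ m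
        - (4 * real (m + 2) * real (m + 1) + 2 * real DIM('a) * real (m + 2)) * bump x ^ (m + 1))"
proof
  fix x :: 'a
  have "partial_deriv b (partial_deriv b (\<lambda>x. bump x ^ (m + 2))) x
      = real (m + 2) * (-2) * (bump x ^ Suc m + (x \<bullet> b) * (real (m + 1) * bump x ^ m * (- 2 * (x \<bullet> b))))"
    if b: "b \<in> Basis" for b
  proof -
    have "((\<lambda>x. real (Suc (Suc m)) * bump x ^ Suc m * (- 2 * (x \<bullet> b))) has_derivative
       (\<lambda>h. real (Suc (Suc m)) * bump x ^ Suc m * (- 2 * (h \<bullet> b))
         + real (Suc (Suc m)) * (real (Suc m) * bump x ^ m * (- 2 * (x \<bullet> h))) * (- 2 * (x \<bullet> b)))) (at x)"
      by (intro has_derivative_mult has_derivative_mult_right has_derivative_inner_left has_derivative_ident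
          has_derivative_bump_power assms)
    from partial_deriv_eq[OF this, of b] show ?thesis
      using partial_deriv_bump_power[of "Suc m" b] b by (simp add: algebra_simps)
  qed
  then have "laplacian (\<lambda>x::'a. bump x ^ (m + 2)) x
     = real (m + 2) * (-2) * (real DIM('a) * bump x ^ Suc m - 2 * real (m + 1) * (bump x ^ m * (\<Sum>b\<in>Basis. (x \<bullet> b) * (x \<bullet> b))))"
  proof -
    assume "\<And>b. b \<in> Basis \<Longrightarrow> partial_deriv b (partial_deriv b (\<lambda>x. bump x ^ (m + 2))) x
      = real (m + 2) * (-2) * (bump x ^ Suc m + (x \<bullet> b) * (real (m + 1) * bump x ^ m * (- 2 * (x \<bullet> b))))"
    then have "laplacian (\<lambda>x::'a. bump x ^ (m + 2)) x
      = (\<Sum>b\<in>Basis. real (m + 2) * (-2) * (bump x ^ Suc m - (2 * real (m + 1) * bump x ^ m) * ((x \<bullet> b) * (x \<bullet> b))))"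
      unfolding laplacian_def by (intro sum.cong refl) (simp only:, simp add: algebra_simps)
    also have "\<dots> = real (m + 2) * (-2) * (real DIM('a) * bump x ^ Suc m - (2 * real (m + 1) * bump x ^ m) * (\<Sum>b\<in>Basis. (x \<bullet> b) * (x \<bullet> b)))"
      by (simp only: sum_distrib_left[symmetric] sum_subtractf sum_constant)
    finally show ?thesis by (simp only: mult.assoc)
  qed
  also have "\<dots> = 4 * real (m + 2) * real (m + 1) * bump x ^ m
        - (4 * real (m + 2) * real (m + 1) + 2 * real DIM('a) * real (m + 2)) * bump x ^ (m + 1)"
    unfolding sum_inner_Basis_square bump_power_inner_self[OF assms] by (simp add: algebra_simps)
  finally show "laplacian (\<lambda>x::'a. bump x ^ (m + 2)) x
     = 4 * real (m + 2) * real (m + 1) * bump x ^ m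
        - (4 * real (m + 2) * real (m + 1) + 2 * real DIM('a) * real (m + 2)) * bump x ^ (m + 1)" .
qed

lemma abs_laplacian_bump_power:
  assumes "0 < m"
  shows "\<bar>laplacian (\<lambda>x::'a::euclidean_space. bump x ^ (m + 2)) x\<bar>
    \<le> (4 * real (m + 2) * real (m + 1) + 2 * real DIM('a) * real (m + 2)) * bump x ^ m"
proof -
  let ?A = "4 * real (m + 2) * real (m + 1)" and ?B = "2 * real DIM('a) * real (m + 2)"
  have "0 \<le> ?A * bump x ^ m" "0 \<le> ?B * bump x ^ m" "?A * bump x ^ (m + 1) \<le> ?A * bump x ^ m"
    "?B * bump x ^ (m + 1) \<le> ?B * bump x ^ m" "0 \<le> ?A * bump x ^ (m + 1)" "0 \<le> ?B * bump x ^ (m + 1)"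
    by (auto intro!: mult_nonneg_nonneg mult_left_mono bump_power_antimono simp del: power_Suc power_add power_Suc2 add_2_eq_Suc' Suc_eq_plus1[symmetric])
  moreover have "laplacian (\<lambda>x::'a. bump x ^ (m + 2)) x = ?A * bump x ^ m - (?A * bump x ^ (m + 1) + ?B * bump x ^ (m + 1))"
    by (simp only: laplacian_bump_power[OF assms] distrib_right)
  moreover have "(?A + ?B) * bump x ^ m = ?A * bump x ^ m + ?B * bump x ^ m"
    by (simp only: distrib_right)
  ultimately show ?thesis by linarith
qed

lemma grad_dot_bump_power:
  assumes "0 < m"
  shows "grad_dot (\<lambda>x. bump x ^ Suc m) (\<lambda>x. bump x ^ Suc m) x = 4 * (real (Suc m))\<^sup>2 * bump x ^ (2 * m) * (x \<bullet> x)"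
proof -
  have "grad_dot (\<lambda>x. bump x ^ Suc m) (\<lambda>x. bump x ^ Suc m) x
     = (\<Sum>b\<in>Basis. 4 * (real (Suc m))\<^sup>2 * bump x ^ (2 * m) * ((x \<bullet> b) * (x \<bullet> b)))"
    unfolding grad_dot_def partial_deriv_bump_power[OF assms]
    by (intro sum.cong refl) (simp only: power2_eq_square mult_2 power_add, simp add: algebra_simps)
  then show ?thesis
    by (simp only: sum_distrib_left[symmetric] sum_inner_Basis_square)
qed

lemma grad_dot_bump_power_le:
  assumes "0 < m"
  shows "grad_dot (\<lambda>x. bump x ^ Suc m) (\<lambda>x. bump x ^ Suc m) x \<le> 4 * (real (Suc m))\<^sup>2 * bump x ^ (2 * m)"
proof -
  have "bump x ^ (2 * m) * (x \<bullet> x) \<le> bump x ^ (2 * m)"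
    using bump_power_inner_self[of "2 * m" x] assms by simp
  then have "4 * (real (Suc m))\<^sup>2 * (bump x ^ (2 * m) * (x \<bullet> x)) \<le> 4 * (real (Suc m))\<^sup>2 * bump x ^ (2 * m)"
    by (rule mult_left_mono) simp
  then show ?thesis
    by (simp only: grad_dot_bump_power[OF assms] mult.assoc)
qed

section \<open>Affine changes of variables\<close>

lemma has_derivative_affine:
  fixes f :: "'a::euclidean_space \<Rightarrow> real"
  assumes "C_class (Suc k) f"
  shows "((\<lambda>x. f (a + r *\<^sub>R x)) has_derivative
     (\<lambda>h. \<Sum>b\<in>Basis. ((r *\<^sub>R h) \<bullet> b) * partial_deriv b f (a + r *\<^sub>R x))) (at x)"
  by (rule has_derivative_compose[OF _ C_class_has_derivative[OF assms]])
    (auto intro!: derivative_eq_intros)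

lemma partial_deriv_affine:
  assumes "C_class (Suc k) f" "b \<in> Basis"
  shows "partial_deriv b (\<lambda>x. f (a + r *\<^sub>R x)) = (\<lambda>x. r * partial_deriv b f (a + r *\<^sub>R x))"
  using partial_deriv_eq[OF has_derivative_affine[OF assms(1)], of b a r]
  by (simp add: fun_eq_iff mult.assoc sum_distrib_left[symmetric] sum_inner_Basis[OF assms(2)] del: C_class.simps)

lemma C_class_affine: "C_class k f \<Longrightarrow> C_class k (\<lambda>x. f (a + r *\<^sub>R x))"
proof (induction k arbitrary: f)
  case 0
  then show ?case by (auto intro!: continuous_on_compose2[of UNIV f] continuous_intros)
next
  case (Suc k)
  show ?case
  proof (rule C_class_SucI[OF has_derivative_affine[OF Suc.prems]])
    fix b :: 'a assume b: "b \<in> Basis"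
    have "C_class k (\<lambda>x. r * partial_deriv b f (a + r *\<^sub>R x))"
      by (rule C_class_cmult[OF Suc.IH[OF C_class_Suc_partial[OF Suc.prems b]]])
    then show "C_class k (\<lambda>x. \<Sum>i\<in>Basis. (r *\<^sub>R b \<bullet> i) * partial_deriv i f (a + r *\<^sub>R x))"
      by (simp add: mult.assoc sum_distrib_left[symmetric] sum_inner_Basis[OF b])
  qed
qed

lemma laplacian_affine:
  assumes "C_class 2 f"
  shows "laplacian (\<lambda>x. f (a + r *\<^sub>R x)) = (\<lambda>x. r\<^sup>2 * laplacian f (a + r *\<^sub>R x))"
proof -
  note f = C_class_2D[OF assms]
  have "partial_deriv b (partial_deriv b (\<lambda>x. f (a + r *\<^sub>R x))) = (\<lambda>x. r * (r * partial_deriv b (partial_deriv b f) (a + r *\<^sub>R x)))"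
    if b: "b \<in> Basis" for b
    by (simp only: partial_deriv_affine[OF f b] partial_deriv_affine[OF C_class_Suc_partial[OF f b] b]
        partial_deriv_cmult[OF C_class_affine[OF C_class_Suc_partial[OF f b]] b])
  then show ?thesis
    unfolding laplacian_def by (simp add: sum_distrib_left power2_eq_square mult.assoc)
qed

lemma grad_dot_affine:
  assumes "C_class (Suc k) f" "C_class (Suc l) g"
  shows "grad_dot (\<lambda>x. f (a + r *\<^sub>R x)) (\<lambda>x. g (a + r *\<^sub>R x)) = (\<lambda>x. r\<^sup>2 * grad_dot f g (a + r *\<^sub>R x))"
  unfolding grad_dot_def using partial_deriv_affine[OF assms(1)] partial_deriv_affine[OF assms(2)]
  by (simp add: sum_distrib_left power2_eq_square algebra_simps)

lemma integral_lborel_scaleR: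
  fixes f :: "'a::euclidean_space \<Rightarrow> real"
  assumes "f \<in> borel_measurable borel" "r \<noteq> 0"
  shows "(LBINT x. f x) = \<bar>r\<bar> ^ DIM('a) * (LBINT x. f (r *\<^sub>R x))"
proof -
  have "(LBINT x. f x) = (\<integral>x. f x \<partial>density (distr lborel borel (\<lambda>x. 0 + r *\<^sub>R x)) (\<lambda>_. ennreal (\<bar>r\<bar> ^ DIM('a))))"
    using lborel_affine[of r "0::'a"] assms by simp
  also have "\<dots> = (\<integral>x. \<bar>r\<bar> ^ DIM('a) * f x \<partial>distr lborel borel (\<lambda>x. 0 + r *\<^sub>R x))"
    by (subst integral_density) (use assms in auto)
  also have "\<dots> = (LBINT x. \<bar>r\<bar> ^ DIM('a) * f (r *\<^sub>R x))"
    by (subst integral_distr) (use assms in auto)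
  finally show ?thesis by simp
qed

lemma Cc_affine:
  assumes "Cc f" "r \<noteq> 0"
  shows "Cc (\<lambda>x. f (a + r *\<^sub>R x))"
proof -
  have "{x. f (a + r *\<^sub>R x) \<noteq> 0} \<subseteq> (\<lambda>y. inverse r *\<^sub>R (- a + y)) ` {y. f y \<noteq> 0}"
    using assms(2) by (auto simp: image_iff intro!: exI[of _ "a + r *\<^sub>R _"])
  moreover have "bounded ((\<lambda>y. inverse r *\<^sub>R (- a + y)) ` {y. f y \<noteq> 0})"
    using bounded_scaling[OF bounded_translation, of "{y. f y \<noteq> 0}" "inverse r" "- a"] assms(1)
    by (simp only: Cc_def image_image)
  moreover have "continuous_on UNIV (\<lambda>x. f (a + r *\<^sub>R x))"
    by (rule continuous_on_compose2[OF Cc_continuous[OF assms(1)]]) (auto intro!: continuous_intros)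
  ultimately show ?thesis
    unfolding Cc_def using bounded_subset by blast
qed

subsection \<open>Sign and pointwise comparison for solutions\<close>

text \<open>The weighted mean \<open>F t\<close> of \<open>z\<close> over the ball of radius
  \<open>t\<close> is nondecreasing in \<open>t\<close>, and its values at 0 and 1 are the two
  sides. With the weight \<open>bump ^ m\<close> no surface integral over spheres is needed.\<close>

lemma subharmonic_mean_value:
  fixes z :: "'a::euclidean_space \<Rightarrow> real"
  assumes z: "C_class 2 z" and sub: "\<And>x. 0 \<le> laplacian z x" and m: "0 < m"
  shows "z 0 * (LBINT x. bump (x::'a) ^ m) \<le> (LBINT x. z x * bump x ^ m)"
proof -
  note z2 = C_class_2D[OF z]
  define F where "F t = (LBINT y. z (t *\<^sub>R y) * bump y ^ m)" for t :: real
  define D where "D t y = (\<Sum>b\<in>Basis. (y \<bullet> b) * partial_deriv b z (t *\<^sub>R y)) * bump y ^ m" for t and y :: 'a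
  have cont_D: "continuous_on UNIV (\<lambda>y. \<Sum>b\<in>Basis. (y \<bullet> b) * partial_deriv b z (t *\<^sub>R y))" for t
    by (intro continuous_on_sum continuous_on_mult continuous_on_inner continuous_on_id continuous_on_const
        continuous_on_compose2[OF C_class_continuous[OF C_class_Suc_partial[OF z2]]] continuous_on_scaleR) auto
  have Cc_D: "Cc (D t)" for t
    unfolding D_def by (intro Cc_mult_left Cc_bump_power m cont_D)
  have deriv: "(F has_real_derivative (LBINT y. D t y)) (at t)" for t
  proof -
    have "compact ((\<lambda>x. \<Sum>b\<in>Basis. \<bar>partial_deriv b z x\<bar>) ` cball 0 (\<bar>t\<bar> + 1))"
      by (intro compact_continuous_image continuous_on_sum continuous_on_rabs
          continuous_on_subset[OF C_class_continuous[OF C_class_Suc_partial[OF z2]]]) auto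
    from compact_imp_bounded[OF this]
    obtain B where B: "\<And>x. x \<in> cball 0 (\<bar>t\<bar> + 1) \<Longrightarrow> norm (\<Sum>b\<in>Basis. \<bar>partial_deriv b z x\<bar>) \<le> B"
      unfolding bounded_iff by (elim exE) (rule that, erule bspec, erule imageI)
    have "(F has_derivative (\<lambda>h. LBINT y. h * D t y)) (at t)"
      unfolding F_def
    proof (rule has_derivative_integral_dominated[where f'="\<lambda>t y h. h * D t y" and g="\<lambda>y. B * bump y ^ m"])
      show "((\<lambda>t. z (t *\<^sub>R y) * bump y ^ m) has_derivative (\<lambda>h. h * D t y)) (at t)" for t y
      proof -
        have "((\<lambda>t. t *\<^sub>R y) has_derivative (\<lambda>h. h *\<^sub>R y)) (at t)"
          by (auto intro!: derivative_eq_intros)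
        from has_derivative_mult_left[OF has_derivative_compose[OF this C_class_has_derivative[OF z2]], of "bump y ^ m"]
        show ?thesis
          by (simp add: D_def sum_distrib_left[symmetric] mult.assoc)
      qed
      show "integrable lborel (\<lambda>y. z (t *\<^sub>R y) * bump y ^ m)" for t
        by (intro Cc_integrable Cc_mult_left Cc_bump_power m continuous_on_compose2[OF C_class_continuous[OF z]]
          continuous_intros) auto
      show "integrable lborel (\<lambda>y. h * D t y)" for h
        by (intro integrable_mult_right Cc_integrable Cc_D)
      show "integrable lborel (\<lambda>y::'a. B * bump y ^ m)"
        by (intro integrable_mult_right Cc_integrable Cc_bump_power m)
      show "\<bar>h * D t' y\<bar> \<le> B * bump y ^ m * norm h" if "dist t' t < 1" for t' y and h :: real
      proof (cases "bump y = 0")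
        case False
        then have y: "norm y \<le> 1" by (rule norm_le_1_if_bump)
        have "\<bar>t'\<bar> \<le> \<bar>t\<bar> + 1" using that by (simp add: dist_real_def)
        with y have "\<bar>t'\<bar> * norm y \<le> \<bar>t\<bar> + 1"
          by (metis abs_ge_zero mult_left_le order_trans)
        then have t'y: "t' *\<^sub>R y \<in> cball 0 (\<bar>t\<bar> + 1)" by simp
        have "\<bar>\<Sum>b\<in>Basis. (y \<bullet> b) * partial_deriv b z (t' *\<^sub>R y)\<bar> \<le> (\<Sum>b\<in>Basis. \<bar>y \<bullet> b\<bar> * \<bar>partial_deriv b z (t' *\<^sub>R y)\<bar>)"
          by (rule order_trans[OF sum_abs]) (simp add: abs_mult)
        also have "\<dots> \<le> (\<Sum>b\<in>Basis. 1 * \<bar>partial_deriv b z (t' *\<^sub>R y)\<bar>)"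
          by (intro sum_mono mult_right_mono) (use y Basis_le_norm order_trans in \<open>blast, simp\<close>)
        also have "\<dots> \<le> B" using B[OF t'y] by simp
        finally have "\<bar>\<Sum>b\<in>Basis. (y \<bullet> b) * partial_deriv b z (t' *\<^sub>R y)\<bar> * bump y ^ m * \<bar>h\<bar> \<le> B * bump y ^ m * \<bar>h\<bar>"
          by (intro mult_right_mono) auto
        then show ?thesis by (simp add: D_def abs_mult mult_ac)
      qed (use m in \<open>simp add: D_def zero_power\<close>)
    qed
    then show ?thesis
      by (simp add: has_field_derivative_def mult_commute_abs)
  qed
  \<comment> \<open>The field \<open>y\<close> times \<open>bump y ^ m\<close> is a constant
    multiple of the gradient of \<open>bump ^ Suc m\<close>. Integration by parts therefore turns
    the derivative of \<open>F\<close> into a positive multiple of an integral of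
    \<open>laplacian z\<close> against \<open>bump ^ Suc m\<close>.\<close>
  have nonneg: "0 \<le> (LBINT y. D t y)" if t: "0 < t" for t
  proof -
    have zt: "C_class 2 (\<lambda>y. z (0 + t *\<^sub>R y))" by (rule C_class_affine[OF z])
    have bm: "C_class (Suc 0) (\<lambda>y::'a. bump y ^ Suc m)"
      by (rule C_class_bump_power) (use m in simp)
    have "grad_dot (\<lambda>y. bump y ^ Suc m) (\<lambda>y. z (0 + t *\<^sub>R y)) = (\<lambda>y. - (2 * real (Suc m) * t) * D t y)"
      unfolding grad_dot_def D_def
      by (simp only: partial_deriv_affine[OF z2] partial_deriv_bump_power[OF m] cong: sum.cong)
        (simp add: sum_distrib_left sum_distrib_right fun_eq_iff mult_ac sum_negf[symmetric] del: of_nat_Suc)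
    then have "- (2 * real (Suc m) * t) * (LBINT y. D t y)
        = (LBINT y. grad_dot (\<lambda>y. bump y ^ Suc m) (\<lambda>y. z (0 + t *\<^sub>R y)) y)"
      by simp
    also have "\<dots> = - (LBINT y. bump y ^ Suc m * laplacian (\<lambda>y. z (0 + t *\<^sub>R y)) y)"
      using green_first[OF bm bounded_support_bump_power zt] by simp
    also have "\<dots> \<le> 0"
      unfolding laplacian_affine[OF z] by (auto intro!: integral_nonneg_AE simp: sub)
    finally have "0 \<le> (2 * real (Suc m) * t) * (LBINT y. D t y)"
      by simp
    moreover have "0 < 2 * real (Suc m) * t"
      using t by simp
    ultimately show ?thesis
      by (metis zero_le_mult_iff not_less)
  qed
  have "F 0 \<le> F 1"
    by (rule DERIV_nonneg_imp_increasing_open)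
      (use deriv nonneg in \<open>auto intro!: continuous_at_imp_continuous_on DERIV_isCont\<close>)
  then show ?thesis by (simp add: F_def)
qed

text \<open>Either the first term on the right already dominates, or \<open>u\<close> is at most a
  constant times \<open>b powr (- k / e)\<close>. In the second case the condition on
  \<open>n\<close> leaves a factor \<open>b\<close>, so for a cutoff \<open>b\<close> the remainder
  keeps compact support.\<close>

lemma powr_cutoff_bound:
  fixes \<delta> e K u b :: real and n k :: nat
  assumes "0 < \<delta>" "0 < e" "0 < K" "real k / e + 1 \<le> real n" "0 \<le> u" "0 \<le> b" "b \<le> 1"
  shows "K * u * b ^ n \<le> \<delta> * u powr (1 + e) * b ^ (n + k) + K * (K / \<delta>) powr (1 / e) * b"
proof -
  have n: "0 < n" using assms by (metis add_nonneg_pos divide_nonneg_pos leD of_nat_0_le_iff of_nat_0_eq_iff zero_less_one gr0I)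
  have rest: "0 \<le> K * (K / \<delta>) powr (1 / e) * b" "0 \<le> \<delta> * u powr (1 + e) * b ^ (n + k)"
    using assms by auto
  show ?thesis
  proof (cases "b = 0 \<or> u = 0")
    case True
    then have "K * u * b ^ n = 0" using n by auto
    then show ?thesis using rest by linarith
  next
    case False
    then have b: "0 < b" and u: "0 < u" using assms by auto
    show ?thesis
    proof (cases "K \<le> \<delta> * u powr e * b ^ k")
      case True
      have "K * u * b ^ n \<le> (\<delta> * u powr e * b ^ k) * u * b ^ n"
        using True u b by (intro mult_right_mono) auto
      also have "\<dots> = \<delta> * u powr (1 + e) * b ^ (n + k)"
        using u by (simp add: powr_add power_add)
      finally show ?thesis using rest by linarith
    next
      case False
      then have "u powr e < K / \<delta> * b powr (- real k)"
        using b assms by (simp add: powr_minus powr_realpow field_simps)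
      then have "(u powr e) powr (1 / e) \<le> (K / \<delta> * b powr (- real k)) powr (1 / e)"
        using assms by (intro powr_mono2) auto
      moreover have "(K / \<delta> * b powr (- real k)) powr (1 / e) = (K / \<delta>) powr (1 / e) * b powr (- real k / e)"
        using assms powr_mult[of "K / \<delta>" "b powr (- real k)" "1 / e"] by (simp add: powr_powr)
      moreover have "(u powr e) powr (1 / e) = u"
        using assms u by (simp add: powr_powr)
      ultimately have "u \<le> (K / \<delta>) powr (1 / e) * b powr (- real k / e)"
        by simp
      then have "K * u * b ^ n \<le> K * ((K / \<delta>) powr (1 / e) * b powr (- real k / e)) * b ^ n"
        using assms by (intro mult_right_mono mult_left_mono) auto
      also have "\<dots> = K * (K / \<delta>) powr (1 / e) * b powr (real n - real k / e)"
        using b by (simp add: powr_diff powr_minus powr_realpow[symmetric] field_simps)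
      also have "\<dots> \<le> K * (K / \<delta>) powr (1 / e) * b powr 1"
        using assms b by (intro mult_left_mono powr_mono') auto
      finally show ?thesis using rest b by simp
    qed
  qed
qed

locale lane_emden4 =
  fixes p :: real and u :: "'a::euclidean_space \<Rightarrow> real"
  assumes p: "1 < p" and solution: "classical_solution p u"
begin

lemma u_pos: "0 < u x"
  using solution by (simp add: classical_solution_def)

lemma C_class_u: "C_class 4 u"
  using solution by (simp add: classical_solution_def)

lemma C2_u: "C_class 2 u"
  using C_class_u by (rule C_class_mono) simp

lemma C2_lap: "C_class 2 (laplacian u)"
proof -
  have "C_class (Suc (Suc 2)) u"
    using C_class_u by (simp add: numeral_eq_Suc del: C_class.simps)
  then show ?thesis
    by (rule C_class_laplacian)
qed

lemma continuous_u: "continuous_on UNIV u"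
  by (rule C_class_continuous[OF C2_u])

lemma continuous_u_powr: "continuous_on UNIV (\<lambda>x. u x powr q)"
  by (rule C_class_continuous[OF C_class_powr[OF C2_u u_pos]])

lemma bilaplacian: "laplacian (laplacian u) x = u x powr p"
  using solution by (simp add: classical_solution_def)

text \<open>The exponent \<open>\<alpha> = 4 / (p - 1)\<close> is forced by
  \<open>\<alpha> + 4 = p * \<alpha>\<close>, which balances four derivatives against the
  power.\<close>

lemma dilation:
  assumes "0 < R"
  shows "lane_emden4 p (\<lambda>x. R powr (4 / (p - 1)) * u (a + R *\<^sub>R x))"
    and "laplacian (\<lambda>x. R powr (4 / (p - 1)) * u (a + R *\<^sub>R x))
       = (\<lambda>x. R powr (4 / (p - 1) + 2) * laplacian u (a + R *\<^sub>R x))"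
proof -
  let ?c = "R powr (4 / (p - 1))"
  have *: "laplacian (\<lambda>x. ?c * u (a + R *\<^sub>R x)) = (\<lambda>x. (?c * R\<^sup>2) * laplacian u (a + R *\<^sub>R x))"
    by (simp only: laplacian_cmult[OF C_class_affine[OF C2_u]] laplacian_affine[OF C2_u] mult.assoc)
  have c: "?c * R\<^sup>2 = R powr (4 / (p - 1) + 2)"
    using assms by (simp add: powr_add)
  show "laplacian (\<lambda>x. ?c * u (a + R *\<^sub>R x)) = (\<lambda>x. R powr (4 / (p - 1) + 2) * laplacian u (a + R *\<^sub>R x))"
    unfolding * c ..
  have "laplacian (laplacian (\<lambda>x. ?c * u (a + R *\<^sub>R x)))
      = (\<lambda>x. (?c * R\<^sup>2) * (R\<^sup>2 * laplacian (laplacian u) (a + R *\<^sub>R x)))"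
    by (simp only: * laplacian_cmult[OF C_class_affine[OF C2_lap]] laplacian_affine[OF C2_lap])
  moreover have "(?c * R\<^sup>2) * (R\<^sup>2 * laplacian (laplacian u) y) = (?c * u y) powr p" for y
  proof -
    have "(?c * u y) powr p = ?c powr p * u y powr p"
      using u_pos[of y] by (simp add: powr_mult)
    moreover have "?c powr p = ?c * R\<^sup>2 * R\<^sup>2"
    proof -
      have "4 / (p - 1) * p = 4 / (p - 1) + 2 + 2"
        using p by (simp add: field_simps)
      then show ?thesis
        using assms by (simp only: powr_powr powr_add) simp
    qed
    ultimately show ?thesis by (simp add: bilaplacian)
  qed
  ultimately show "lane_emden4 p (\<lambda>x. ?c * u (a + R *\<^sub>R x))"
    using p assms u_pos C_class_cmult[OF C_class_affine[OF C_class_u]]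
    by unfold_locales (auto simp only: classical_solution_def intro!: mult_pos_pos powr_gt_zero[THEN iffD2])
qed

end

lemma dilation_bound_imp_nonpos:
  fixes c C :: real
  assumes "\<And>R. 1 \<le> R \<Longrightarrow> R powr e * c \<le> C" "0 < e"
  shows "c \<le> 0"
proof (rule ccontr)
  assume "\<not> c \<le> 0"
  then have c: "0 < c" by simp
  \<comment> \<open>With this \<open>R\<close> the product \<open>R powr e * c\<close> equals
    \<open>\<bar>C\<bar> + c\<close>, which exceeds \<open>C\<close>.\<close>
  define R where "R = (\<bar>C\<bar> / c + 1) powr (1 / e)"
  have "1 \<le> R"
    using c assms(2) unfolding R_def by (intro ge_one_powr_ge_zero) auto
  moreover have "R powr e = \<bar>C\<bar> / c + 1"
    using c assms(2) by (simp add: R_def powr_powr add_nonneg_pos)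
  ultimately have "(\<bar>C\<bar> / c + 1) * c \<le> C"
    using assms(1)[of R] by simp
  moreover have "(\<bar>C\<bar> / c + 1) * c = \<bar>C\<bar> + c"
    using c by (simp add: field_simps)
  ultimately show False
    using c by linarith
qed

lemma laplacian_bounded_above:
  assumes p: "1 < p"
  shows "\<exists>C. \<forall>u::'a::euclidean_space \<Rightarrow> real. lane_emden4 p u \<longrightarrow> laplacian u 0 \<le> C"
proof -
  \<comment> \<open>This is the condition of \<open>powr_cutoff_bound\<close> for
    \<open>k = 4\<close> and \<open>e = p - 1\<close>: the bilaplacian of the cutoff costs four
    powers of \<open>bump\<close>, to be bought with the surplus exponent \<open>p - 1\<close> of
    \<open>u\<close>.\<close>
  define n where "n = nat \<lceil>4 / (p - 1)\<rceil> + 1"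
  have n0: "0 < n" and n: "real 4 / (p - 1) + 1 \<le> real n"
    unfolding n_def by linarith+
  define c where "c m = 4 * real (m + 2) * real (m + 1) + 2 * real DIM('a) * real (m + 2)" for m
  have c_pos: "0 < c m" for m
    unfolding c_def by (intro add_pos_pos mult_pos_pos) (auto intro: DIM_positive)
  define A B where "A = 4 * real (n + 2 + 2) * real (n + 2 + 1)" and "B = c (n + 2)"
  have AB: "0 < A" "0 < B" using c_pos unfolding A_def B_def by auto
  define K where "K = A * c n + B * c (n + 1)"
  have K: "0 < K" using AB c_pos by (simp add: K_def add_pos_pos)
  define C1 where "C1 = K * (K / (1/2)) powr (1 / (p - 1))"
  define I where "I m = (LBINT x. bump (x::'a) ^ m)" for m
  define C2 where "C2 = c (n + 4) * (2 * C1 * I 1 + I (n + 4)) / I (n + 6)"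
  let ?\<psi> = "\<lambda>x::'a. bump x ^ (n + 4)"
  have lap_psi: "laplacian ?\<psi> = (\<lambda>x. A * bump x ^ (n + 2) + (- B) * bump x ^ (n + 2 + 1))"
    using laplacian_bump_power[of "n + 2", where 'a='a] n0
    by (simp add: A_def B_def c_def fun_eq_iff algebra_simps numeral_eq_Suc)
  have C2_psi: "C_class 2 ?\<psi>" and b1: "C_class 2 (\<lambda>x::'a. bump x ^ (n + 2))" and b2: "C_class 2 (\<lambda>x::'a. bump x ^ (n + 2 + 1))"
    using n0 by (simp_all only: C_class_bump_power)
  have C2_lap_psi: "C_class 2 (laplacian ?\<psi>)"
    unfolding lap_psi by (intro C_class_add C_class_cmult b1 b2)
  have bilap_psi: "\<bar>laplacian (laplacian ?\<psi>) x\<bar> \<le> K * bump x ^ n" for x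
  proof -
    have "laplacian (laplacian ?\<psi>) x = A * laplacian (\<lambda>x::'a. bump x ^ (n + 2)) x + (- B) * laplacian (\<lambda>x::'a. bump x ^ (n + 1 + 2)) x"
      unfolding lap_psi laplacian_add[OF C_class_cmult[OF b1] C_class_cmult[OF b2]] laplacian_cmult[OF b1] laplacian_cmult[OF b2]
      by (simp add: add.commute add.left_commute)
    moreover have "\<bar>A * laplacian (\<lambda>x::'a. bump x ^ (n + 2)) x\<bar> \<le> A * (c n * bump x ^ n)"
      using abs_laplacian_bump_power[OF n0, of x] AB by (simp add: abs_mult c_def)
    moreover have "\<bar>(- B) * laplacian (\<lambda>x::'a. bump x ^ (n + 1 + 2)) x\<bar> \<le> B * (c (n + 1) * bump x ^ n)"
    proof -
      have "\<bar>laplacian (\<lambda>x::'a. bump x ^ (n + 1 + 2)) x\<bar> \<le> c (n + 1) * bump x ^ (n + 1)"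
        unfolding c_def by (rule abs_laplacian_bump_power) simp
      also have "\<dots> \<le> c (n + 1) * bump x ^ n"
        using c_pos[of "n + 1"] by (intro mult_left_mono bump_power_antimono) auto
      finally show ?thesis using AB by (simp add: abs_mult)
    qed
    ultimately show ?thesis by (simp add: K_def algebra_simps)
  qed
  have "laplacian u 0 \<le> C2" if "lane_emden4 p u" for u :: "'a \<Rightarrow> real"
  proof -
    interpret lane_emden4 p u by fact
    have Cc_psi: "Cc ?\<psi>" "Cc (\<lambda>x::'a. bump x ^ n)" "Cc (\<lambda>x::'a. bump x)" "Cc (\<lambda>x::'a. bump x ^ (n + 6))"
      using Cc_bump_power[of 1, where 'a='a] n0 by (auto intro: Cc_bump_power)
    have int_up: "integrable lborel (\<lambda>x. u x powr p * ?\<psi> x)"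
      by (intro Cc_integrable Cc_mult_left continuous_u_powr Cc_psi)
    have "(LBINT x. u x powr p * ?\<psi> x) = (LBINT x. ?\<psi> x * laplacian (laplacian u) x)"
      by (simp add: bilaplacian mult.commute)
    also have "\<dots> = (LBINT x. laplacian ?\<psi> x * laplacian u x)"
      by (rule green_second[OF C2_psi bounded_support_bump_power C2_lap]) simp
    also have "\<dots> = (LBINT x. laplacian (laplacian ?\<psi>) x * u x)"
      by (rule green_second[OF C2_lap_psi _ C2_u]) (use Cc_laplacian[OF C2_psi bounded_support_bump_power] in \<open>simp add: Cc_def\<close>)
    \<comment> \<open>The factor 1/2 lets the left side absorb this term; what is left does not
      depend on \<open>u\<close>.\<close>
    also have "\<dots> \<le> (LBINT x. (1/2) * (u x powr p * ?\<psi> x) + C1 * bump x)"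
    proof (rule integral_mono)
      show "integrable lborel (\<lambda>x. laplacian (laplacian ?\<psi>) x * u x)"
        using Cc_laplacian[OF C2_psi bounded_support_bump_power]
        by (intro Cc_integrable Cc_mult_right Cc_laplacian C2_lap_psi continuous_u) (simp_all add: Cc_def)
      show "integrable lborel (\<lambda>x. (1/2) * (u x powr p * ?\<psi> x) + C1 * bump x)"
        by (intro Bochner_Integration.integrable_add integrable_mult_right int_up Cc_integrable Cc_psi)
      fix x :: 'a
      have "laplacian (laplacian ?\<psi>) x * u x \<le> K * bump x ^ n * u x"
        using bilap_psi[of x] u_pos[of x] by (intro mult_right_mono) auto
      also have "\<dots> \<le> 1/2 * u x powr (1 + (p - 1)) * bump x ^ (n + 4) + C1 * bump x"
        unfolding C1_def using powr_cutoff_bound[of "1/2" "p - 1" K 4 n "u x" "bump x"] K n p u_pos[of x]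
        by (simp add: mult_ac)
      finally show "laplacian (laplacian ?\<psi>) x * u x \<le> (1/2) * (u x powr p * ?\<psi> x) + C1 * bump x"
        by simp
    qed
    also have "\<dots> = (1/2) * (LBINT x. u x powr p * ?\<psi> x) + C1 * I 1"
      unfolding I_def using int_up Cc_psi by (subst Bochner_Integration.integral_add) (auto intro: Cc_integrable)
    finally have up: "(LBINT x. u x powr p * ?\<psi> x) \<le> 2 * C1 * I 1"
      by simp
    \<comment> \<open>Two powers more than in \<open>?\<psi>\<close>, so that the Laplacian of this
      cutoff is controlled by \<open>?\<psi>\<close>, against which \<open>u powr p\<close> has just
      been bounded.\<close>
    have C2_6: "C_class 2 (\<lambda>x::'a. bump x ^ (n + 6))"
      by (rule C_class_bump_power) simp
    have "laplacian u 0 * I (n + 6) \<le> (LBINT x. laplacian u x * bump x ^ (n + 6))"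
      unfolding I_def by (rule subharmonic_mean_value[OF C2_lap]) (simp_all add: bilaplacian)
    also have "\<dots> = (LBINT x. bump x ^ (n + 6) * laplacian u x)"
      by (simp add: mult.commute)
    also have "\<dots> = (LBINT x. laplacian (\<lambda>x. bump x ^ (n + 6)) x * u x)"
      by (rule green_second[OF C2_6 bounded_support_bump_power C2_u]) simp
    also have "\<dots> \<le> (LBINT x. c (n + 4) * (u x powr p * ?\<psi> x + ?\<psi> x))"
    proof (rule integral_mono)
      show "integrable lborel (\<lambda>x. laplacian (\<lambda>x. bump x ^ (n + 6)) x * u x)"
        by (intro Cc_integrable Cc_mult_right Cc_laplacian C2_6 continuous_u bounded_support_bump_power) simp
      show "integrable lborel (\<lambda>x. c (n + 4) * (u x powr p * ?\<psi> x + ?\<psi> x))"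
        by (intro Bochner_Integration.integrable_add integrable_mult_right int_up Cc_integrable Cc_psi)
      fix x :: 'a
      have "\<bar>laplacian (\<lambda>x::'a. bump x ^ (n + 6)) x\<bar> \<le> c (n + 4) * ?\<psi> x"
        using abs_laplacian_bump_power[of "n + 4" x] by (simp add: c_def add.assoc numeral_eq_Suc)
      then have "laplacian (\<lambda>x. bump x ^ (n + 6)) x * u x \<le> c (n + 4) * ?\<psi> x * u x"
        using u_pos[of x] by (intro mult_right_mono) auto
      also have "\<dots> \<le> c (n + 4) * ?\<psi> x * (u x powr p + 1)"
      proof -
        have "u x \<le> u x powr p + 1"
        proof (cases "u x \<le> 1")
          case False
          then have "u x powr 1 \<le> u x powr p" using p by (intro powr_mono) auto
          then show ?thesis using False by simp
        qed (simp add: add_increasing)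
        then show ?thesis using c_pos[of "n + 4"] by (intro mult_left_mono) auto
      qed
      finally show "laplacian (\<lambda>x. bump x ^ (n + 6)) x * u x \<le> c (n + 4) * (u x powr p * ?\<psi> x + ?\<psi> x)"
        by (simp add: algebra_simps)
    qed
    also have "\<dots> = c (n + 4) * ((LBINT x. u x powr p * ?\<psi> x) + I (n + 4))"
      unfolding I_def using int_up Cc_psi by (subst Bochner_Integration.integral_mult_right_zero, subst Bochner_Integration.integral_add) (auto intro: Cc_integrable)
    also have "\<dots> \<le> c (n + 4) * (2 * C1 * I 1 + I (n + 4))"
      using up c_pos[of "n + 4"] by (intro mult_left_mono) auto
    finally have *: "laplacian u 0 * I (n + 6) \<le> c (n + 4) * (2 * C1 * I 1 + I (n + 4))" .
    have "0 < I (n + 6)"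
      unfolding I_def by (rule Cc_integral_pos[OF Cc_psi(4), of 0]) auto
    with * show ?thesis
      by (simp add: C2_def field_simps)
  qed
  then show ?thesis by blast
qed

context lane_emden4
begin

lemma laplacian_nonpos: "laplacian u a \<le> 0"
proof -
  obtain C where C: "\<And>w::'a \<Rightarrow> real. lane_emden4 p w \<Longrightarrow> laplacian w 0 \<le> C"
    using laplacian_bounded_above[OF p] by blast
  have "R powr (4 / (p - 1) + 2) * laplacian u a \<le> C" if "1 \<le> R" for R
    using C[OF dilation(1), of R a] dilation(2)[of R a] that by simp
  then show ?thesis
    by (rule dilation_bound_imp_nonpos) (use p in \<open>auto intro: add_nonneg_pos\<close>)
qed

text \<open>A zero of \<open>laplacian u\<close> would be a global maximum of it, where its
  Laplacian \<open>u powr p\<close> could not be positive.\<close>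

lemma laplacian_neg: "laplacian u a < 0"
proof -
  have "laplacian u a \<noteq> 0"
  proof
    assume "laplacian u a = 0"
    then have "laplacian (laplacian u) a \<le> 0"
      using laplacian_nonpos by (intro global_max_laplacian(1)[OF C2_lap]) simp
    with u_pos[of a] show False
      by (simp add: bilaplacian)
  qed
  then show ?thesis using laplacian_nonpos[of a] by simp
qed

end

text \<open>The function \<open>w = l * u powr \<sigma> + laplacian u\<close> satisfies
  \<open>laplacian w \<ge> l * \<sigma> * u powr (\<sigma> - 1) * w\<close>. At a positive maximum
  of \<open>w\<close> times a cutoff this bounds the coefficient, hence \<open>u\<close>, and
  \<open>u\<close> bounds \<open>w\<close> from above because \<open>laplacian u\<close> is
  nonpositive.\<close>

lemma comparison_bounded_above:
  assumes p: "1 < p"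
  shows "\<exists>C. \<forall>u::'a::euclidean_space \<Rightarrow> real. lane_emden4 p u \<longrightarrow>
    sqrt (2 / (p + 1)) * u 0 powr ((p + 1) / 2) + laplacian u 0 \<le> C"
proof -
  define \<sigma> l where "\<sigma> = (p + 1) / 2" and "l = sqrt (2 / (p + 1))"
  have \<sigma>: "1 < \<sigma>" using p by (simp add: \<sigma>_def)
  have l: "0 < l" using p by (simp add: l_def)
  \<comment> \<open>This normalisation makes \<open>u powr p\<close> the product of
    \<open>l * \<sigma> * u powr (\<sigma> - 1)\<close> and \<open>l * u powr \<sigma>\<close>, so
    that the lower bound for \<open>laplacian w\<close> contains the factor
    \<open>w\<close>.\<close>
  have l2: "l * (l * \<sigma>) = 1"
    using p by (simp add: l_def \<sigma>_def mult.assoc[symmetric])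
  define m where "m = nat \<lceil>2 * \<sigma> / (\<sigma> - 1)\<rceil> + 1"
  have m0: "0 < m" and m: "2 * \<sigma> / (\<sigma> - 1) \<le> real (m + 2)"
    unfolding m_def by linarith+
  define c where "c = 4 * real (m + 2) * real (m + 1) + 2 * real DIM('a) * real (m + 2)"
  \<comment> \<open>Twice the gradient bound \<open>4 * (m + 2)\<^sup>2\<close>, from the cross term
    at the maximum, plus the bound \<open>c\<close> for the Laplacian of the cutoff.\<close>
  define C1 where "C1 = 8 * (real (m + 2))\<^sup>2 + c"
  have C1: "0 < C1"
    unfolding C1_def c_def by (intro add_pos_nonneg) auto
  define C where "C = l * (C1 / (l * \<sigma>)) powr (\<sigma> / (\<sigma> - 1))"
  have C0: "0 \<le> C" using l by (simp add: C_def)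
  have "l * u 0 powr \<sigma> + laplacian u 0 \<le> C" if "lane_emden4 p u" for u :: "'a \<Rightarrow> real"
  proof -
    interpret lane_emden4 p u by fact
    define w where "w = (\<lambda>x. l * u x powr \<sigma> + laplacian u x)"
    define \<beta> where "\<beta> = (\<lambda>x::'a. bump x ^ (m + 2))"
    have X: "C_class 2 (\<lambda>x. u x powr \<sigma>)" by (rule C_class_powr[OF C2_u u_pos])
    have w: "C_class 2 w" unfolding w_def by (intro C_class_add C_class_cmult X C2_lap)
    have \<beta>: "C_class 2 \<beta>" unfolding \<beta>_def by (rule C_class_bump_power) (use m0 in simp)
    have w_le: "w x \<le> l * u x powr \<sigma>" for x
      using laplacian_nonpos[of x] by (simp add: w_def)
    have lap_w: "l * \<sigma> * u x powr (\<sigma> - 1) * w x \<le> laplacian w x" for x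
    proof -
      have "laplacian w x = l * (\<sigma> * u x powr (\<sigma> - 1) * laplacian u x + \<sigma> * (\<sigma> - 1) * u x powr (\<sigma> - 2) * grad_dot u u x) + u x powr p"
        unfolding w_def laplacian_add[OF C_class_cmult[OF X] C2_lap] laplacian_cmult[OF X] laplacian_powr[OF C2_u u_pos]
        by (simp add: bilaplacian)
      moreover have "u x powr p = l * \<sigma> * u x powr (\<sigma> - 1) * (l * u x powr \<sigma>)"
      proof -
        have "p = (\<sigma> - 1) + \<sigma>"
          by (simp add: \<sigma>_def field_simps)
        then have "u x powr p = u x powr (\<sigma> - 1) * u x powr \<sigma>"
          by (metis powr_add)
        then show ?thesis using l2 by (simp add: mult_ac)
      qed
      moreover have "0 \<le> l * (\<sigma> * (\<sigma> - 1) * u x powr (\<sigma> - 2) * grad_dot u u x)"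
        using l \<sigma> grad_dot_self_nonneg[of u x] by (intro mult_nonneg_nonneg) auto
      ultimately show ?thesis
        by (simp add: w_def algebra_simps)
    qed
    have "continuous_on (cball 0 1) (\<lambda>x. w x * \<beta> x)"
      using C_class_continuous[OF C_class_mult[OF w \<beta>]] continuous_on_subset by blast
    then have "\<exists>a\<in>cball 0 1. \<forall>y\<in>cball 0 1. w y * \<beta> y \<le> w a * \<beta> a"
      by (intro continuous_attains_sup) auto
    then obtain a where a: "a \<in> cball 0 1" "\<And>y. y \<in> cball 0 1 \<Longrightarrow> w y * \<beta> y \<le> w a * \<beta> a"
      by blast
    show ?thesis
    proof (cases "0 < w 0")
      case False
      then show ?thesis using C0 by (simp add: w_def)
    next
      case True
      have w0: "w 0 \<le> w a * \<beta> a"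
        using a(2)[of 0] by (simp add: \<beta>_def)
      then have "0 < w a * \<beta> a" using True by linarith
      moreover have "0 \<le> \<beta> a" by (simp add: \<beta>_def)
      ultimately have wa: "0 < w a" and "0 < \<beta> a"
        by (auto simp: zero_less_mult_iff)
      then have ba: "0 < bump a"
        using bump_nonneg[of a] unfolding \<beta>_def by (metis order.order_iff_strict less_irrefl power_0_left zero_less_power_eq add_is_0 zero_neq_numeral)
      \<comment> \<open>The maximum over the closed ball is positive while the product vanishes
        outside, so it is a maximum over the whole space.\<close>
      have max: "w y * \<beta> y \<le> w a * \<beta> a" for y
      proof (cases "y \<in> cball 0 1")
        case False
        then have "bump y = 0" by (intro bump_eq_0) auto
        then show ?thesis using \<open>0 < w a * \<beta> a\<close> by (simp add: \<beta>_def)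
      qed (rule a(2))
      note at_max = global_max_laplacian[OF C_class_mult[OF w \<beta>] max]
      have lap: "laplacian w a * \<beta> a + 2 * grad_dot w \<beta> a + w a * laplacian \<beta> a \<le> 0"
        using at_max(1) by (simp add: laplacian_mult[OF w \<beta>])
      have w': "C_class (Suc 0) w" and \<beta>': "C_class (Suc 0) \<beta>"
        using w \<beta> by (auto intro: C_class_mono simp del: C_class.simps)
      \<comment> \<open>The vanishing gradient of \<open>w * \<beta>\<close> expresses the cross
        term through \<open>grad_dot \<beta> \<beta>\<close>, which is explicit.\<close>
      have "w a * grad_dot \<beta> \<beta> a + \<beta> a * grad_dot w \<beta> a = 0"
        using at_max(2)[of \<beta>] by (simp add: grad_dot_mult_left[OF w' \<beta>'])
      moreover have "grad_dot \<beta> \<beta> a \<le> 4 * (real (m + 2))\<^sup>2 * bump a ^ (2 * (m + 1))"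
        unfolding \<beta>_def using grad_dot_bump_power_le[of "m + 1" a] by simp
      then have "w a * grad_dot \<beta> \<beta> a \<le> w a * (4 * (real (m + 2))\<^sup>2 * bump a ^ (2 * (m + 1)))"
        using wa by (intro mult_left_mono) auto
      ultimately have "- (w a * (4 * (real (m + 2))\<^sup>2 * bump a ^ (2 * (m + 1)))) \<le> \<beta> a * grad_dot w \<beta> a"
        by linarith
      moreover have "bump a ^ (2 * (m + 1)) = \<beta> a * bump a ^ m"
        by (simp add: \<beta>_def power_add[symmetric] mult_2)
      ultimately have "\<beta> a * (- (w a * (4 * (real (m + 2))\<^sup>2 * bump a ^ m))) \<le> \<beta> a * grad_dot w \<beta> a"
        by (simp only: minus_mult_right[symmetric] mult_ac)
      then have grad: "- (w a * (4 * (real (m + 2))\<^sup>2 * bump a ^ m)) \<le> grad_dot w \<beta> a"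
        using \<open>0 < \<beta> a\<close> by (rule mult_left_le_imp_le)
      have "\<bar>laplacian \<beta> a\<bar> \<le> c * bump a ^ m"
        unfolding \<beta>_def c_def by (rule abs_laplacian_bump_power[OF m0])
      then have "w a * (- (c * bump a ^ m)) \<le> w a * laplacian \<beta> a"
        using wa by (intro mult_left_mono) auto
      with lap grad have "laplacian w a * \<beta> a \<le> w a * (C1 * bump a ^ m)"
        unfolding C1_def by (simp add: algebra_simps)
      moreover have "l * \<sigma> * u a powr (\<sigma> - 1) * w a * \<beta> a \<le> laplacian w a * \<beta> a"
        using lap_w[of a] \<open>0 < \<beta> a\<close> by (intro mult_right_mono) auto
      ultimately have "(l * \<sigma> * u a powr (\<sigma> - 1) * (bump a)\<^sup>2) * (w a * bump a ^ m) \<le> C1 * (w a * bump a ^ m)"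
        by (simp add: \<beta>_def power_add power2_eq_square mult_ac)
      \<comment> \<open>Here \<open>w a\<close> cancels, and the remaining inequality bounds
        \<open>u a\<close> by a negative power of \<open>bump a\<close>. The choice of
        \<open>m\<close> makes \<open>\<beta>\<close> compensate that power.\<close>
      then have "l * \<sigma> * u a powr (\<sigma> - 1) * (bump a)\<^sup>2 \<le> C1"
        using wa ba by (subst (asm) mult_le_cancel_right_pos) auto
      then have "u a powr (\<sigma> - 1) \<le> C1 / (l * \<sigma>) * bump a powr (- 2)"
        using l \<sigma> ba by (simp add: field_simps powr_minus)
      then have "(u a powr (\<sigma> - 1)) powr (\<sigma> / (\<sigma> - 1)) \<le> (C1 / (l * \<sigma>) * bump a powr (- 2)) powr (\<sigma> / (\<sigma> - 1))"
        using \<sigma> by (intro powr_mono2) auto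
      moreover have "(C1 / (l * \<sigma>) * bump a powr (- 2)) powr (\<sigma> / (\<sigma> - 1))
          = (C1 / (l * \<sigma>)) powr (\<sigma> / (\<sigma> - 1)) * bump a powr (- 2 * \<sigma> / (\<sigma> - 1))"
        using powr_mult[of "C1 / (l * \<sigma>)" "bump a powr (- 2)" "\<sigma> / (\<sigma> - 1)"] C1 l \<sigma> by (simp add: powr_powr)
      moreover have "(u a powr (\<sigma> - 1)) powr (\<sigma> / (\<sigma> - 1)) = u a powr \<sigma>"
        using \<sigma> by (simp add: powr_powr)
      ultimately have "u a powr \<sigma> \<le> (C1 / (l * \<sigma>)) powr (\<sigma> / (\<sigma> - 1)) * bump a powr (- 2 * \<sigma> / (\<sigma> - 1))"
        by simp
      then have "l * u a powr \<sigma> * \<beta> a \<le> l * ((C1 / (l * \<sigma>)) powr (\<sigma> / (\<sigma> - 1)) * bump a powr (- 2 * \<sigma> / (\<sigma> - 1))) * \<beta> a"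
        using l \<open>0 < \<beta> a\<close> by (intro mult_right_mono mult_left_mono) auto
      also have "\<dots> = C * (bump a powr (- 2 * \<sigma> / (\<sigma> - 1)) * bump a powr (real (m + 2)))"
        using ba by (simp only: powr_realpow C_def \<beta>_def mult_ac)
      also have "\<dots> = C * bump a powr (real (m + 2) - 2 * \<sigma> / (\<sigma> - 1))"
        by (simp add: powr_add[symmetric])
      also have "\<dots> \<le> C * 1"
        using C0 m ba by (intro mult_left_mono powr_le1) auto
      finally have "l * u a powr \<sigma> * \<beta> a \<le> C" by simp
      moreover have "w a * \<beta> a \<le> l * u a powr \<sigma> * \<beta> a"
        using w_le \<open>0 < \<beta> a\<close> by (intro mult_right_mono) auto
      ultimately show ?thesis
        using w0 by (simp add: w_def)
    qed
  qed
  then show ?thesis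
    unfolding l_def \<sigma>_def by blast
qed

context lane_emden4
begin

lemma comparison: "sqrt (2 / (p + 1)) * u a powr ((p + 1) / 2) \<le> - laplacian u a"
proof -
  let ?l = "sqrt (2 / (p + 1))" and ?\<sigma> = "(p + 1) / 2"
  obtain C where C: "\<And>w::'a \<Rightarrow> real. lane_emden4 p w \<Longrightarrow> ?l * w 0 powr ?\<sigma> + laplacian w 0 \<le> C"
    using comparison_bounded_above[OF p] by blast
  have "R powr (4 / (p - 1) + 2) * (?l * u a powr ?\<sigma> + laplacian u a) \<le> C" if R: "1 \<le> R" for R
  proof -
    have "4 / (p - 1) * ?\<sigma> = 4 / (p - 1) + 2"
      using p by (simp add: field_simps)
    then have "(R powr (4 / (p - 1)) * u a) powr ?\<sigma> = R powr (4 / (p - 1) + 2) * u a powr ?\<sigma>"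
      using R u_pos[of a] by (simp only: powr_mult powr_powr less_imp_le powr_ge_zero)
    then show ?thesis
      using C[OF dilation(1), of R a] dilation(2)[of R a] R by (simp add: algebra_simps)
  qed
  then have "?l * u a powr ?\<sigma> + laplacian u a \<le> 0"
    by (rule dilation_bound_imp_nonpos) (use p in \<open>auto intro: add_nonneg_pos\<close>)
  then show ?thesis by simp
qed

end

subsection \<open>Convolution of compactly supported functions\<close>

definition conv :: "('a::euclidean_space \<Rightarrow> real) \<Rightarrow> ('a \<Rightarrow> real) \<Rightarrow> 'a \<Rightarrow> real" where
  "conv \<eta> f x = (LBINT y. \<eta> (x - y) * f y)"

lemma Cc_abs: "Cc f \<Longrightarrow> Cc (\<lambda>x. \<bar>f x\<bar>)"
  unfolding Cc_def by (auto intro: continuous_on_rabs)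

lemma continuous_on_reflect: "continuous_on UNIV \<eta> \<Longrightarrow> continuous_on UNIV (\<lambda>y::'a::euclidean_space. \<eta> (x - y) :: real)"
  by (rule continuous_on_compose2[of UNIV \<eta>]) (auto intro!: continuous_intros)

lemma Cc_conv_integrand: "Cc \<eta> \<Longrightarrow> Cc f \<Longrightarrow> Cc (\<lambda>y. \<eta> (x - y) * f y)"
  by (intro Cc_mult_left continuous_on_reflect Cc_continuous)

lemma continuous_on_conv:
  assumes \<eta>: "Cc \<eta>" and f: "Cc f"
  shows "continuous_on UNIV (conv \<eta> f)"
proof -
  obtain B where B: "0 < B" "\<And>x. \<bar>\<eta> x\<bar> \<le> B"
    using Cc_bounded[OF \<eta>] by blast
  have "(\<lambda>n. conv \<eta> f (X n)) \<longlonglongrightarrow> conv \<eta> f x" if X: "X \<longlonglongrightarrow> x" for X x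
    unfolding conv_def
  proof (rule integral_dominated_convergence[where w="\<lambda>y. B * \<bar>f y\<bar>"])
    show "(\<lambda>y. \<eta> (x - y) * f y) \<in> borel_measurable lborel"
      using Cc_integrable[OF Cc_conv_integrand[OF \<eta> f]] by blast
    show "(\<lambda>y. \<eta> (X i - y) * f y) \<in> borel_measurable lborel" for i
      using Cc_integrable[OF Cc_conv_integrand[OF \<eta> f]] by blast
    show "integrable lborel (\<lambda>y. B * \<bar>f y\<bar>)"
      by (intro integrable_mult_right Cc_integrable Cc_abs f)
    show "AE y in lborel. (\<lambda>i. \<eta> (X i - y) * f y) \<longlonglongrightarrow> \<eta> (x - y) * f y"
    proof (intro AE_I2 tendsto_mult tendsto_const)
      fix y
      have "isCont \<eta> (x - y)"
        using Cc_continuous[OF \<eta>] by (simp add: continuous_on_eq_continuous_at)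
      then show "(\<lambda>i. \<eta> (X i - y)) \<longlonglongrightarrow> \<eta> (x - y)"
        by (rule isCont_tendsto_compose) (intro tendsto_diff X tendsto_const)
    qed
    show "AE y in lborel. norm (\<eta> (X i - y) * f y) \<le> B * \<bar>f y\<bar>" for i
      using B by (auto simp: abs_mult intro!: mult_right_mono AE_I2)
  qed
  then show ?thesis
    by (simp add: continuous_on_sequentially comp_def)
qed

lemma conv_nonzeroD:
  assumes "conv \<eta> f x \<noteq> 0"
  obtains y where "\<eta> (x - y) \<noteq> 0" "f y \<noteq> 0"
proof -
  have "\<exists>y. \<eta> (x - y) * f y \<noteq> 0"
  proof (rule ccontr)
    assume "\<not> ?thesis"
    then have "(\<lambda>y. \<eta> (x - y) * f y) = (\<lambda>y. 0)"
      by blast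
    with assms show False by (simp add: conv_def)
  qed
  then show thesis using that by auto
qed

lemma Cc_conv:
  assumes \<eta>: "Cc \<eta>" and f: "Cc f"
  shows "Cc (conv \<eta> f)"
proof -
  obtain r s where rs: "\<And>x. \<eta> x \<noteq> 0 \<Longrightarrow> norm x \<le> r" "\<And>x. f x \<noteq> 0 \<Longrightarrow> norm x \<le> s"
    using \<eta> f by (auto simp: Cc_def bounded_iff)
  have "norm x \<le> r + s" if nz: "conv \<eta> f x \<noteq> 0" for x
  proof -
    obtain y where "\<eta> (x - y) \<noteq> 0" "f y \<noteq> 0"
      by (rule conv_nonzeroD[OF nz])
    then show ?thesis
      using rs(1)[of "x - y"] rs(2)[of y] norm_triangle_ineq[of "x - y" y] by simp
  qed
  then show ?thesis
    using continuous_on_conv[OF \<eta> f] by (auto simp: Cc_def bounded_iff)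
qed

lemma has_derivative_conv:
  fixes \<eta> :: "'a::euclidean_space \<Rightarrow> real"
  assumes \<eta>: "C_class (Suc k) \<eta>" "bounded {x. \<eta> x \<noteq> 0}" and f: "Cc f"
  shows "(conv \<eta> f has_derivative (\<lambda>h. \<Sum>b\<in>Basis. (h \<bullet> b) * conv (partial_deriv b \<eta>) f x)) (at x)"
proof -
  have Cc_\<eta>: "Cc \<eta>"
    by (rule C_class_Cc[OF \<eta>])
  note Cc_p = Cc_partial_deriv[OF \<eta>]
  have "Cc (\<lambda>x. \<Sum>b\<in>Basis. \<bar>partial_deriv b \<eta> x\<bar>)"
    by (intro Cc_sum Cc_abs Cc_p)
  then obtain B where B: "0 < B" "\<And>x. \<bar>\<Sum>b\<in>Basis. \<bar>partial_deriv b \<eta> x\<bar>\<bar> \<le> B"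
    using Cc_bounded by blast
  have "((\<lambda>x. LBINT y. \<eta> (x - y) * f y) has_derivative
      (\<lambda>h. LBINT y. (\<Sum>b\<in>Basis. (h \<bullet> b) * partial_deriv b \<eta> (x - y)) * f y)) (at x)"
  proof (rule has_derivative_integral_dominated[where g="\<lambda>y. B * \<bar>f y\<bar>"])
    show "((\<lambda>x. \<eta> (x - y) * f y) has_derivative (\<lambda>h. (\<Sum>b\<in>Basis. (h \<bullet> b) * partial_deriv b \<eta> (x - y)) * f y)) (at x)" for x y
      by (intro has_derivative_mult_left has_derivative_compose[OF _ C_class_has_derivative[OF \<eta>(1)]])
        (auto intro!: derivative_eq_intros)
    show "integrable lborel (\<lambda>y. \<eta> (x - y) * f y)" for x
      by (intro Cc_integrable Cc_conv_integrand Cc_\<eta> f)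
    show "integrable lborel (\<lambda>y. (\<Sum>b\<in>Basis. (h \<bullet> b) * partial_deriv b \<eta> (x - y)) * f y)" for h
      by (intro Cc_integrable Cc_mult_left f continuous_on_sum continuous_on_mult continuous_on_const
          continuous_on_reflect Cc_continuous Cc_p)
    show "integrable lborel (\<lambda>y. B * \<bar>f y\<bar>)"
      by (intro integrable_mult_right Cc_integrable Cc_abs f)
    show "\<bar>(\<Sum>b\<in>Basis. (h \<bullet> b) * partial_deriv b \<eta> (x' - y)) * f y\<bar> \<le> B * \<bar>f y\<bar> * norm h" for x' y h
    proof -
      have "\<bar>\<Sum>b\<in>Basis. (h \<bullet> b) * partial_deriv b \<eta> (x' - y)\<bar> \<le> (\<Sum>b\<in>Basis. \<bar>h \<bullet> b\<bar> * \<bar>partial_deriv b \<eta> (x' - y)\<bar>)"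
        by (rule order_trans[OF sum_abs]) (simp add: abs_mult)
      also have "\<dots> \<le> (\<Sum>b\<in>Basis. norm h * \<bar>partial_deriv b \<eta> (x' - y)\<bar>)"
        by (intro sum_mono mult_right_mono Basis_le_norm) auto
      also have "\<dots> \<le> norm h * B"
        unfolding sum_distrib_left[symmetric] using B(2)[of "x' - y"] by (intro mult_left_mono) auto
      finally have "\<bar>\<Sum>b\<in>Basis. (h \<bullet> b) * partial_deriv b \<eta> (x' - y)\<bar> * \<bar>f y\<bar> \<le> norm h * B * \<bar>f y\<bar>"
        by (rule mult_right_mono) simp
      then show ?thesis by (simp add: abs_mult mult_ac)
    qed
  qed
  moreover have "(LBINT y. (\<Sum>b\<in>Basis. (h \<bullet> b) * partial_deriv b \<eta> (x - y)) * f y)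
      = (\<Sum>b\<in>Basis. (h \<bullet> b) * conv (partial_deriv b \<eta>) f x)" for h
    unfolding conv_def sum_distrib_right mult.assoc
    by (subst Bochner_Integration.integral_sum)
      (auto intro!: integrable_mult_right Cc_integrable Cc_conv_integrand Cc_p f)
  ultimately show ?thesis
    by (simp add: conv_def[abs_def])
qed

lemma partial_deriv_conv:
  assumes "C_class (Suc k) \<eta>" "bounded {x. \<eta> x \<noteq> 0}" "Cc f" "b \<in> Basis"
  shows "partial_deriv b (conv \<eta> f) = conv (partial_deriv b \<eta>) f"
  using partial_deriv_eq[OF has_derivative_conv[OF assms(1-3)], of b]
  by (simp add: fun_eq_iff sum_inner_Basis[OF assms(4)])

lemma C_class_conv:
  "C_class k \<eta> \<Longrightarrow> bounded {x. \<eta> x \<noteq> 0} \<Longrightarrow> Cc f \<Longrightarrow> C_class k (conv \<eta> f)"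
proof (induction k arbitrary: \<eta>)
  case 0
  then show ?case by (simp add: continuous_on_conv Cc_def)
next
  case (Suc k)
  show ?case
  proof (rule C_class_SucI[OF has_derivative_conv[OF Suc.prems]])
    fix b :: 'a assume b: "b \<in> Basis"
    show "C_class k (\<lambda>x. \<Sum>i\<in>Basis. (b \<bullet> i) * conv (partial_deriv i \<eta>) f x)"
      unfolding sum_inner_Basis[OF b]
      by (rule Suc.IH[OF C_class_Suc_partial[OF Suc.prems(1) b] bounded_support_partial_deriv[OF Suc.prems(2)] Suc.prems(3)])
  qed
qed

lemma laplacian_conv:
  assumes "C_class 2 \<eta>" "bounded {x. \<eta> x \<noteq> 0}" "Cc f"
  shows "laplacian (conv \<eta> f) = conv (laplacian \<eta>) f"
proof
  fix x
  note \<eta> = C_class_2D[OF assms(1)]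
  note bs = bounded_support_partial_deriv[OF assms(2)]
  note p = Cc_partial_deriv[OF C_class_Suc_partial[OF \<eta>] bs]
  have "laplacian (conv \<eta> f) x = (\<Sum>b\<in>Basis. conv (partial_deriv b (partial_deriv b \<eta>)) f x)"
    unfolding laplacian_def
    by (intro sum.cong refl)
      (simp only: partial_deriv_conv[OF \<eta> assms(2,3)] partial_deriv_conv[OF C_class_Suc_partial[OF \<eta>] bs assms(3)])
  also have "\<dots> = conv (laplacian \<eta>) f x"
    unfolding conv_def laplacian_def sum_distrib_right
    by (rule Bochner_Integration.integral_sum[symmetric]) (intro Cc_integrable Cc_conv_integrand p assms(3))
  finally show "laplacian (conv \<eta> f) x = conv (laplacian \<eta>) f x" .
qed

lemma conv_partial_deriv:
  assumes \<eta>: "C_class (Suc k) \<eta>" "bounded {x. \<eta> x \<noteq> 0}" and f: "C_class (Suc l) f" "bounded {x. f x \<noteq> 0}" and b: "b \<in> Basis"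
  shows "conv (partial_deriv b \<eta>) f = conv \<eta> (partial_deriv b f)"
proof
  fix x
  have r: "C_class (Suc k) (\<lambda>y. \<eta> (x + (-1) *\<^sub>R y))"
    by (rule C_class_affine[OF \<eta>(1)])
  have "(LBINT y. f y * partial_deriv b (\<lambda>y. \<eta> (x + (-1) *\<^sub>R y)) y)
      = - (LBINT y. partial_deriv b f y * \<eta> (x + (-1) *\<^sub>R y))"
    by (rule integral_by_parts_partial_deriv[OF f r b])
  then show "conv (partial_deriv b \<eta>) f x = conv \<eta> (partial_deriv b f) x"
    unfolding partial_deriv_affine[OF \<eta>(1) b] conv_def by (simp add: mult.commute)
qed

lemma conv_linear:
  assumes \<eta>: "Cc \<eta>" and f: "Cc f" "Cc g"
  shows "conv \<eta> (\<lambda>x. f x + c * g x) = (\<lambda>x. conv \<eta> f x + c * conv \<eta> g x)"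
proof
  fix x
  have "(LBINT y. \<eta> (x - y) * (f y + c * g y)) = (LBINT y. \<eta> (x - y) * f y + c * (\<eta> (x - y) * g y))"
    by (simp add: algebra_simps)
  also have "\<dots> = (LBINT y. \<eta> (x - y) * f y) + c * (LBINT y. \<eta> (x - y) * g y)"
    by (subst Bochner_Integration.integral_add)
      (auto intro!: integrable_mult_right Cc_integrable Cc_conv_integrand assms)
  finally show "conv \<eta> (\<lambda>x. f x + c * g x) x = conv \<eta> f x + c * conv \<eta> g x"
    unfolding conv_def .
qed

text \<open>The integrand is itself continuous with compact support on the product space, where
  \<open>x - y\<close> and \<open>y\<close> bounded force \<open>x\<close> bounded; integrability is
  then automatic.\<close>

lemma Cc_fubini:
  fixes f :: "'a::euclidean_space \<Rightarrow> real"
  assumes \<eta>: "Cc \<eta>" and f: "Cc f" and g: "continuous_on UNIV g"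
  shows "(LBINT x. LBINT y. \<eta> (x - y) * f y * g x) = (LBINT y. LBINT x. \<eta> (x - y) * f y * g x)"
proof -
  obtain r s where rs: "\<And>x. \<eta> x \<noteq> 0 \<Longrightarrow> norm x \<le> r" "\<And>x. f x \<noteq> 0 \<Longrightarrow> norm x \<le> s"
    using \<eta> f by (auto simp: Cc_def bounded_iff)
  have "Cc (\<lambda>z. \<eta> (fst z - snd z) * f (snd z) * g (fst z))"
    unfolding Cc_def
  proof
    have *: "continuous_on UNIV (\<lambda>z. h (k z))" if "continuous_on UNIV h" "continuous_on UNIV k"
      for h :: "'a \<Rightarrow> real" and k :: "'a \<times> 'a \<Rightarrow> 'a"
      using that by (rule continuous_on_compose2) auto
    show "continuous_on UNIV (\<lambda>z. \<eta> (fst z - snd z) * f (snd z) * g (fst z))"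
      by (intro continuous_on_mult * Cc_continuous[OF \<eta>] Cc_continuous[OF f] g continuous_on_diff continuous_on_fst continuous_on_snd continuous_on_id)
    show "bounded {z. \<eta> (fst z - snd z) * f (snd z) * g (fst z) \<noteq> 0}"
    proof (rule boundedI[of _ "r + s + s"])
      fix z assume "z \<in> {z. \<eta> (fst z - snd z) * f (snd z) * g (fst z) \<noteq> 0}"
      then have "norm (fst z - snd z) \<le> r" "norm (snd z) \<le> s"
        using rs by auto
      then show "norm z \<le> r + s + s"
        using norm_triangle_ineq[of "fst z - snd z" "snd z"] norm_Pair_le[of "fst z" "snd z"] by simp
    qed
  qed
  then have "integrable (lborel \<Otimes>\<^sub>M lborel) (\<lambda>(x, y). \<eta> (x - y) * f y * g x)"
    unfolding lborel_prod by (auto dest: Cc_integrable simp: case_prod_beta')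
  from lborel_pair.Fubini_integral[OF this] show ?thesis by simp
qed

lemma conv_adjoint:
  assumes \<eta>: "Cc \<eta>" and even: "\<And>x. \<eta> (- x) = \<eta> x" and f: "Cc f" and g: "Cc g"
  shows "(LBINT x. conv \<eta> f x * g x) = (LBINT x. f x * conv \<eta> g x)"
proof -
  have "(LBINT x. conv \<eta> f x * g x) = (LBINT x. LBINT y. \<eta> (x - y) * f y * g x)"
    by (simp add: conv_def)
  also have "\<dots> = (LBINT y. LBINT x. \<eta> (x - y) * f y * g x)"
    by (rule Cc_fubini[OF \<eta> f Cc_continuous[OF g]])
  also have "\<dots> = (LBINT y. f y * (LBINT x. \<eta> (y - x) * g x))"
  proof (intro Bochner_Integration.integral_cong refl)
    fix y
    have "(LBINT x. \<eta> (x - y) * f y * g x) = (LBINT x. f y * (\<eta> (y - x) * g x))"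
      by (intro Bochner_Integration.integral_cong refl) (metis even minus_diff_eq mult.assoc mult.commute)
    then show "(LBINT x. \<eta> (x - y) * f y * g x) = f y * (LBINT x. \<eta> (y - x) * g x)"
      by simp
  qed
  finally show ?thesis by (simp add: conv_def)
qed

text \<open>Only a positive upper bound \<open>A\<close> for the mass of the weight enters, so a
  weight of mass zero needs no separate case.\<close>

lemma weighted_cauchy_schwarz:
  assumes h: "Cc h" and f: "Cc f" and A: "(LBINT y. \<bar>h y\<bar>) \<le> A" "0 < A"
  shows "(LBINT y. h y * f y)\<^sup>2 \<le> A * (LBINT y. \<bar>h y\<bar> * (f y)\<^sup>2)"
proof -
  define S Q where "S = (LBINT y. h y * f y)" and "Q = (LBINT y. \<bar>h y\<bar> * (f y)\<^sup>2)"
  note cc = Cc_abs[OF h] Cc_power2[OF f] Cc_abs[OF f]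
  have "\<bar>S\<bar> \<le> (LBINT y. \<bar>h y\<bar> * \<bar>f y\<bar>)"
    unfolding S_def using integral_abs_bound[of lborel "\<lambda>y. h y * f y"] by (simp add: abs_mult)
  \<comment> \<open>The minimizer in \<open>t\<close> of
    \<open>Q - 2 * t * \<bar>S\<bar> + t\<^sup>2 * A\<close>.\<close>
  define t where "t = \<bar>S\<bar> / A"
  have t: "0 \<le> t" using A by (simp add: t_def)
  have "0 \<le> (LBINT y. \<bar>h y\<bar> * (\<bar>f y\<bar> - t)\<^sup>2)"
    by (intro integral_nonneg_AE) auto
  also have "\<dots> = (LBINT y. \<bar>h y\<bar> * (f y)\<^sup>2 + (- 2 * t) * (\<bar>h y\<bar> * \<bar>f y\<bar>) + t\<^sup>2 * \<bar>h y\<bar>)"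
    by (intro Bochner_Integration.integral_cong refl) (simp add: power2_diff algebra_simps)
  also have "\<dots> = Q + (- 2 * t) * (LBINT y. \<bar>h y\<bar> * \<bar>f y\<bar>) + t\<^sup>2 * (LBINT y. \<bar>h y\<bar>)"
    unfolding Q_def
    by (simp add: Bochner_Integration.integral_add Cc_integrable Cc_mult cc Cc_cmult del: Bochner_Integration.integral_mult_right_zero minus_mult_left[symmetric])
  also have "\<dots> \<le> Q + (- 2 * t) * \<bar>S\<bar> + t\<^sup>2 * A"
    using \<open>\<bar>S\<bar> \<le> _\<close> A t by (intro add_mono mult_left_mono mult_left_mono_neg) auto
  also have "\<dots> = Q - S\<^sup>2 / A"
    using A by (simp add: t_def field_simps power2_eq_square)
  finally show ?thesis
    using A by (simp add: S_def Q_def field_simps)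
qed

text \<open>Schur's argument: Cauchy-Schwarz with the weight
  \<open>\<bar>\<eta> (x - y)\<bar>\<close> for each \<open>x\<close>, then Fubini, using the bound
  \<open>A\<close> once for each variable.\<close>

lemma conv_L2_bound:
  assumes \<eta>: "Cc \<eta>" and f: "Cc f" and A: "(LBINT y. \<bar>\<eta> y\<bar>) \<le> A" "0 < A"
  shows "(LBINT x. (conv \<eta> f x)\<^sup>2) \<le> A\<^sup>2 * (LBINT x. (f x)\<^sup>2)"
proof -
  let ?\<kappa> = "\<lambda>x. \<bar>\<eta> x\<bar>" and ?g = "\<lambda>x. (f x)\<^sup>2"
  note cc = Cc_abs[OF \<eta>] Cc_power2[OF f]
  have refl: "Cc (\<lambda>y. \<eta> (x - y))" for x
    using Cc_affine[OF \<eta>, of "-1" x] by simp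
  have shift: "(LBINT y. \<bar>\<eta> (x - y)\<bar>) = (LBINT y. \<bar>\<eta> y\<bar>)" for x
  proof -
    have "(LBINT y. \<bar>\<eta> (x - y)\<bar>) = (LBINT y. \<bar>\<eta> (x + y)\<bar>)"
      using integral_lborel_scaleR[of "\<lambda>y. \<bar>\<eta> (x - y)\<bar>" "-1"] Cc_continuous[OF Cc_abs[OF refl]]
      by (simp add: borel_measurable_continuous_onI)
    also have "\<dots> = (LBINT y. \<bar>\<eta> y\<bar>)"
      using integral_lborel_shift[of "\<lambda>y. \<bar>\<eta> y\<bar>" x] Cc_continuous[OF cc(1)]
      by (simp add: borel_measurable_continuous_onI add.commute)
    finally show ?thesis .
  qed
  have shift': "(LBINT x. \<bar>\<eta> (x - y)\<bar>) = (LBINT y. \<bar>\<eta> y\<bar>)" for y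
    using integral_lborel_shift[of "\<lambda>y. \<bar>\<eta> y\<bar>" "- y"] Cc_continuous[OF cc(1)]
    by (simp add: borel_measurable_continuous_onI)
  have "(conv \<eta> f x)\<^sup>2 \<le> A * conv ?\<kappa> ?g x" for x
    unfolding conv_def by (rule weighted_cauchy_schwarz[OF refl f]) (simp_all add: shift A)
  then have "(LBINT x. (conv \<eta> f x)\<^sup>2) \<le> (LBINT x. A * conv ?\<kappa> ?g x)"
    by (intro integral_mono Cc_integrable Cc_power2 Cc_cmult Cc_conv \<eta> f cc)
  also have "\<dots> = A * (LBINT x. conv ?\<kappa> ?g x)"
    by simp
  also have "\<dots> \<le> A * (A * (LBINT x. (f x)\<^sup>2))"
  proof (rule mult_left_mono)
    have "(LBINT x. conv ?\<kappa> ?g x) = (LBINT y. LBINT x. \<bar>\<eta> (x - y)\<bar> * (f y)\<^sup>2)"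
      unfolding conv_def using Cc_fubini[OF cc, of "\<lambda>_. 1"] by simp
    also have "\<dots> = (LBINT y. \<bar>\<eta> y\<bar>) * (LBINT x. (f x)\<^sup>2)"
      by (simp add: shift')
    also have "\<dots> \<le> A * (LBINT x. (f x)\<^sup>2)"
      by (intro mult_right_mono A integral_nonneg_AE) auto
    finally show "(LBINT x. conv ?\<kappa> ?g x) \<le> A * (LBINT x. (f x)\<^sup>2)" .
  qed (use A in simp)
  finally show ?thesis
    by (simp add: power2_eq_square mult.assoc)
qed


subsection \<open>Comparing quadratic forms from a comparison of their squares\<close>

definition ip :: "('a::euclidean_space \<Rightarrow> real) \<Rightarrow> ('a \<Rightarrow> real) \<Rightarrow> real" where
  "ip f g = (LBINT x. f x * g x)"

lemma ip_commute: "ip f g = ip g f"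
  by (simp add: ip_def mult.commute)

lemma ip_self_nonneg: "0 \<le> ip f f"
  unfolding ip_def by (intro integral_nonneg_AE) auto

lemma ip_linear_left:
  assumes "Cc f" "Cc g" "Cc h"
  shows "ip (\<lambda>x. f x + c * g x) h = ip f h + c * ip g h"
proof -
  have "ip (\<lambda>x. f x + c * g x) h = (LBINT x. f x * h x + c * (g x * h x))"
    unfolding ip_def by (simp add: algebra_simps)
  then show ?thesis
    unfolding ip_def using assms by (simp add: Bochner_Integration.integral_add Cc_integrable Cc_mult Cc_cmult)
qed

lemma ip_linear_right:
  assumes "Cc f" "Cc g" "Cc h"
  shows "ip h (\<lambda>x. f x + c * g x) = ip h f + c * ip h g"
  using ip_linear_left[OF assms] by (simp add: ip_commute)

lemma ip_young:
  assumes "Cc f" "Cc g" "0 < \<delta>"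
  shows "2 * \<bar>ip f g\<bar> \<le> \<delta> * ip f f + ip g g / \<delta>"
proof -
  have *: "0 \<le> \<delta>\<^sup>2 * ip f f + 2 * s * \<delta> * ip f g + ip g g" if s: "s * s = 1" for s
  proof -
    have dil: "Cc (\<lambda>x. g x + (s * \<delta>) * f x)"
      by (intro Cc_add Cc_cmult assms)
    have "0 \<le> ip (\<lambda>x. g x + (s * \<delta>) * f x) (\<lambda>x. g x + (s * \<delta>) * f x)"
      by (rule ip_self_nonneg)
    also have "\<dots> = ip g g + (s * \<delta>) * ip f g + (s * \<delta>) * (ip f g + (s * \<delta>) * ip f f)"
      by (simp only: ip_linear_left[OF assms(2,1) dil] ip_linear_right[OF assms(2,1)] assms ip_commute[of g f])
    also have "\<dots> = (s * s) * \<delta>\<^sup>2 * ip f f + 2 * s * \<delta> * ip f g + ip g g"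
      by (simp add: power2_eq_square algebra_simps)
    finally show ?thesis using s by simp
  qed
  have "2 * \<bar>ip f g\<bar> * \<delta> \<le> \<delta>\<^sup>2 * ip f f + ip g g"
    using *[of 1] *[of "-1"] by (cases "0 \<le> ip f g") (simp_all add: mult_ac)
  also have "\<dots> = (\<delta> * ip f f + ip g g / \<delta>) * \<delta>"
    using assms(3) by (simp add: field_simps power2_eq_square)
  finally show ?thesis
    using assms(3) by (rule mult_right_le_imp_le)
qed

text \<open>The Loewner--Heinz inequality for bounded operators. If the form of \<open>K - W\<close> had the negative
  infimum \<open>-l\<close> on the unit sphere, a minimizing sequence for \<open>B = K - W + l\<close> would satisfy
  \<open>B f \<rightarrow> 0\<close>, which contradicts \<open>0 \<le> \<parallel>K f\<parallel>\<^sup>2 - \<parallel>W f\<parallel>\<^sup>2 = \<langle>(K + W) f, (B - l) f\<rangle>\<close>.\<close>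

lemma loewner_heinz:
  fixes K W :: "('a::euclidean_space \<Rightarrow> real) \<Rightarrow> 'a \<Rightarrow> real"
  assumes cc: "\<And>f. Cc f \<Longrightarrow> Cc (K f)" "\<And>f. Cc f \<Longrightarrow> Cc (W f)"
    and lin: "\<And>f g c. Cc f \<Longrightarrow> Cc g \<Longrightarrow> K (\<lambda>x. f x + c * g x) = (\<lambda>x. K f x + c * K g x)"
      "\<And>f g c. Cc f \<Longrightarrow> Cc g \<Longrightarrow> W (\<lambda>x. f x + c * g x) = (\<lambda>x. W f x + c * W g x)"
    and sym: "\<And>f g. Cc f \<Longrightarrow> Cc g \<Longrightarrow> ip (K f) g = ip f (K g)"
      "\<And>f g. Cc f \<Longrightarrow> Cc g \<Longrightarrow> ip (W f) g = ip f (W g)"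
    and pos: "\<And>f. Cc f \<Longrightarrow> 0 \<le> ip (K f) f"
    and dom: "\<And>f. Cc f \<Longrightarrow> ip (W f) (W f) \<le> ip (K f) (K f)"
    and bdd: "\<And>f. Cc f \<Longrightarrow> ip (K f) (K f) \<le> C * ip f f"
    and f: "Cc f"
  shows "ip (W f) f \<le> ip (K f) f"
proof (rule ccontr)
  assume neg: "\<not> ?thesis"
  define E where "E = \<bar>C\<bar> + 1"
  have E: "1 \<le> E" by (simp add: E_def)
  have bK: "ip (K g) (K g) \<le> E * ip g g" if "Cc g" for g
  proof -
    have "C * ip g g \<le> E * ip g g"
      by (intro mult_right_mono ip_self_nonneg) (simp add: E_def)
    then show ?thesis using bdd[OF that] by linarith
  qed
  have bW: "ip (W g) (W g) \<le> E * ip g g" if "Cc g" for g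
    using dom[OF that] bK[OF that] by linarith
  define q where "q g = ip (K g) g - ip (W g) g" for g
  have q_abs: "\<bar>q g\<bar> \<le> (E + 1) * ip g g" if "Cc g" for g
    using ip_young[OF cc(1)[OF that] that, of 1] ip_young[OF cc(2)[OF that] that, of 1] bK[OF that] bW[OF that]
    by (simp add: q_def algebra_simps abs_le_iff) linarith
  \<comment> \<open>Homogeneous form of the statement that \<open>- l\<close> is a lower bound of
    \<open>q\<close> on the unit sphere; \<open>- Inf L\<close> is the infimum, and no function has
    to be normalised.\<close>
  define L where "L = {l. \<forall>g. Cc g \<longrightarrow> 0 \<le> q g + l * ip g g}"
  define l where "l = Inf L"
  have mem: "E + 1 \<in> L"
    using q_abs by (fastforce simp: L_def abs_le_iff)
  have qf: "q f < 0" using neg by (simp add: q_def)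
  have ff: "0 < ip f f"
    using q_abs[OF f] qf E ip_self_nonneg[of f] by (cases "ip f f = 0") auto
  have low: "- q f / ip f f \<le> m" if "m \<in> L" for m
  proof -
    have "0 \<le> q f + m * ip f f" using that f by (simp add: L_def)
    then show ?thesis using ff by (simp add: field_simps)
  qed
  have l_pos: "0 < l"
  proof -
    have "- q f / ip f f \<le> l"
      unfolding l_def using mem low by (intro cInf_greatest) auto
    moreover have "0 < - q f / ip f f" using qf ff by (simp add: divide_neg_pos)
    ultimately show ?thesis by linarith
  qed
  have bdd_L: "bdd_below L"
    using low by (intro bdd_belowI)
  have l_mem: "0 \<le> q g + l * ip g g" if g: "Cc g" for g
  proof (cases "ip g g = 0")
    case True
    then show ?thesis using q_abs[OF g] by simp
  next
    case False
    then have gg: "0 < ip g g" using ip_self_nonneg[of g] by simp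
    have "- q g / ip g g \<le> l"
      unfolding l_def
    proof (rule cInf_greatest)
      show "L \<noteq> {}" using mem by blast
      fix m assume "m \<in> L"
      then have "0 \<le> q g + m * ip g g" using g by (simp add: L_def)
      then show "- q g / ip g g \<le> m" using gg by (simp add: field_simps)
    qed
    then show ?thesis using gg by (simp add: field_simps)
  qed
  define B where "B g = (\<lambda>x. (K g x + (-1) * W g x) + l * g x)" for g
  have ccT: "Cc (\<lambda>x. K g x + (-1) * W g x)" if "Cc g" for g
    by (intro Cc_add Cc_cmult cc that)
  have ccB: "Cc (B g)" if "Cc g" for g
    unfolding B_def by (intro Cc_add Cc_cmult cc that)
  have ip_B: "ip (B g) h = ip (K g) h - ip (W g) h + l * ip g h" if "Cc g" "Cc h" for g h
    unfolding B_def using that by (simp only: ip_linear_left[OF ccT] ip_linear_left[OF cc])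
  have B_self: "ip (B g) g = q g + l * ip g g" if "Cc g" for g
    using ip_B[OF that that] by (simp add: q_def)
  have B_sym: "ip (B g) h = ip (B h) g" if "Cc g" "Cc h" for g h
    using ip_B[OF that] ip_B[OF that(2,1)] sym(1)[OF that] sym(2)[OF that]
      ip_commute[of g h] ip_commute[of g "K h"] ip_commute[of g "W h"] by simp
  have B_lin: "B (\<lambda>x. g x + c * h x) = (\<lambda>x. B g x + c * B h x)" if "Cc g" "Cc h" for g h c
    unfolding B_def lin(1)[OF that] lin(2)[OF that] by (simp add: algebra_simps)
  define D where "D = E + 1 + l"
  have D: "0 < D" using E l_pos by (simp add: D_def)
  have B_small: "ip (B g) (B g) \<le> D * ip (B g) g" if g: "Cc g" for g
  proof -
    \<comment> \<open>Nonnegativity of the form of \<open>B\<close> at \<open>g - B g / D\<close>,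
      where \<open>D\<close> bounds this form, gives the Cauchy-Schwarz type bound of
      \<open>B g\<close> by the form at \<open>g\<close>.\<close>
    define t where "t = - 1 / D"
    let ?h = "\<lambda>x. g x + t * B g x"
    have ccs: "Cc g" "Cc (B g)" "Cc (B (B g))" "Cc ?h"
      by (intro g ccB Cc_add Cc_cmult)+
    have "0 \<le> ip (B ?h) ?h"
      using l_mem[OF ccs(4)] B_self[OF ccs(4)] by simp
    also have "\<dots> = ip (B g) g + t * ip (B g) (B g) + t * (ip (B (B g)) g + t * ip (B (B g)) (B g))"
      by (simp only: B_lin[OF ccs(1,2)] ip_linear_left[OF ccs(2,3,4)] ip_linear_right[OF ccs(1,2)] ccs)
    also have "\<dots> = ip (B g) g + 2 * t * ip (B g) (B g) + t\<^sup>2 * ip (B (B g)) (B g)"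
      using B_sym[OF ccs(2,1)] by (simp add: power2_eq_square algebra_simps)
    also have "ip (B (B g)) (B g) \<le> D * ip (B g) (B g)"
      using B_self[OF ccs(2)] q_abs[OF ccs(2)] by (simp add: D_def algebra_simps abs_le_iff)
    then have "ip (B g) g + 2 * t * ip (B g) (B g) + t\<^sup>2 * ip (B (B g)) (B g)
        \<le> ip (B g) g + 2 * t * ip (B g) (B g) + t\<^sup>2 * (D * ip (B g) (B g))"
      by (intro add_left_mono mult_left_mono) auto
    also have "\<dots> = ip (B g) g - ip (B g) (B g) / D"
      using D by (simp add: t_def power2_eq_square field_simps)
    finally show ?thesis using D by (simp add: field_simps)
  qed
  \<comment> \<open>With these parameters Young's inequality gives each of the two terms bounding
    \<open>2 * ip S (B g)\<close> the share \<open>l\<^sup>2 / 2 * ip g g\<close>. The bound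
    \<open>\<epsilon> \<le> l / 4\<close> makes the opposite estimate at least
    \<open>3 / 2 * l\<^sup>2 * ip g g\<close>.\<close>
  define \<delta> where "\<delta> = l\<^sup>2 / (8 * E)"
  define \<epsilon> where "\<epsilon> = min (l / 4) (\<delta> * l\<^sup>2 / (2 * D))"
  have \<delta>: "0 < \<delta>" using l_pos E by (simp add: \<delta>_def)
  have \<epsilon>: "0 < \<epsilon>" "\<epsilon> \<le> l / 4" "\<epsilon> * D / \<delta> \<le> l\<^sup>2 / 2"
  proof -
    show "0 < \<epsilon>" "\<epsilon> \<le> l / 4" using l_pos \<delta> D by (auto simp: \<epsilon>_def)
    have "\<epsilon> \<le> \<delta> * l\<^sup>2 / (2 * D)" by (simp add: \<epsilon>_def)
    then show "\<epsilon> * D / \<delta> \<le> l\<^sup>2 / 2" using \<delta> D by (simp add: field_simps)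
  qed
  \<comment> \<open>Failure of the bound just below the infimum of \<open>L\<close> supplies a
    nearly minimizing function \<open>g\<close>.\<close>
  have "l - \<epsilon> \<notin> L"
    using cInf_lower[OF _ bdd_L, of "l - \<epsilon>"] \<epsilon> by (auto simp: l_def)
  then obtain g where g: "Cc g" "q g + (l - \<epsilon>) * ip g g < 0"
    by (auto simp: L_def not_le)
  have Bgg: "ip (B g) g < \<epsilon> * ip g g"
    using g(2) B_self[OF g(1)] by (simp add: algebra_simps)
  have "0 < \<epsilon> * ip g g"
    using Bgg B_self[OF g(1)] l_mem[OF g(1)] by linarith
  then have gg: "0 < ip g g"
    using \<epsilon>(1) by (rule zero_less_mult_pos)
  define S where "S = (\<lambda>x. K g x + 1 * W g x)"
  have ccS: "Cc S" unfolding S_def by (intro Cc_add Cc_cmult cc g)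
  note ccg = cc[OF g(1)] g(1) ccB[OF g(1)]
  have ipS: "ip S h = ip (K g) h + ip (W g) h" if "Cc h" for h
    unfolding S_def using ip_linear_left[OF ccg(1,2) that, of 1] by simp
  have "ip S (B g) = ip (K g) (B g) + ip (W g) (B g)"
    by (rule ipS[OF ccg(4)])
  also have "\<dots> = (ip (K g) (K g) - ip (W g) (W g)) + l * ip S g"
    using ip_B[OF g(1) ccg(1)] ip_B[OF g(1) ccg(2)] ipS[OF g(1)]
    by (simp add: ip_commute[of _ "B g"] ip_commute[of "W g" "K g"] ip_commute[of g] algebra_simps)
  finally have low_S: "l * ip S g \<le> ip S (B g)"
    using dom[OF g(1)] by simp
  have "ip S g = 2 * ip (K g) g - q g"
    using ipS[OF g(1)] by (simp add: q_def)
  then have "(l - \<epsilon>) * ip g g \<le> ip S g"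
    using pos[OF g(1)] g(2) by simp
  then have "l * ((l - \<epsilon>) * ip g g) \<le> l * ip S g"
    using l_pos by (intro mult_left_mono) auto
  moreover have SS: "ip S S \<le> 4 * (E * ip g g)"
  proof -
    have "ip S S = ip (K g) (K g) + 2 * ip (K g) (W g) + ip (W g) (W g)"
      using ipS[OF ccS] ipS[OF ccg(1)] ipS[OF ccg(2)] ip_commute[of "K g" S] ip_commute[of "W g" S] ip_commute[of "W g" "K g"]
      by linarith
    moreover have "2 * ip (K g) (W g) \<le> ip (K g) (K g) + ip (W g) (W g)"
      using ip_young[OF ccg(1,2), of 1] by linarith
    ultimately show ?thesis
      using bK[OF g(1)] bW[OF g(1)] by linarith
  qed
  moreover have "2 * \<bar>ip S (B g)\<bar> \<le> \<delta> * ip S S + ip (B g) (B g) / \<delta>"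
    by (rule ip_young[OF ccS ccg(4) \<delta>])
  moreover have "ip (B g) (B g) / \<delta> \<le> (\<epsilon> * D / \<delta>) * ip g g"
  proof -
    have "ip (B g) (B g) \<le> D * (\<epsilon> * ip g g)"
      using B_small[OF g(1)] Bgg D by (meson less_imp_le mult_left_mono order_trans)
    then show ?thesis using \<delta> by (simp add: field_simps)
  qed
  moreover have "(\<epsilon> * D / \<delta>) * ip g g \<le> l\<^sup>2 / 2 * ip g g"
    using \<epsilon>(3) gg by (intro mult_right_mono) auto
  moreover have "\<delta> * ip S S \<le> \<delta> * (4 * (E * ip g g))"
    using SS \<delta> by (intro mult_left_mono) auto
  moreover have "\<delta> * (4 * (E * ip g g)) = l\<^sup>2 / 2 * ip g g"
    using E by (simp add: \<delta>_def)
  moreover have "l\<^sup>2 * ip g g = l\<^sup>2 / 2 * ip g g + l\<^sup>2 / 2 * ip g g"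
    by simp
  ultimately have "2 * (l * ((l - \<epsilon>) * ip g g)) \<le> l\<^sup>2 * ip g g"
    using low_S abs_ge_self[of "ip S (B g)"] by linarith
  then have "(2 * l * (l - \<epsilon>)) * ip g g \<le> l\<^sup>2 * ip g g"
    by (simp only: mult_ac)
  then have "2 * l * (l - \<epsilon>) \<le> l * l"
    using gg by (simp add: mult_le_cancel_right_pos power2_eq_square)
  moreover have "l * (3 / 4 * l) \<le> l * (l - \<epsilon>)"
    using \<epsilon>(2) l_pos by (intro mult_left_mono) auto
  moreover have "0 < l * l" using l_pos by simp
  ultimately show False by (simp add: algebra_simps)
qed

subsection \<open>Stability in first-order form\<close>

lemma lebesgue_integral_continuous:
  fixes f :: "'a::euclidean_space \<Rightarrow> real"
  assumes "continuous_on UNIV f"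
  shows "(\<integral>x. f x \<partial>lebesgue) = (LBINT x. f x)" "integrable lebesgue f \<longleftrightarrow> integrable lborel f"
  using borel_measurable_continuous_onI[OF assms] by (simp_all add: integral_completion integrable_completion)

lemma locally_integrable_continuous:
  fixes f :: "'a::euclidean_space \<Rightarrow> real"
  assumes f: "continuous_on UNIV f"
  shows "locally_integrable f"
  unfolding locally_integrable_def set_integrable_def
proof (intro allI impI)
  fix K :: "'a set" assume K: "compact K"
  have "integrable lborel (\<lambda>x. indicator K x *\<^sub>R f x)"
    by (rule borel_integrable_compact[OF K]) (use f continuous_on_subset in blast)
  moreover from this have "(\<lambda>x. indicator K x *\<^sub>R f x) \<in> borel_measurable lborel"
    by blast
  ultimately show "integrable lebesgue (\<lambda>x. indicator K x *\<^sub>R f x)"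
    by (simp only: integrable_completion)
qed

lemma weak_partial_deriv_classical:
  assumes f: "C_class (Suc k) f" and b: "b \<in> Basis"
  shows "weak_partial_deriv b f (partial_deriv b f)"
  unfolding weak_partial_deriv_def
proof (intro conjI allI impI)
  note cf = C_class_continuous[OF f] and cp = C_class_continuous[OF C_class_Suc_partial[OF f b]]
  show "locally_integrable f" "locally_integrable (partial_deriv b f)"
    by (intro locally_integrable_continuous cf cp)+
  fix \<eta> :: "'a \<Rightarrow> real" assume "test_function \<eta>"
  then have \<eta>: "C_class (Suc 0) \<eta>" and bd: "bounded {x. \<eta> x \<noteq> 0}"
    using bounded_subset[OF compact_imp_bounded closure_subset] by (auto simp: test_function_def simp del: C_class.simps)
  have "(LBINT x. \<eta> x * partial_deriv b f x) = - (LBINT x. partial_deriv b \<eta> x * f x)"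
    by (rule integral_by_parts_partial_deriv[OF \<eta> bd f b])
  then show "(LINT x|lebesgue. f x * partial_deriv b \<eta> x) = - (LINT x|lebesgue. partial_deriv b f x * \<eta> x)"
    using cf cp C_class_continuous[OF \<eta>] C_class_continuous[OF C_class_Suc_partial[OF \<eta> b]]
    by (simp add: lebesgue_integral_continuous continuous_on_mult mult.commute del: C_class.simps)
qed

lemma square_integrable_Cc: "Cc f \<Longrightarrow> square_integrable f"
  unfolding square_integrable_def
  using measurable_completion[of f lborel borel] borel_measurable_continuous_onI[of f]
    lebesgue_integral_continuous(2)[OF Cc_continuous[OF Cc_power2]] Cc_integrable[OF Cc_power2]
  by (auto simp: Cc_continuous)

lemma sobolev_C_class:
  assumes "C_class k f" "bounded {x. f x \<noteq> 0}"
  shows "sobolev k f"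
  using assms
proof (induction k arbitrary: f)
  case 0
  then show ?case by (simp add: square_integrable_Cc Cc_def)
next
  case (Suc k)
  have "Cc f"
    by (rule C_class_Cc[OF Suc.prems])
  moreover have "\<exists>g. weak_partial_deriv b f g \<and> sobolev k g" if b: "b \<in> Basis" for b
    using weak_partial_deriv_classical[OF Suc.prems(1) b] Suc.IH[OF C_class_Suc_partial[OF Suc.prems(1) b] bounded_support_partial_deriv[OF Suc.prems(2)]]
    by blast
  ultimately show ?case
    by (simp add: square_integrable_Cc)
qed

lemma weak_laplacian_classical:
  assumes "C_class 2 f"
  shows "weak_laplacian f (laplacian f)"
proof -
  note f = C_class_2D[OF assms]
  show ?thesis
    unfolding weak_laplacian_def laplacian_def
    using weak_partial_deriv_classical[OF f] weak_partial_deriv_classical[OF C_class_Suc_partial[OF f]]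
    by (intro exI[of _ "\<lambda>b. partial_deriv b f"] exI[of _ "\<lambda>b. partial_deriv b (partial_deriv b f)"]) blast
qed

text \<open>For a compactly supported test function of class 2 both integrals in
  \<open>stability_form\<close> are finite, so the extended-real inequality becomes a real
  one.\<close>

lemma stability_classical:
  fixes u :: "'a::euclidean_space \<Rightarrow> real"
  assumes stable: "stable_solution p u" and p: "1 < p" and \<phi>: "C_class 2 \<phi>" "bounded {x. \<phi> x \<noteq> 0}"
  shows "p * (LBINT x. u x powr (p - 1) * (\<phi> x)\<^sup>2) \<le> (LBINT x. (laplacian \<phi> x)\<^sup>2)"
proof -
  interpret lane_emden4 p u
    using stable p by unfold_locales (simp_all add: stable_solution_def)
  have Cc_\<phi>: "Cc \<phi>"
    by (rule C_class_Cc[OF \<phi>])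
  have cc: "Cc (\<lambda>x. (laplacian \<phi> x)\<^sup>2)" "Cc (\<lambda>x. u x powr (p - 1) * (\<phi> x)\<^sup>2)"
    by (intro Cc_power2 Cc_laplacian \<phi>) (intro Cc_mult_left continuous_u_powr Cc_power2 Cc_\<phi>)
  have nn: "(\<integral>\<^sup>+x. ennreal (f x) \<partial>lebesgue) = ennreal (LBINT x. f x)" if "Cc f" "\<And>x. 0 \<le> f x" for f :: "'a \<Rightarrow> real"
    using that nn_integral_eq_integral[OF Cc_integrable[OF that(1)]] by (simp add: nn_integral_completion)
  have "0 \<le> stability_form p u \<phi> (laplacian \<phi>)"
    using stable sobolev_C_class[OF \<phi>] weak_laplacian_classical[OF \<phi>(1)] by (auto simp: stable_solution_def)
  also have "\<dots> = ereal (LBINT x. (laplacian \<phi> x)\<^sup>2) - ereal (p * (LBINT x. u x powr (p - 1) * (\<phi> x)\<^sup>2))"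
    unfolding stability_form_def power2_abs using nn[OF cc(1)] nn[OF cc(2)]
    by (simp add: enn2ereal_ennreal integral_nonneg_AE)
  finally show ?thesis
    by simp
qed

text \<open>Mollification makes \<open>- \<Delta>\<close> bounded in the L2 norm, with kernel
  \<open>laplacian \<eta>\<close>, so that \<open>loewner_heinz\<close> applies. Convolution with an
  even nonnegative kernel of mass 1 is a symmetric contraction, so the comparison of the squares
  survives and the gradient form does not grow.\<close>

lemma second_order_imp_first_order_bounded:
  fixes V :: "'a::euclidean_space \<Rightarrow> real"
  assumes V: "continuous_on UNIV V" "\<And>x. 0 \<le> V x" "\<And>x. V x \<le> M"
    and second: "\<And>\<phi>. C_class 2 \<phi> \<Longrightarrow> bounded {x. \<phi> x \<noteq> 0} \<Longrightarrow>
      (LBINT x. (V x * \<phi> x)\<^sup>2) \<le> (LBINT x. (laplacian \<phi> x)\<^sup>2)"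
    and \<eta>: "C_class 2 \<eta>" "Cc \<eta>" "\<And>x. 0 \<le> \<eta> x" "\<And>x. \<eta> (- x) = \<eta> x" "(LBINT x. \<eta> x) = 1"
    and \<phi>: "C_class (Suc 0) \<phi>" "bounded {x. \<phi> x \<noteq> 0}"
  shows "(LBINT x. V x * (conv \<eta> (conv \<eta> \<phi>) x)\<^sup>2) \<le> (LBINT x. grad_dot \<phi> \<phi> x)"
proof -
  have supp: "bounded {x. \<eta> x \<noteq> 0}" using \<eta>(2) by (simp add: Cc_def)
  have \<eta>1: "C_class (Suc 0) \<eta>" using \<eta>(1) by (rule C_class_mono) simp
  let ?P = "conv \<eta>" and ?\<kappa> = "laplacian \<eta>"
  \<comment> \<open>Up to commuting with derivatives, \<open>K\<close> has one mollifier on each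
    side of \<open>- \<Delta>\<close>; \<open>W\<close> has two on each side of the multiplication
    by \<open>V\<close>. The inner pair in \<open>W\<close> allows \<open>second\<close> to be
    applied to \<open>?P (?P f)\<close>, whose Laplacian is exactly \<open>- K f\<close>.\<close>
  define K W where "K f = (\<lambda>x. - laplacian (?P (?P f)) x)" and "W f = ?P (?P (\<lambda>x. V x * ?P (?P f) x))" for f
  have \<kappa>: "Cc ?\<kappa>" by (rule Cc_laplacian[OF \<eta>(1) supp])
  have ccP: "Cc f \<Longrightarrow> Cc (?P f)" for f
    by (rule Cc_conv[OF \<eta>(2)])
  have ccVP: "Cc f \<Longrightarrow> Cc (\<lambda>x. V x * ?P (?P f) x)" for f
    by (intro Cc_mult_left V ccP)
  have C2P: "Cc f \<Longrightarrow> C_class 2 (?P f)" for f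
    by (rule C_class_conv[OF \<eta>(1) supp])
  have K_conv: "K f = (\<lambda>x. - conv ?\<kappa> (?P f) x)" if "Cc f" for f
    unfolding K_def laplacian_conv[OF \<eta>(1) supp ccP[OF that]] ..
  have \<kappa>_even: "?\<kappa> (- x) = ?\<kappa> x" for x
    using laplacian_affine[OF \<eta>(1), of 0 "-1"] \<eta>(4) by (simp add: fun_eq_iff)
  have L2P: "ip (?P f) (?P f) \<le> ip f f" if "Cc f" for f
    using conv_L2_bound[OF \<eta>(2) that, of 1] \<eta>(3,5) by (simp add: ip_def power2_eq_square)
  have P_sym: "ip (?P f) g = ip f (?P g)" if "Cc f" "Cc g" for f g
    unfolding ip_def by (rule conv_adjoint[OF \<eta>(2,4) that])
  have K_form: "ip (K f) g = (LBINT x. grad_dot (?P f) (?P g) x)" if "Cc f" "Cc g" for f g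
  proof -
    have "ip (K f) g = - ip (conv ?\<kappa> (?P f)) g"
      unfolding K_conv[OF that(1)] ip_def by simp
    also have "ip (conv ?\<kappa> (?P f)) g = ip (?P f) (conv ?\<kappa> g)"
      unfolding ip_def by (rule conv_adjoint[OF \<kappa> \<kappa>_even ccP[OF that(1)] that(2)])
    also have "conv ?\<kappa> g = laplacian (?P g)"
      by (rule laplacian_conv[OF \<eta>(1) supp that(2), symmetric])
    also have "ip (?P f) (laplacian (?P g)) = - (LBINT x. grad_dot (?P f) (?P g) x)"
      unfolding ip_def
      by (rule green_first[OF C_class_conv[OF \<eta>1 supp that(1)] _ C2P[OF that(2)]]) (use ccP[OF that(1)] in \<open>simp add: Cc_def\<close>)
    finally show ?thesis by simp
  qed
  define A where "A = (LBINT x. \<bar>?\<kappa> x\<bar>) + 1"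
  have A: "0 < A" "(LBINT x. \<bar>?\<kappa> x\<bar>) \<le> A"
    using integral_nonneg_AE[of "\<lambda>x. \<bar>?\<kappa> x\<bar>" lborel] by (auto simp: A_def intro: add_nonneg_pos)
  have Cc_\<phi>: "Cc \<phi>" by (rule C_class_Cc[OF \<phi>])
  have "ip (W \<phi>) \<phi> \<le> ip (K \<phi>) \<phi>"
  proof (rule loewner_heinz[OF _ _ _ _ _ _ _ _ _ Cc_\<phi>])
    fix f g :: "'a \<Rightarrow> real" and c :: real assume f: "Cc f" and g: "Cc g"
    show "K (\<lambda>x. f x + c * g x) = (\<lambda>x. K f x + c * K g x)"
      unfolding K_conv[OF Cc_add[OF f Cc_cmult[OF g]]] K_conv[OF f] K_conv[OF g] conv_linear[OF \<eta>(2) f g]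
        conv_linear[OF \<kappa> ccP[OF f] ccP[OF g]] by simp
    have "(\<lambda>x. V x * (?P (?P f) x + c * ?P (?P g) x)) = (\<lambda>x. V x * ?P (?P f) x + c * (V x * ?P (?P g) x))"
      by (simp add: algebra_simps)
    then show "W (\<lambda>x. f x + c * g x) = (\<lambda>x. W f x + c * W g x)"
      unfolding W_def conv_linear[OF \<eta>(2) f g] conv_linear[OF \<eta>(2) ccP[OF f] ccP[OF g]]
      by (simp only: conv_linear[OF \<eta>(2) ccVP[OF f] ccVP[OF g]] conv_linear[OF \<eta>(2) ccP[OF ccVP[OF f]] ccP[OF ccVP[OF g]]])
    show "ip (K f) g = ip f (K g)"
      by (simp only: ip_commute[of f] K_form[OF f g] K_form[OF g f] grad_dot_commute)
    show "ip (W f) g = ip f (W g)"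
    proof -
      have "ip (W f) g = ip (\<lambda>x. V x * ?P (?P f) x) (?P (?P g))"
        unfolding W_def using f g by (simp add: P_sym ccVP ccP)
      also have "\<dots> = ip (?P (?P f)) (\<lambda>x. V x * ?P (?P g) x)"
        by (simp add: ip_def mult_ac)
      also have "\<dots> = ip f (W g)"
        unfolding W_def using f g by (simp add: P_sym ccVP ccP)
      finally show ?thesis .
    qed
  next
    fix f :: "'a \<Rightarrow> real" assume f: "Cc f"
    show "Cc (K f)"
      unfolding K_conv[OF f] by (intro Cc_uminus Cc_conv \<kappa> ccP f)
    show "Cc (W f)"
      unfolding W_def by (intro ccP ccVP f)
    show "0 \<le> ip (K f) f"
      unfolding K_form[OF f f] by (intro integral_nonneg_AE) (simp add: grad_dot_self_nonneg)
    have "ip (W f) (W f) \<le> ip (\<lambda>x. V x * ?P (?P f) x) (\<lambda>x. V x * ?P (?P f) x)"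
      unfolding W_def using L2P[OF ccP[OF ccVP[OF f]]] L2P[OF ccVP[OF f]] by linarith
    also have "\<dots> \<le> (LBINT x. (laplacian (?P (?P f)) x)\<^sup>2)"
      using second[OF C2P[OF ccP[OF f]]] ccP[OF ccP[OF f]] by (simp add: ip_def power2_eq_square Cc_def)
    also have "\<dots> = ip (K f) (K f)"
      by (simp add: ip_def K_def power2_eq_square)
    finally show "ip (W f) (W f) \<le> ip (K f) (K f)" .
    have "ip (K f) (K f) = (LBINT x. (conv ?\<kappa> (?P f) x)\<^sup>2)"
      unfolding K_conv[OF f] by (simp add: ip_def power2_eq_square)
    also have "\<dots> \<le> A\<^sup>2 * ip (?P f) (?P f)"
      using conv_L2_bound[OF \<kappa> ccP[OF f] A(2,1)] by (simp add: ip_def power2_eq_square)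
    also have "\<dots> \<le> A\<^sup>2 * ip f f"
      by (intro mult_left_mono L2P f) auto
    finally show "ip (K f) (K f) \<le> A\<^sup>2 * ip f f" .
  qed
  moreover have "ip (W \<phi>) \<phi> = (LBINT x. V x * (?P (?P \<phi>) x)\<^sup>2)"
  proof -
    have "ip (W \<phi>) \<phi> = ip (\<lambda>x. V x * ?P (?P \<phi>) x) (?P (?P \<phi>))"
      unfolding W_def using Cc_\<phi> by (simp add: P_sym ccVP ccP)
    then show ?thesis by (simp add: ip_def power2_eq_square mult.assoc)
  qed
  \<comment> \<open>Derivatives commute with convolution, so the form of \<open>K\<close> is the
    squared norm of the mollified gradient, to which the contraction property applies.\<close>
  moreover have "ip (K \<phi>) \<phi> \<le> (LBINT x. grad_dot \<phi> \<phi> x)"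
  proof -
    note p\<phi> = Cc_partial_deriv[OF \<phi>]
    have "ip (K \<phi>) \<phi> = (LBINT x. (\<Sum>b\<in>Basis. ?P (partial_deriv b \<phi>) x * ?P (partial_deriv b \<phi>) x))"
      unfolding K_form[OF Cc_\<phi> Cc_\<phi>] grad_dot_def
      by (simp only: partial_deriv_conv[OF \<eta>1 supp Cc_\<phi>] conv_partial_deriv[OF \<eta>1 supp \<phi>] cong: sum.cong)
    also have "\<dots> = (\<Sum>b\<in>Basis. ip (?P (partial_deriv b \<phi>)) (?P (partial_deriv b \<phi>)))"
      unfolding ip_def by (intro Bochner_Integration.integral_sum Cc_integrable Cc_mult ccP p\<phi>)
    also have "\<dots> \<le> (\<Sum>b\<in>Basis. ip (partial_deriv b \<phi>) (partial_deriv b \<phi>))"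
      by (intro sum_mono L2P p\<phi>)
    also have "\<dots> = (LBINT x. grad_dot \<phi> \<phi> x)"
      unfolding ip_def grad_dot_def
      by (rule Bochner_Integration.integral_sum[symmetric]) (intro Cc_integrable Cc_mult p\<phi>)
    finally show ?thesis .
  qed
  ultimately show ?thesis by simp
qed

text \<open>The value \<open>c\<close> and the error \<open>e\<close> are left free because three
  instances are needed: \<open>c\<close> a value of the function for convergence,
  \<open>c = 0\<close> for a uniform bound, and \<open>c = e = 0\<close> for the support.\<close>

lemma conv_near:
  assumes \<eta>: "Cc \<eta>" "\<And>x. 0 \<le> \<eta> x" "(LBINT y. \<eta> (x - y)) = 1" "\<And>x. \<eta> x \<noteq> 0 \<Longrightarrow> norm x \<le> r"
    and f: "Cc f" and near: "\<And>y. norm (x - y) \<le> r \<Longrightarrow> \<bar>f y - c\<bar> \<le> e"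
  shows "\<bar>conv \<eta> f x - c\<bar> \<le> e"
proof -
  have refl: "Cc (\<lambda>y. \<eta> (x - y))"
    using Cc_affine[OF \<eta>(1), of "-1" x] by simp
  note int = Cc_integrable[OF Cc_conv_integrand[OF \<eta>(1) f]] Cc_integrable[OF refl]
  have bounds: "\<eta> (x - y) * (c - e) \<le> \<eta> (x - y) * f y \<and> \<eta> (x - y) * f y \<le> \<eta> (x - y) * (c + e)" for y
  proof (cases "\<eta> (x - y) = 0")
    case False
    then have "\<bar>f y - c\<bar> \<le> e"
      by (intro near \<eta>(4))
    then have "c - e \<le> f y" "f y \<le> c + e"
      by linarith+
    then show ?thesis
      using \<eta>(2) by (simp add: mult_left_mono)
  qed simp
  have "(LBINT y. \<eta> (x - y) * (c - e)) \<le> conv \<eta> f x" "conv \<eta> f x \<le> (LBINT y. \<eta> (x - y) * (c + e))"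
    unfolding conv_def
    by (rule integral_mono[OF integrable_mult_left[OF int(2)] int(1) conjunct1[OF bounds]],
      rule integral_mono[OF int(1) integrable_mult_left[OF int(2)] conjunct2[OF bounds]])
  then show ?thesis
    using \<eta>(3) by (simp add: abs_le_iff)
qed

lemma mollifier_exists:
  assumes "0 < r"
  obtains \<eta> :: "'a::euclidean_space \<Rightarrow> real"
  where "C_class 2 \<eta>" "Cc \<eta>" "\<And>x. 0 \<le> \<eta> x" "\<And>x. \<eta> (- x) = \<eta> x" "\<And>x. (LBINT y. \<eta> (x - y)) = 1"
    "\<And>x. \<eta> x \<noteq> 0 \<Longrightarrow> norm x \<le> r"
proof -
  \<comment> \<open>The cube is the lowest power of \<open>bump\<close> of class 2.\<close>
  let ?\<beta> = "\<lambda>x::'a. bump (0 + inverse r *\<^sub>R x) ^ 3"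
  have \<beta>: "Cc ?\<beta>"
    by (rule Cc_affine[OF Cc_bump_power]) (use assms in auto)
  define I where "I = (LBINT x. ?\<beta> x)"
  have I: "0 < I"
    unfolding I_def by (rule Cc_integral_pos[OF \<beta>, of 0]) auto
  define \<eta> where "\<eta> = (\<lambda>x. inverse I * ?\<beta> x)"
  have cc: "Cc \<eta>" unfolding \<eta>_def by (rule Cc_cmult[OF \<beta>])
  have even: "\<eta> (- x) = \<eta> x" for x
    using bump_minus[of "inverse r *\<^sub>R x"] by (simp add: \<eta>_def)
  show thesis
  proof (rule that[of \<eta>])
    show "C_class 2 \<eta>"
      unfolding \<eta>_def by (intro C_class_cmult C_class_affine[of 2 "\<lambda>x. bump x ^ 3"] C_class_bump_power) simp
    show "(LBINT y. \<eta> (x - y)) = 1" for x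
    proof -
      have "(LBINT y. \<eta> (x - y)) = (LBINT y. \<eta> (y + (- x)))"
        by (intro Bochner_Integration.integral_cong refl) (metis even minus_diff_eq diff_conv_add_uminus)
      also have "\<dots> = (LBINT y. \<eta> y)"
        by (rule integral_lborel_shift) (use Cc_continuous[OF cc] in \<open>simp add: borel_measurable_continuous_onI\<close>)
      also have "\<dots> = inverse I * I"
        unfolding \<eta>_def I_def by simp
      finally show ?thesis using I by simp
    qed
    show "norm x \<le> r" if "\<eta> x \<noteq> 0" for x
    proof -
      have "bump (inverse r *\<^sub>R x) \<noteq> 0" using that by (auto simp: \<eta>_def)
      then have "norm (inverse r *\<^sub>R x) \<le> 1" by (rule norm_le_1_if_bump)
      then show ?thesis using assms by (simp add: field_simps)
    qed
    show "0 \<le> \<eta> x" for x using I by (simp add: \<eta>_def)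
  qed (rule cc, rule even)
qed

text \<open>The mollification radius tends to 0. Only the left side needs a limit, because the
  gradient form of \<open>\<phi>\<close> itself bounds every approximation.\<close>

lemma second_order_imp_first_order:
  fixes V :: "'a::euclidean_space \<Rightarrow> real"
  assumes V: "continuous_on UNIV V" "\<And>x. 0 \<le> V x"
    and second: "\<And>\<phi>. C_class 2 \<phi> \<Longrightarrow> bounded {x. \<phi> x \<noteq> 0} \<Longrightarrow>
      (LBINT x. (V x * \<phi> x)\<^sup>2) \<le> (LBINT x. (laplacian \<phi> x)\<^sup>2)"
    and \<phi>: "C_class (Suc 0) \<phi>" "bounded {x. \<phi> x \<noteq> 0}"
  shows "(LBINT x. V x * (\<phi> x)\<^sup>2) \<le> (LBINT x. grad_dot \<phi> \<phi> x)"
proof -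
  have Cc_\<phi>: "Cc \<phi>" by (rule C_class_Cc[OF \<phi>])
  obtain r where r: "0 < r" "\<And>x. r \<le> norm x \<Longrightarrow> \<phi> x = 0"
    using Cc_zero_outside[OF Cc_\<phi>] by blast
  obtain B where B: "0 < B" "\<And>x. \<bar>\<phi> x\<bar> \<le> B"
    using Cc_bounded[OF Cc_\<phi>] by blast
  have "bounded (V ` cball 0 r)"
    by (intro compact_imp_bounded compact_continuous_image continuous_on_subset[OF V(1)]) auto
  then obtain M where M: "0 < M" "\<And>x. norm x \<le> r \<Longrightarrow> V x \<le> M"
    unfolding bounded_pos by force
  define U where "U x = min (V x) M" for x
  have U: "continuous_on UNIV U" "\<And>x. 0 \<le> U x" "\<And>x. U x \<le> M"
    using V M by (auto simp: U_def intro: continuous_on_min)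
  have second_U: "(LBINT x. (U x * \<psi> x)\<^sup>2) \<le> (LBINT x. (laplacian \<psi> x)\<^sup>2)"
    if \<psi>: "C_class 2 \<psi>" "bounded {x. \<psi> x \<noteq> 0}" for \<psi>
  proof -
    have cc: "Cc \<psi>"
    using C_class_Cc \<psi> by blast
    have "(LBINT x. (U x * \<psi> x)\<^sup>2) \<le> (LBINT x. (V x * \<psi> x)\<^sup>2)"
    proof (intro integral_mono Cc_integrable Cc_power2 Cc_mult_left U V cc)
      show "(U x * \<psi> x)\<^sup>2 \<le> (V x * \<psi> x)\<^sup>2" for x
        unfolding power_mult_distrib using U(2)[of x] by (intro mult_right_mono power_mono) (auto simp: U_def)
    qed
    then show ?thesis using second[OF \<psi>] by linarith
  qed
  \<comment> \<open>Two convolutions with radius \<open>1 / Suc n\<close> see \<open>\<phi>\<close>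
    only up to distance \<open>2 / Suc n\<close>.\<close>
  have "\<exists>\<psi>. Cc \<psi> \<and> (\<forall>x c e. (\<forall>y. norm (x - y) \<le> 2 / real (Suc n) \<longrightarrow> \<bar>\<phi> y - c\<bar> \<le> e) \<longrightarrow> \<bar>\<psi> x - c\<bar> \<le> e) \<and>
      (LBINT x. U x * (\<psi> x)\<^sup>2) \<le> (LBINT x. grad_dot \<phi> \<phi> x)" for n
  proof -
    obtain \<eta> :: "'a \<Rightarrow> real" where \<eta>: "C_class 2 \<eta>" "Cc \<eta>" "\<And>x. 0 \<le> \<eta> x" "\<And>x. \<eta> (- x) = \<eta> x"
      "\<And>x. (LBINT y. \<eta> (x - y)) = 1" "\<And>x. \<eta> x \<noteq> 0 \<Longrightarrow> norm x \<le> 1 / real (Suc n)"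
      using mollifier_exists[of "1 / real (Suc n)"] by auto
    have int: "(LBINT x. \<eta> x) = 1"
      using \<eta>(5)[of 0] \<eta>(4) by simp
    have "\<bar>conv \<eta> (conv \<eta> \<phi>) x - c\<bar> \<le> e" if near: "\<And>y. norm (x - y) \<le> 2 / real (Suc n) \<Longrightarrow> \<bar>\<phi> y - c\<bar> \<le> e" for x c e
    proof (rule conv_near[OF \<eta>(2,3,5,6) Cc_conv[OF \<eta>(2) Cc_\<phi>]])
      fix y assume y: "norm (x - y) \<le> 1 / real (Suc n)"
      show "\<bar>conv \<eta> \<phi> y - c\<bar> \<le> e"
      proof (rule conv_near[OF \<eta>(2,3,5,6) Cc_\<phi>])
        fix z assume z: "norm (y - z) \<le> 1 / real (Suc n)"
        have "norm (x - z) \<le> 1 / real (Suc n) + 1 / real (Suc n)"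
          using norm_triangle_ineq[of "x - y" "y - z"] y z by simp
        then show "\<bar>\<phi> z - c\<bar> \<le> e" by (intro near) (simp add: field_simps)
      qed
    qed
    moreover have "(LBINT x. U x * (conv \<eta> (conv \<eta> \<phi>) x)\<^sup>2) \<le> (LBINT x. grad_dot \<phi> \<phi> x)"
      by (rule second_order_imp_first_order_bounded[OF U second_U \<eta>(1-4) int \<phi>])
    moreover have "Cc (conv \<eta> (conv \<eta> \<phi>))"
      by (intro Cc_conv \<eta> Cc_\<phi>)
    ultimately show ?thesis by (intro exI[of _ "conv \<eta> (conv \<eta> \<phi>)"]) blast
  qed
  then obtain \<psi> where \<psi>: "\<And>n. Cc (\<psi> n)"
    "\<And>n x c e. (\<And>y. norm (x - y) \<le> 2 / real (Suc n) \<Longrightarrow> \<bar>\<phi> y - c\<bar> \<le> e) \<Longrightarrow> \<bar>\<psi> n x - c\<bar> \<le> e"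
    "\<And>n. (LBINT x. U x * (\<psi> n x)\<^sup>2) \<le> (LBINT x. grad_dot \<phi> \<phi> x)"
    by metis
  have "(\<lambda>n. LBINT x. U x * (\<psi> n x)\<^sup>2) \<longlonglongrightarrow> (LBINT x. U x * (\<phi> x)\<^sup>2)"
  proof (rule integral_dominated_convergence[where w="\<lambda>x. (M * B\<^sup>2) * indicator (cball 0 (r + 2)) x"])
    show "(\<lambda>x. U x * (\<phi> x)\<^sup>2) \<in> borel_measurable lborel" "(\<lambda>x. U x * (\<psi> n x)\<^sup>2) \<in> borel_measurable lborel" for n
      using Cc_integrable[OF Cc_mult_left[OF U(1) Cc_power2[OF Cc_\<phi>]]]
        Cc_integrable[OF Cc_mult_left[OF U(1) Cc_power2[OF \<psi>(1)]]] by blast+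
    show "integrable lborel (\<lambda>x::'a. (M * B\<^sup>2) * indicator (cball 0 (r + 2)) x)"
      by (rule integrable_indicator_cball)
    show "AE x in lborel. (\<lambda>n. U x * (\<psi> n x)\<^sup>2) \<longlonglongrightarrow> U x * (\<phi> x)\<^sup>2"
    proof (intro AE_I2 tendsto_mult tendsto_const tendsto_power)
      fix x
      show "(\<lambda>n. \<psi> n x) \<longlonglongrightarrow> \<phi> x"
      proof (rule LIMSEQ_I)
        fix e :: real assume e: "0 < e"
        have "isCont \<phi> x" using Cc_continuous[OF Cc_\<phi>] by (simp add: continuous_on_eq_continuous_at)
        then obtain d where d: "0 < d" "\<And>y. dist y x < d \<Longrightarrow> dist (\<phi> y) (\<phi> x) < e / 2"
          using e unfolding continuous_at_eps_delta by (meson half_gt_zero)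
        obtain N where N: "inverse (real (Suc N)) < d / 2"
          using reals_Archimedean[of "d / 2"] d(1) by auto
        have "norm (\<psi> n x - \<phi> x) < e" if n: "N \<le> n" for n
        proof -
          have "2 / real (Suc n) \<le> 2 / real (Suc N)"
            using n by (intro divide_left_mono) auto
          moreover have "2 / real (Suc N) = 2 * inverse (real (Suc N))"
            by (simp only: divide_inverse)
          ultimately have small: "2 / real (Suc n) < d"
            using N by linarith
          have "\<bar>\<psi> n x - \<phi> x\<bar> \<le> e / 2"
          proof (rule \<psi>(2))
            fix y assume "norm (x - y) \<le> 2 / real (Suc n)"
            then have "dist y x < d" using small by (simp add: dist_norm norm_minus_commute)
            then show "\<bar>\<phi> y - \<phi> x\<bar> \<le> e / 2" using d(2)[of y] by (simp add: dist_real_def)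
          qed
          then show ?thesis using e by simp
        qed
        then show "\<exists>N. \<forall>n\<ge>N. norm (\<psi> n x - \<phi> x) < e" by blast
      qed
    qed
    show "AE x in lborel. norm (U x * (\<psi> n x)\<^sup>2) \<le> M * B\<^sup>2 * indicator (cball 0 (r + 2)) x" for n
    proof (intro AE_I2)
      fix x :: 'a
      have two: "2 / real (Suc n) \<le> 2" by (simp add: field_simps)
      show "norm (U x * (\<psi> n x)\<^sup>2) \<le> M * B\<^sup>2 * indicator (cball 0 (r + 2)) x"
      proof (cases "norm x \<le> r + 2")
        case True
        have "\<bar>\<psi> n x - 0\<bar> \<le> B" by (rule \<psi>(2)) (use B in simp)
        then have "(\<psi> n x)\<^sup>2 \<le> B\<^sup>2" using power_mono[of "\<bar>\<psi> n x\<bar>" B 2] by simp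
        then have "U x * (\<psi> n x)\<^sup>2 \<le> M * B\<^sup>2" using U[of ] M by (intro mult_mono) auto
        then show ?thesis using True U(2)[of x] by (simp add: abs_mult)
      next
        case False
        have "\<bar>\<psi> n x - 0\<bar> \<le> 0"
        proof (rule \<psi>(2))
          fix y assume "norm (x - y) \<le> 2 / real (Suc n)"
          then have "norm (x - y) \<le> 2" using two by linarith
          then have "r \<le> norm y" using False norm_triangle_ineq[of "x - y" y] by simp
          then show "\<bar>\<phi> y - 0\<bar> \<le> 0" using r by simp
        qed
        then show ?thesis using False by simp
      qed
    qed
  qed
  then have "(LBINT x. U x * (\<phi> x)\<^sup>2) \<le> (LBINT x. grad_dot \<phi> \<phi> x)"
    by (rule LIMSEQ_le_const2) (use \<psi>(3) in blast)
  moreover have "U x * (\<phi> x)\<^sup>2 = V x * (\<phi> x)\<^sup>2" for x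
    using r(2)[of x] M(2)[of x] by (cases "norm x \<le> r") (auto simp: U_def)
  ultimately show ?thesis by simp
qed

lemma stability_first_order:
  fixes u :: "'a::euclidean_space \<Rightarrow> real"
  assumes stable: "stable_solution p u" and p: "1 < p" and \<phi>: "C_class (Suc 0) \<phi>" "bounded {x. \<phi> x \<noteq> 0}"
  shows "(LBINT x. sqrt p * u x powr ((p - 1) / 2) * (\<phi> x)\<^sup>2) \<le> (LBINT x. grad_dot \<phi> \<phi> x)"
proof -
  interpret lane_emden4 p u
    using stable p by unfold_locales (simp_all add: stable_solution_def)
  show ?thesis
  proof (rule second_order_imp_first_order[OF _ _ _ \<phi>])
    show "continuous_on UNIV (\<lambda>x. sqrt p * u x powr ((p - 1) / 2))"
      by (intro continuous_on_mult continuous_on_const continuous_u_powr)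
    show "0 \<le> sqrt p * u x powr ((p - 1) / 2)" for x
      using p by simp
    fix \<psi> :: "'a \<Rightarrow> real" assume \<psi>: "C_class 2 \<psi>" "bounded {x. \<psi> x \<noteq> 0}"
    have "(sqrt p * u x powr ((p - 1) / 2) * \<psi> x)\<^sup>2 = p * (u x powr (p - 1) * (\<psi> x)\<^sup>2)" for x
    proof -
      have "(u x powr ((p - 1) / 2))\<^sup>2 = u x powr (p - 1)"
        using powr_add[of "u x" "(p - 1) / 2" "(p - 1) / 2"] by (simp add: power2_eq_square)
      then show ?thesis
        using p by (simp add: power_mult_distrib)
    qed
    then show "(LBINT x. (sqrt p * u x powr ((p - 1) / 2) * \<psi> x)\<^sup>2) \<le> (LBINT x. (laplacian \<psi> x)\<^sup>2)"
      using stability_classical[OF stable p \<psi>] by simp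
  qed
qed

subsection \<open>The integral estimate\<close>

text \<open>The remaining estimates use stability only through this inequality, and its invariance
  under dilations can be checked on test functions of class 1, without dilating weak
  derivatives.\<close>

locale stable_lane_emden4 = lane_emden4 +
  assumes first_order: "\<And>\<phi>. C_class (Suc 0) \<phi> \<Longrightarrow> bounded {x. \<phi> x \<noteq> 0} \<Longrightarrow>
    (LBINT x. sqrt p * u x powr ((p - 1) / 2) * (\<phi> x)\<^sup>2) \<le> (LBINT x. grad_dot \<phi> \<phi> x)"

lemma stable_solution_imp_locale:
  assumes "1 < p" "stable_solution p u"
  shows "stable_lane_emden4 p u"
  using assms stability_first_order[OF assms(2,1)]
  by unfold_locales (auto simp: stable_solution_def)

text \<open>The first summand bounds the squared gradient of \<open>bump ^ Suc m\<close>. The second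
  is \<open>k + 1\<close> times the bound for the Laplacian of \<open>bump ^ (2 * m + 2)\<close>,
  where \<open>k = e / (4 * (e - 1))\<close>. The type argument carries the dimension.\<close>

definition caccioppoli_const :: "real \<Rightarrow> nat \<Rightarrow> 'a::euclidean_space itself \<Rightarrow> real" where
  "caccioppoli_const e m T = 4 * (real (Suc m))\<^sup>2
     + (e / (4 * (e - 1)) + 1) * (4 * real (2 * m + 2) * real (2 * m + 1) + 2 * real DIM('a) * real (2 * m + 2))"

lemma caccioppoli_const_nonneg: "1 < e \<Longrightarrow> 0 \<le> caccioppoli_const e m T"
  unfolding caccioppoli_const_def by (intro add_nonneg_nonneg mult_nonneg_nonneg) auto

text \<open>The test function is \<open>w powr (e / 2) * bump ^ Suc m\<close>. The squared gradient
  of \<open>w powr (e / 2)\<close> is a combination of \<open>laplacian (w powr e)\<close> and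
  \<open>w powr (e - 1) * laplacian w\<close>; moving the first Laplacian to the cutoff leaves no
  gradient of \<open>w\<close>.\<close>

lemma weighted_energy_estimate:
  fixes w V :: "'a::euclidean_space \<Rightarrow> real"
  assumes w: "C_class 2 w" "\<And>x. 0 < w x" and e: "1 < e" and m: "0 < m"
    and first_order: "\<And>\<phi>. C_class (Suc 0) \<phi> \<Longrightarrow> bounded {x. \<phi> x \<noteq> 0} \<Longrightarrow>
      (LBINT x. V x * (\<phi> x)\<^sup>2) \<le> (LBINT x. grad_dot \<phi> \<phi> x)"
  shows "(LBINT x. V x * w x powr e * bump x ^ (2 * m + 2))
    \<le> e\<^sup>2 / (4 * (e - 1)) * (LBINT x. w x powr (e - 1) * - laplacian w x * bump x ^ (2 * m + 2))
      + caccioppoli_const e m TYPE('a) * (LBINT x. w x powr e * bump x ^ (2 * m))"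
proof -
  define \<zeta> g G \<psi> \<phi> where defs: "\<zeta> = (\<lambda>x::'a. bump x ^ Suc m)" "g = (\<lambda>x. w x powr (e / 2))"
    "G = (\<lambda>x. w x powr e)" "\<psi> = (\<lambda>x::'a. bump x ^ (2 * m + 2))" "\<phi> = (\<lambda>x. g x * \<zeta> x)"
  note w2 = C_class_2D[OF w(1)]
  note w1 = C_class_Suc_imp[OF w2]
  have \<psi>\<zeta>: "\<psi> = (\<lambda>x. \<zeta> x * \<zeta> x)"
    by (simp add: defs fun_eq_iff power_add[symmetric] mult_2)
  have \<zeta>: "C_class (Suc 0) \<zeta>" unfolding defs by (rule C_class_bump_power) (use m in simp)
  have \<psi>: "C_class 2 \<psi>" "bounded {x. \<psi> x \<noteq> 0}" unfolding defs
    by (rule C_class_bump_power, use m in simp) (rule bounded_support_bump_power, simp)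
  have \<psi>1: "C_class (Suc 0) \<psi>" using \<psi>(1) by (rule C_class_mono) simp
  have Cc_\<psi>: "Cc \<psi>" by (rule C_class_Cc[OF \<psi>])
  have g: "C_class (Suc 0) g" unfolding defs by (rule C_class_powr[OF w1 w(2)])
  have G: "C_class 2 G" unfolding defs by (rule C_class_powr[OF w])
  have cont: "continuous_on UNIV (\<lambda>x. w x powr a)" for a
    by (rule C_class_continuous[OF C_class_powr[OF w]])
  have \<phi>: "C_class (Suc 0) \<phi>" "bounded {x. \<phi> x \<noteq> 0}"
    unfolding defs(5) by (rule C_class_mult[OF g \<zeta>])
      (rule bounded_subset[OF bounded_support_bump_power[of "Suc m"]], auto simp: defs)
  \<comment> \<open>The quotient of \<open>(e / 2)\<^sup>2\<close>, from the gradient of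
    \<open>w powr (e / 2)\<close>, by \<open>e * (e - 1)\<close>, from the gradient term in
    \<open>laplacian (w powr e)\<close>.\<close>
  define k where "k = e / (4 * (e - 1))"
  have k: "0 < k" using e by (simp add: k_def)
  have grad: "grad_dot \<phi> \<phi> x = G x * grad_dot \<zeta> \<zeta> x + (1/2) * grad_dot \<psi> G x + k * (\<psi> x * laplacian G x)
      + k * e * (w x powr (e - 1) * - laplacian w x * \<psi> x)" for x
  proof -
    have sq: "w x powr (e / 2) * w x powr (e / 2) = w x powr e"
      "w x powr (e / 2) * w x powr (e / 2 - 1) = w x powr (e - 1)"
      "w x powr (e / 2 - 1) * w x powr (e / 2 - 1) = w x powr (e - 2)"
      unfolding powr_add[symmetric] by (rule arg_cong[of _ _ "\<lambda>a. w x powr a"], simp)+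
    have "grad_dot \<phi> \<phi> x = g x * (g x * grad_dot \<zeta> \<zeta> x + \<zeta> x * grad_dot g \<zeta> x) + \<zeta> x * (g x * grad_dot g \<zeta> x + \<zeta> x * grad_dot g g x)"
      unfolding defs(5)
      by (simp only: grad_dot_mult_left[OF g \<zeta>] grad_dot_commute[of \<zeta> "\<lambda>x. g x * \<zeta> x"] grad_dot_commute[of g "\<lambda>x. g x * \<zeta> x"]
          grad_dot_commute[of \<zeta> g])
    also have "\<dots> = g x * g x * grad_dot \<zeta> \<zeta> x + 2 * (g x * \<zeta> x * grad_dot g \<zeta> x) + \<psi> x * grad_dot g g x"
      by (simp add: \<psi>\<zeta> algebra_simps)
    also have "g x * g x = G x"
      by (simp add: defs sq)
    also have "2 * (g x * \<zeta> x * grad_dot g \<zeta> x) = (1/2) * grad_dot \<psi> G x"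
    proof -
      have "grad_dot g \<zeta> x = e / 2 * w x powr (e / 2 - 1) * grad_dot w \<zeta> x"
        unfolding defs(2) by (simp only: grad_dot_powr_left[OF w1 w(2)])
      moreover have "grad_dot \<psi> G x = 2 * \<zeta> x * (e * w x powr (e - 1) * grad_dot w \<zeta> x)"
        unfolding \<psi>\<zeta> grad_dot_mult_left[OF \<zeta> \<zeta>] grad_dot_commute[of \<zeta> G]
        by (simp add: defs(3) grad_dot_powr_left[OF w1 w(2)])
      moreover have "g x * w x powr (e / 2 - 1) = w x powr (e - 1)"
        by (simp add: defs(2) sq)
      ultimately show ?thesis
        by (simp add: algebra_simps)
    qed
    also have "\<psi> x * grad_dot g g x = k * (\<psi> x * laplacian G x) + k * e * (w x powr (e - 1) * - laplacian w x * \<psi> x)"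
    proof -
      have "grad_dot g g x = (e / 2) * (e / 2) * (w x powr (e / 2 - 1) * w x powr (e / 2 - 1)) * grad_dot w w x"
        unfolding defs(2) by (simp only: grad_dot_powr_left[OF w1 w(2)] grad_dot_commute[of w "\<lambda>x. w x powr _"] mult_ac)
      then have 1: "grad_dot g g x = (e / 2) * (e / 2) * w x powr (e - 2) * grad_dot w w x"
        by (simp only: sq)
      have "laplacian G x + e * (w x powr (e - 1) * - laplacian w x) = e * (e - 1) * w x powr (e - 2) * grad_dot w w x"
        unfolding defs(3) by (simp add: laplacian_powr[OF w])
      then have "k * (laplacian G x + e * (w x powr (e - 1) * - laplacian w x)) = grad_dot g g x"
        using e by (simp only: 1) (simp add: k_def field_simps)
      then have "\<psi> x * grad_dot g g x = \<psi> x * (k * (laplacian G x + e * (w x powr (e - 1) * - laplacian w x)))"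
        by (simp only:)
      then show ?thesis by (simp only: distrib_left mult_ac)
    qed
    finally show ?thesis by simp
  qed
  note cG = C_class_continuous[OF G]
  have cc: "Cc (\<lambda>x. G x * grad_dot \<zeta> \<zeta> x)" "Cc (grad_dot \<psi> G)" "Cc (\<lambda>x. \<psi> x * laplacian G x)"
    "Cc (\<lambda>x. w x powr (e - 1) * - laplacian w x * \<psi> x)" "Cc (\<lambda>x. G x * laplacian \<psi> x)" "Cc (\<lambda>x. G x * bump x ^ (2 * m))"
  proof -
    show "Cc (\<lambda>x. G x * grad_dot \<zeta> \<zeta> x)"
      by (intro Cc_mult_left cG Cc_grad_dot[OF \<zeta> \<zeta>]) (simp only: defs bounded_support_bump_power zero_less_Suc)
    show "Cc (grad_dot \<psi> G)"
      by (rule Cc_grad_dot[OF \<psi>1 C_class_mono[OF G] \<psi>(2), of "Suc 0"]) simp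
    show "Cc (\<lambda>x. \<psi> x * laplacian G x)"
      by (intro Cc_mult_right Cc_\<psi> continuous_laplacian G)
    show "Cc (\<lambda>x. w x powr (e - 1) * - laplacian w x * \<psi> x)"
      by (intro Cc_mult_left Cc_\<psi> continuous_on_mult cont continuous_on_minus continuous_laplacian w)
    show "Cc (\<lambda>x. G x * laplacian \<psi> x)"
      by (intro Cc_mult_left cG Cc_laplacian \<psi>)
    show "Cc (\<lambda>x. G x * bump x ^ (2 * m))"
      by (intro Cc_mult_left cG Cc_bump_power) (use m in simp)
  qed
  define c where "c = 4 * real (2 * m + 2) * real (2 * m + 1) + 2 * real DIM('a) * real (2 * m + 2)"
  have c: "0 \<le> c" by (simp add: c_def)
  let ?J = "LBINT x. G x * bump x ^ (2 * m)"
  have "(LBINT x. V x * w x powr e * bump x ^ (2 * m + 2)) = (LBINT x. V x * (\<phi> x)\<^sup>2)"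
  proof (intro Bochner_Integration.integral_cong refl)
    fix x
    have "w x powr (e / 2) * w x powr (e / 2) = w x powr e"
      unfolding powr_add[symmetric] by simp
    then have "(\<phi> x)\<^sup>2 = w x powr e * \<psi> x"
      by (simp add: defs(2,5) \<psi>\<zeta> power2_eq_square mult_ac)
    then show "V x * w x powr e * bump x ^ (2 * m + 2) = V x * (\<phi> x)\<^sup>2"
      by (simp add: defs(4))
  qed
  also have "\<dots> \<le> (LBINT x. grad_dot \<phi> \<phi> x)"
    by (rule first_order[OF \<phi>])
  also have "\<dots> = (LBINT x. G x * grad_dot \<zeta> \<zeta> x) + (1/2) * (LBINT x. grad_dot \<psi> G x)
      + k * (LBINT x. \<psi> x * laplacian G x) + k * e * (LBINT x. w x powr (e - 1) * - laplacian w x * \<psi> x)"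
    unfolding grad using cc[THEN Cc_integrable]
    by (simp only: Bochner_Integration.integral_add integrable_mult_right Bochner_Integration.integrable_add
        Bochner_Integration.integral_mult_right_zero)
  \<comment> \<open>The cross term is a divergence up to a multiple of the Laplacian term, so both
    combine into the single factor \<open>k - 1/2\<close> in front of an integral of
    \<open>G\<close> against \<open>laplacian \<psi>\<close>.\<close>
  also have "(LBINT x. grad_dot \<psi> G x) = - (LBINT x. \<psi> x * laplacian G x)"
    using green_first[OF \<psi>1 \<psi>(2) G] by simp
  also have "(LBINT x. \<psi> x * laplacian G x) = (LBINT x. G x * laplacian \<psi> x)"
    using green_second[OF \<psi> G] by (simp add: mult.commute)
  finally have *: "(LBINT x. V x * w x powr e * bump x ^ (2 * m + 2))
      \<le> (LBINT x. G x * grad_dot \<zeta> \<zeta> x) + (k - 1/2) * (LBINT x. G x * laplacian \<psi> x)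
        + k * e * (LBINT x. w x powr (e - 1) * - laplacian w x * \<psi> x)"
    by (simp add: algebra_simps)
  have "(LBINT x. G x * grad_dot \<zeta> \<zeta> x) \<le> (LBINT x. 4 * (real (Suc m))\<^sup>2 * (G x * bump x ^ (2 * m)))"
  proof (intro integral_mono integrable_mult_right Cc_integrable cc)
    show "G x * grad_dot \<zeta> \<zeta> x \<le> 4 * (real (Suc m))\<^sup>2 * (G x * bump x ^ (2 * m))" for x
      using mult_left_mono[OF grad_dot_bump_power_le[OF m, of x], of "G x"] by (simp add: defs mult_ac)
  qed
  then have 1: "(LBINT x. G x * grad_dot \<zeta> \<zeta> x) \<le> 4 * (real (Suc m))\<^sup>2 * ?J"
    by simp
  have "\<bar>LBINT x. G x * laplacian \<psi> x\<bar> \<le> (LBINT x. c * (G x * bump x ^ (2 * m)))"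
  proof (rule order_trans[OF integral_abs_bound], intro integral_mono integrable_mult_right Cc_integrable Cc_abs cc)
    show "\<bar>G x * laplacian \<psi> x\<bar> \<le> c * (G x * bump x ^ (2 * m))" for x
      using mult_left_mono[OF abs_laplacian_bump_power[of "2 * m" x], of "G x"] m by (simp add: defs c_def abs_mult mult_ac)
  qed
  then have lap: "\<bar>LBINT x. G x * laplacian \<psi> x\<bar> \<le> c * ?J"
    by simp
  have 2: "(k - 1/2) * (LBINT x. G x * laplacian \<psi> x) \<le> (k + 1) * (c * ?J)"
  proof -
    have "(k - 1/2) * (LBINT x. G x * laplacian \<psi> x) \<le> \<bar>k - 1/2\<bar> * \<bar>LBINT x. G x * laplacian \<psi> x\<bar>"
      by (simp add: abs_mult[symmetric])
    also have "\<dots> \<le> (k + 1) * (c * ?J)"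
      using lap k by (intro mult_mono) auto
    finally show ?thesis .
  qed
  have "k * e = e\<^sup>2 / (4 * (e - 1))"
    by (simp add: k_def power2_eq_square)
  moreover have "caccioppoli_const e m TYPE('a) * ?J = 4 * (real (Suc m))\<^sup>2 * ?J + (k + 1) * (c * ?J)"
    by (simp add: caccioppoli_const_def k_def c_def algebra_simps)
  ultimately show ?thesis
    using * 1 2 by (simp add: defs)
qed

section \<open>Inequalities of Young type for real powers\<close>

lemma young_powr:
  fixes x y s :: real
  assumes "0 \<le> x" "0 \<le> y" "1 < s"
  shows "x powr (s - 1) * y \<le> (1 - 1 / s) * x powr s + 1 / s * y powr s"
proof -
  have "x powr (s - 1) * y \<le> (x powr (s - 1)) powr (s / (s - 1)) / (s / (s - 1)) + y powr s / s"
    by (rule Youngs_inequality) (use assms in \<open>auto simp: field_simps\<close>)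
  also have "(x powr (s - 1)) powr (s / (s - 1)) = x powr s"
    using assms by (simp add: powr_powr)
  finally show ?thesis
    using assms by (simp add: field_simps)
qed

text \<open>If \<open>A * x powr a \<le> \<theta> * y powr a\<close>, the first term on the right
  dominates; otherwise \<open>y\<close> is at most a multiple of \<open>x\<close>, and by
  homogeneity of degree \<open>s\<close> the second does.\<close>

lemma powr_absorb:
  fixes x y a s A \<theta> :: real
  assumes "0 < x" "0 < y" "0 < a" "a \<le> s" "0 < A" "0 < \<theta>"
  shows "A * x powr a * y powr (s - a) \<le> \<theta> * y powr s + A * (A / \<theta>) powr ((s - a) / a) * x powr s"
proof (cases "A * x powr a \<le> \<theta> * y powr a")
  case True
  then have "A * x powr a * y powr (s - a) \<le> \<theta> * y powr a * y powr (s - a)"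
    by (intro mult_right_mono) auto
  also have "\<dots> = \<theta> * y powr s"
    by (simp add: mult.assoc powr_add[symmetric])
  also have "\<dots> \<le> \<theta> * y powr s + A * (A / \<theta>) powr ((s - a) / a) * x powr s"
    using assms by simp
  finally show ?thesis .
next
  case False
  then have "y powr a \<le> A / \<theta> * x powr a"
    using assms by (simp add: field_simps)
  then have "(y powr a) powr ((s - a) / a) \<le> (A / \<theta> * x powr a) powr ((s - a) / a)"
    using assms by (intro powr_mono2) auto
  moreover have "(A / \<theta> * x powr a) powr ((s - a) / a) = (A / \<theta>) powr ((s - a) / a) * x powr (s - a)"
    using assms powr_mult[of "A / \<theta>" "x powr a"] by (simp add: powr_powr)
  moreover have "(y powr a) powr ((s - a) / a) = y powr (s - a)"
    using assms by (simp add: powr_powr)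
  ultimately have "A * x powr a * y powr (s - a) \<le> A * x powr a * ((A / \<theta>) powr ((s - a) / a) * x powr (s - a))"
    using assms by (intro mult_left_mono) auto
  also have "\<dots> = A * (A / \<theta>) powr ((s - a) / a) * (x powr a * x powr (s - a))"
    by simp
  also have "x powr a * x powr (s - a) = x powr s"
    by (simp add: powr_add[symmetric])
  finally show ?thesis
    using assms by (smt (verit) mult_nonneg_nonneg powr_ge_zero)
qed

context stable_lane_emden4
begin

definition v :: "'a \<Rightarrow> real" where "v = (\<lambda>x. - laplacian u x)"

definition X :: "'a \<Rightarrow> real" where "X = (\<lambda>x. u x powr ((p + 1) / 2))"

lemma v_pos: "0 < v x"
  using laplacian_neg by (simp add: v_def)

lemma X_pos: "0 < X x"
  using u_pos[of x] by (simp add: X_def)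

lemma C2_v: "C_class 2 v"
  unfolding v_def by (rule C_class_uminus[OF C2_lap])

lemma laplacian_v: "laplacian v x = - (u x powr p)"
  using laplacian_cmult[OF C2_lap, of "-1"] by (simp add: v_def bilaplacian)

lemma X_le_v: "X x \<le> sqrt ((p + 1) / 2) * v x"
proof -
  have "sqrt ((p + 1) / 2) * (sqrt (2 / (p + 1)) * X x) \<le> sqrt ((p + 1) / 2) * v x"
    using comparison[of x] p by (intro mult_left_mono) (simp_all add: X_def v_def)
  moreover have "sqrt ((p + 1) / 2) * (sqrt (2 / (p + 1)) * X x) = X x"
    using p by (simp add: mult.assoc[symmetric] real_sqrt_mult[symmetric])
  ultimately show ?thesis by simp
qed

lemma continuous_v_powr: "continuous_on UNIV (\<lambda>x. v x powr q)"
  by (rule C_class_continuous[OF C_class_powr[OF C2_v v_pos]])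

lemma continuous_X_powr: "continuous_on UNIV (\<lambda>x. X x powr q)"
  unfolding X_def powr_powr by (rule continuous_u_powr)

lemma X_powr: "X x powr q = u x powr ((p + 1) / 2 * q)"
  by (simp add: X_def powr_powr)

lemma u_powr_p: "u x powr p = u x powr ((p - 1) / 2) * X x"
  unfolding X_def powr_add[symmetric] by (simp add: field_simps)

text \<open>The Young parameter \<open>t\<close> makes both diagonal coefficients dominate, which is possible exactly
  when the product of the two stability constants exceeds 1.\<close>

lemma coupled_estimate:
  assumes s: "1 < s" and e: "e = (p + 1) / 2 * s" "1 < e" and m: "0 < m"
    and t: "0 < t" "t < sqrt p * (4 * (e - 1) / e\<^sup>2)" "1 < t * (sqrt p * (4 * (s - 1) / s\<^sup>2))"
  shows "(sqrt p * (4 * (e - 1) / e\<^sup>2) / t - 1) * (LBINT x. u x powr ((p - 1) / 2) * X x powr s * bump x ^ (2 * m + 2))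
    \<le> (4 * (e - 1) / e\<^sup>2 * caccioppoli_const e m TYPE('a) * sqrt ((p + 1) / 2) powr s / t
        + 4 * (s - 1) / s\<^sup>2 * caccioppoli_const s m TYPE('a) * t powr (1 - s))
      * (LBINT x. v x powr s * bump x ^ (2 * m))"
proof -
  define a b where "a = 4 * (e - 1) / e\<^sup>2" and "b = 4 * (s - 1) / s\<^sup>2"
  have ab: "0 < a" "0 < b" using s e by (simp_all add: a_def b_def)
  define Ce Cs where "Ce = caccioppoli_const e m TYPE('a)" and "Cs = caccioppoli_const s m TYPE('a)"
  have C_nonneg: "0 \<le> Ce" "0 \<le> Cs"
    using s e by (simp_all add: Ce_def Cs_def caccioppoli_const_nonneg)
  \<comment> \<open>The common density for both energy estimates: the potential times the cutoff.
    The main terms become the \<open>s\<close>-th moments \<open>K1\<close> of \<open>X\<close> and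
    \<open>K2\<close> of \<open>v\<close> with respect to it.\<close>
  define \<mu> where "\<mu> = (\<lambda>x. u x powr ((p - 1) / 2) * bump x ^ (2 * m + 2))"
  have \<mu>: "Cc \<mu>" "\<And>x. 0 \<le> \<mu> x"
    unfolding \<mu>_def by (intro Cc_mult_left continuous_u_powr Cc_bump_power) auto
  define K1 K2 J where "K1 = (LBINT x. X x powr s * \<mu> x)" and "K2 = (LBINT x. v x powr s * \<mu> x)"
    and "J = (LBINT x. v x powr s * bump x ^ (2 * m))"
  have Cc_J: "Cc (\<lambda>x. v x powr s * bump x ^ (2 * m))" "Cc (\<lambda>x. X x powr s * bump x ^ (2 * m))"
    using m by (intro Cc_mult_left continuous_v_powr continuous_X_powr Cc_bump_power; simp)+
  note Cc_K = Cc_mult_left[OF continuous_X_powr \<mu>(1), of s] Cc_mult_left[OF continuous_v_powr \<mu>(1), of s]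
  have cont1: "continuous_on UNIV X" "continuous_on UNIV v"
    using continuous_X_powr[of 1] C_class_continuous[OF C2_v] X_pos by (simp_all add: less_imp_le)
  note Cc_M = Cc_mult_left[OF continuous_on_mult[OF continuous_X_powr cont1(2)] \<mu>(1), of "s - 1"]
    Cc_mult_left[OF continuous_on_mult[OF cont1(1) continuous_v_powr] \<mu>(1), of "s - 1"]
  have E1: "sqrt p * a * K1 \<le> (LBINT x. X x powr (s - 1) * v x * \<mu> x) + a * Ce * sqrt ((p + 1) / 2) powr s * J"
  proof -
    have main: "(LBINT x. sqrt p * u x powr ((p - 1) / 2) * u x powr e * bump x ^ (2 * m + 2))
      \<le> e\<^sup>2 / (4 * (e - 1)) * (LBINT x. u x powr (e - 1) * - laplacian u x * bump x ^ (2 * m + 2))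
        + Ce * (LBINT x. u x powr e * bump x ^ (2 * m))"
      unfolding Ce_def by (rule weighted_energy_estimate[OF C2_u u_pos e(2) m first_order])
    have h1: "(\<lambda>x. sqrt p * u x powr ((p - 1) / 2) * u x powr e * bump x ^ (2 * m + 2)) = (\<lambda>x. sqrt p * (X x powr s * \<mu> x))"
      by (simp add: \<mu>_def X_powr e(1) mult_ac)
    have h2: "(\<lambda>x. u x powr (e - 1) * - laplacian u x * bump x ^ (2 * m + 2)) = (\<lambda>x. X x powr (s - 1) * v x * \<mu> x)"
    proof
      fix x
      \<comment> \<open>The reason for the choice of \<open>e\<close>: the source term of the
        \<open>u\<close> estimate acquires the same density \<open>\<mu>\<close> as that of the
        \<open>v\<close> estimate.\<close>
      have "e - 1 = (p - 1) / 2 + (p + 1) / 2 * (s - 1)"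
        by (simp add: e(1) field_simps)
      then have "u x powr (e - 1) = u x powr ((p - 1) / 2) * X x powr (s - 1)"
        by (simp only: X_powr powr_add)
      then show "u x powr (e - 1) * - laplacian u x * bump x ^ (2 * m + 2) = X x powr (s - 1) * v x * \<mu> x"
        by (simp add: \<mu>_def v_def)
    qed
    \<comment> \<open>The pointwise comparison of \<open>X\<close> with \<open>v\<close> enters
      here: it leaves \<open>J\<close> as the only error integral for both estimates.\<close>
    have h3: "(LBINT x. u x powr e * bump x ^ (2 * m)) \<le> sqrt ((p + 1) / 2) powr s * J"
    proof -
      have "(LBINT x. u x powr e * bump x ^ (2 * m)) = (LBINT x. X x powr s * bump x ^ (2 * m))"
        by (simp add: X_powr e(1))
      also have "\<dots> \<le> (LBINT x. sqrt ((p + 1) / 2) powr s * (v x powr s * bump x ^ (2 * m)))"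
      proof (intro integral_mono Cc_integrable Cc_cmult Cc_J)
        fix x
        have "X x powr s \<le> (sqrt ((p + 1) / 2) * v x) powr s"
          using X_le_v[of x] X_pos[of x] s by (intro powr_mono2) auto
        also have "\<dots> = sqrt ((p + 1) / 2) powr s * v x powr s"
          using p v_pos[of x] by (simp add: powr_mult)
        finally show "X x powr s * bump x ^ (2 * m) \<le> sqrt ((p + 1) / 2) powr s * (v x powr s * bump x ^ (2 * m))"
          by (simp add: mult.assoc[symmetric] mult_right_mono)
      qed
      finally show ?thesis by (simp add: J_def)
    qed
    have "sqrt p * K1 \<le> e\<^sup>2 / (4 * (e - 1)) * (LBINT x. X x powr (s - 1) * v x * \<mu> x)
        + Ce * (LBINT x. u x powr e * bump x ^ (2 * m))"
      using main unfolding h1 h2 by (simp add: K1_def)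
    with mult_left_mono[OF h3 C_nonneg(1)] have "sqrt p * K1 \<le> e\<^sup>2 / (4 * (e - 1)) * (LBINT x. X x powr (s - 1) * v x * \<mu> x)
        + Ce * (sqrt ((p + 1) / 2) powr s * J)"
      by linarith
    then have "a * (sqrt p * K1) \<le> a * (e\<^sup>2 / (4 * (e - 1)) * (LBINT x. X x powr (s - 1) * v x * \<mu> x)
        + Ce * (sqrt ((p + 1) / 2) powr s * J))"
      using ab by (intro mult_left_mono) auto
    also have "\<dots> = (a * (e\<^sup>2 / (4 * (e - 1)))) * (LBINT x. X x powr (s - 1) * v x * \<mu> x)
        + a * Ce * sqrt ((p + 1) / 2) powr s * J"
      by (simp only: distrib_left mult.assoc)
    also have "a * (e\<^sup>2 / (4 * (e - 1))) = 1"
      using e(2) by (simp add: a_def)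
    finally show ?thesis by (simp add: mult_ac)
  qed
  have E2: "sqrt p * b * K2 \<le> (LBINT x. X x * v x powr (s - 1) * \<mu> x) + b * Cs * J"
  proof -
    have main: "(LBINT x. sqrt p * u x powr ((p - 1) / 2) * v x powr s * bump x ^ (2 * m + 2))
      \<le> s\<^sup>2 / (4 * (s - 1)) * (LBINT x. v x powr (s - 1) * - laplacian v x * bump x ^ (2 * m + 2))
        + Cs * (LBINT x. v x powr s * bump x ^ (2 * m))"
      unfolding Cs_def by (rule weighted_energy_estimate[OF C2_v v_pos s m first_order])
    have h1: "(\<lambda>x. sqrt p * u x powr ((p - 1) / 2) * v x powr s * bump x ^ (2 * m + 2)) = (\<lambda>x. sqrt p * (v x powr s * \<mu> x))"
      by (simp add: \<mu>_def mult_ac)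
    have h2: "(\<lambda>x. v x powr (s - 1) * - laplacian v x * bump x ^ (2 * m + 2)) = (\<lambda>x. X x * v x powr (s - 1) * \<mu> x)"
      by (simp add: \<mu>_def laplacian_v u_powr_p mult_ac)
    have "sqrt p * K2 \<le> s\<^sup>2 / (4 * (s - 1)) * (LBINT x. X x * v x powr (s - 1) * \<mu> x) + Cs * J"
      using main unfolding h1 h2 by (simp add: K2_def J_def)
    then have "b * (sqrt p * K2) \<le> b * (s\<^sup>2 / (4 * (s - 1)) * (LBINT x. X x * v x powr (s - 1) * \<mu> x) + Cs * J)"
      using ab by (intro mult_left_mono) auto
    also have "\<dots> = (b * (s\<^sup>2 / (4 * (s - 1)))) * (LBINT x. X x * v x powr (s - 1) * \<mu> x) + b * Cs * J"
      by (simp only: distrib_left mult.assoc)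
    also have "b * (s\<^sup>2 / (4 * (s - 1))) = 1"
      using s by (simp add: b_def)
    finally show ?thesis by (simp add: mult_ac)
  qed
  \<comment> \<open>The moment of \<open>v / t\<close> in place of \<open>v\<close>. Applied to
    \<open>X\<close> and \<open>v / t\<close>, Young's inequality gives the weights
    \<open>1 - 1 / s\<close> and \<open>1 / s\<close> in one estimate and the swapped weights in the
    other.\<close>
  define K3 where "K3 = t powr (- s) * K2"
  have vt: "(v x / t) powr q = t powr (- q) * v x powr q" for x q
    using t(1) v_pos[of x] by (simp add: powr_divide powr_minus field_simps)
  have Y1: "(LBINT x. X x powr (s - 1) * v x * \<mu> x) \<le> t * ((1 - 1 / s) * K1 + 1 / s * K3)"
  proof -
    have "(LBINT x. X x powr (s - 1) * v x * \<mu> x)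
        \<le> (LBINT x. (t * (1 - 1 / s)) * (X x powr s * \<mu> x) + (t * (1 / s) * t powr (- s)) * (v x powr s * \<mu> x))"
    proof (intro integral_mono Cc_integrable Cc_add Cc_cmult Cc_K Cc_M)
      fix x
      have "X x powr (s - 1) * (v x / t) \<le> (1 - 1 / s) * X x powr s + 1 / s * (v x / t) powr s"
        using X_pos[of x] v_pos[of x] t(1) s by (intro young_powr) auto
      then have "t * (X x powr (s - 1) * (v x / t)) * \<mu> x \<le> t * ((1 - 1 / s) * X x powr s + 1 / s * (t powr (- s) * v x powr s)) * \<mu> x"
        unfolding vt using t(1) \<mu>(2) by (intro mult_right_mono mult_left_mono) auto
      then show "X x powr (s - 1) * v x * \<mu> x \<le> (t * (1 - 1 / s)) * (X x powr s * \<mu> x) + (t * (1 / s) * t powr (- s)) * (v x powr s * \<mu> x)"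
        using t(1) by (simp add: algebra_simps)
    qed
    also have "\<dots> = (t * (1 - 1 / s)) * K1 + (t * (1 / s) * t powr (- s)) * K2"
      unfolding K1_def K2_def using Cc_K
      by (simp only: Bochner_Integration.integral_add integrable_mult_right Cc_integrable Bochner_Integration.integral_mult_right_zero)
    finally show ?thesis by (simp add: K3_def algebra_simps)
  qed
  have Y2: "(LBINT x. X x * v x powr (s - 1) * \<mu> x) \<le> t powr (s - 1) * (1 / s * K1 + (1 - 1 / s) * K3)"
  proof -
    have tt: "t powr (s - 1) * t powr (- (s - 1)) = 1"
      using t(1) by (simp add: powr_add[symmetric])
    have "(LBINT x. X x * v x powr (s - 1) * \<mu> x)
        \<le> (LBINT x. (t powr (s - 1) * (1 / s)) * (X x powr s * \<mu> x) + (t powr (s - 1) * (1 - 1 / s) * t powr (- s)) * (v x powr s * \<mu> x))"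
    proof (intro integral_mono Cc_integrable Cc_add Cc_cmult Cc_K Cc_M)
      fix x
      have "(v x / t) powr (s - 1) * X x \<le> (1 - 1 / s) * (v x / t) powr s + 1 / s * X x powr s"
        using X_pos[of x] v_pos[of x] t(1) s by (intro young_powr) auto
      then have "t powr (s - 1) * (t powr (- (s - 1)) * v x powr (s - 1) * X x) * \<mu> x
          \<le> t powr (s - 1) * ((1 - 1 / s) * (t powr (- s) * v x powr s) + 1 / s * X x powr s) * \<mu> x"
        unfolding vt using \<mu>(2) by (intro mult_right_mono mult_left_mono) auto
      also have "t powr (s - 1) * (t powr (- (s - 1)) * v x powr (s - 1) * X x) * \<mu> x
          = (t powr (s - 1) * t powr (- (s - 1))) * (X x * v x powr (s - 1) * \<mu> x)"
        by (simp only: mult_ac)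
      finally show "X x * v x powr (s - 1) * \<mu> x \<le> (t powr (s - 1) * (1 / s)) * (X x powr s * \<mu> x) + (t powr (s - 1) * (1 - 1 / s) * t powr (- s)) * (v x powr s * \<mu> x)"
        unfolding tt by (simp add: algebra_simps)
    qed
    also have "\<dots> = (t powr (s - 1) * (1 / s)) * K1 + (t powr (s - 1) * (1 - 1 / s) * t powr (- s)) * K2"
      unfolding K1_def K2_def using Cc_K
      by (simp only: Bochner_Integration.integral_add integrable_mult_right Cc_integrable Bochner_Integration.integral_mult_right_zero)
    finally show ?thesis by (simp add: K3_def algebra_simps)
  qed
  have F1: "sqrt p * a / t * K1 \<le> (1 - 1 / s) * K1 + 1 / s * K3 + a * Ce * sqrt ((p + 1) / 2) powr s / t * J"
  proof -
    have "sqrt p * a * K1 \<le> t * ((1 - 1 / s) * K1 + 1 / s * K3) + a * Ce * sqrt ((p + 1) / 2) powr s * J"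
      using E1 Y1 by linarith
    then have "(sqrt p * a * K1) / t \<le> (t * ((1 - 1 / s) * K1 + 1 / s * K3) + a * Ce * sqrt ((p + 1) / 2) powr s * J) / t"
      using t(1) by (intro divide_right_mono) auto
    also have "\<dots> = (1 - 1 / s) * K1 + 1 / s * K3 + a * Ce * sqrt ((p + 1) / 2) powr s / t * J"
      using t(1) by (simp add: add_divide_distrib)
    finally show ?thesis by simp
  qed
  have F2: "t * (sqrt p * b) * K3 \<le> 1 / s * K1 + (1 - 1 / s) * K3 + b * Cs * t powr (1 - s) * J"
  proof -
    have tt: "t powr (1 - s) * t powr (s - 1) = 1" "t powr (1 - s) = t * t powr (- s)"
      using t(1) by (simp_all add: powr_add[symmetric] powr_mult_base)
    have "sqrt p * b * K2 \<le> t powr (s - 1) * (1 / s * K1 + (1 - 1 / s) * K3) + b * Cs * J"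
      using E2 Y2 by linarith
    then have "t powr (1 - s) * (sqrt p * b * K2) \<le> t powr (1 - s) * (t powr (s - 1) * (1 / s * K1 + (1 - 1 / s) * K3) + b * Cs * J)"
      by (intro mult_left_mono) auto
    also have "\<dots> = (t powr (1 - s) * t powr (s - 1)) * (1 / s * K1 + (1 - 1 / s) * K3) + b * Cs * t powr (1 - s) * J"
      by (simp only: distrib_left mult_ac)
    also have "t powr (1 - s) * (sqrt p * b * K2) = t * (sqrt p * b) * K3"
      by (simp only: tt(2) K3_def mult_ac)
    finally show ?thesis by (simp only: tt(1) mult_1)
  qed
  have "0 \<le> K3"
    unfolding K3_def K2_def using \<mu>(2) by (intro mult_nonneg_nonneg integral_nonneg_AE) auto
  then have "0 \<le> (t * (sqrt p * b) - 1) * K3"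
    using t(3) by (intro mult_nonneg_nonneg) (simp_all add: b_def)
  then have "(sqrt p * a / t - 1) * K1 \<le> (a * Ce * sqrt ((p + 1) / 2) powr s / t + b * Cs * t powr (1 - s)) * J"
    using F1 F2 by (simp add: algebra_simps)
  moreover have "K1 = (LBINT x. u x powr ((p - 1) / 2) * X x powr s * bump x ^ (2 * m + 2))"
    by (simp add: K1_def \<mu>_def mult_ac)
  ultimately show ?thesis
    by (simp only: a_def b_def Ce_def Cs_def J_def)
qed

text \<open>Since \<open>s > 2\<close>, the gradient terms have a good sign after moving the Laplacian from \<open>u\<close>
  to \<open>v\<^sup>s\<^sup>-\<^sup>1\<close>; this gives the upper bound of \<open>v\<close> in terms of \<open>u\<close> that complements \<open>comparison\<close>.\<close>

lemma v_power_estimate: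
  assumes s: "2 < s" and n: "0 < n"
  shows "(LBINT x. v x powr s * bump x ^ (n + 2))
    \<le> (LBINT x. (s - 1) * (u x powr (p + 1) * v x powr (s - 2) * bump x ^ (n + 2))
        + ((s - 1) * (4 * (real (n + 2))\<^sup>2) / (s - 2) + (4 * real (n + 2) * real (n + 1) + 2 * real DIM('a) * real (n + 2)))
          * (u x * v x powr (s - 1) * bump x ^ n))"
proof -
  define h \<psi> where "h = (\<lambda>x. v x powr (s - 1))" and "\<psi> = (\<lambda>x::'a. bump x ^ (n + 2))"
  define \<kappa> where "\<kappa> = 4 * (real (n + 2))\<^sup>2"
  define c where "c = 4 * real (n + 2) * real (n + 1) + 2 * real DIM('a) * real (n + 2)"
  note v2 = C_class_2D[OF C2_v]
  note v1 = C_class_Suc_imp[OF v2]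
  have h: "C_class 2 h" unfolding h_def by (rule C_class_powr[OF C2_v v_pos])
  have \<psi>: "C_class 2 \<psi>" unfolding \<psi>_def by (rule C_class_bump_power) (use n in simp)
  have h\<psi>: "C_class 2 (\<lambda>x. h x * \<psi> x)" by (rule C_class_mult[OF h \<psi>])
  have Cc_\<psi>: "Cc \<psi>" unfolding \<psi>_def by (rule Cc_bump_power) simp
  have supp: "bounded {x. h x * \<psi> x \<noteq> 0}"
    using Cc_mult_left[OF C_class_continuous[OF h] Cc_\<psi>] by (simp add: Cc_def)
  have bound: "- laplacian (\<lambda>x. h x * \<psi> x) x
      \<le> (s - 1) * (v x powr (s - 2) * u x powr p * \<psi> x) + ((s - 1) * \<kappa> / (s - 2) + c) * (v x powr (s - 1) * bump x ^ n)" for x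
  proof -
    \<comment> \<open>Up to the factor \<open>(s - 1) * v powr (s - 2)\<close>, \<open>P\<close> is
      the gradient term with the good sign and \<open>Q\<close> the error to be paid. They are
      matched so that \<open>P * Q\<close> dominates the squared product of the gradients of
      \<open>v\<close> and \<open>\<psi>\<close>, and \<open>2 * sqrt (P * Q) \<le> P + Q\<close>
      then absorbs the cross term into \<open>P\<close>.\<close>
    define P Q d where "P = (s - 2) * (grad_dot v v x * \<psi> x) / v x" and "Q = \<kappa> * bump x ^ n * v x / (s - 2)"
      and "d = grad_dot v \<psi> x"
    have vx: "0 < v x" by (rule v_pos)
    have \<psi>0: "0 \<le> \<psi> x" by (simp add: \<psi>_def)
    have PQ: "0 \<le> P" "0 \<le> Q"
      using s vx \<psi>0 grad_dot_self_nonneg[of v x] by (auto simp: P_def Q_def \<kappa>_def)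
    have "grad_dot \<psi> \<psi> x \<le> \<kappa> * (bump x ^ n * \<psi> x)"
    proof -
      have "grad_dot \<psi> \<psi> x \<le> \<kappa> * bump x ^ (2 * (n + 1))"
        unfolding \<psi>_def \<kappa>_def using grad_dot_bump_power_le[of "n + 1" x] by simp
      also have "bump x ^ (2 * (n + 1)) = bump x ^ n * \<psi> x"
        by (simp add: \<psi>_def mult_2 power_add[symmetric])
      finally show ?thesis .
    qed
    then have "grad_dot v v x * grad_dot \<psi> \<psi> x \<le> grad_dot v v x * (\<kappa> * (bump x ^ n * \<psi> x))"
      by (intro mult_left_mono grad_dot_self_nonneg)
    then have "d\<^sup>2 \<le> grad_dot v v x * (\<kappa> * (bump x ^ n * \<psi> x))"
      using grad_dot_cauchy_schwarz[of v \<psi> x] by (simp add: d_def)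
    also have "\<dots> = P * Q"
      using s vx by (simp add: P_def Q_def)
    finally have "d\<^sup>2 \<le> P * Q" .
    moreover have "4 * (P * Q) \<le> (P + Q)\<^sup>2"
      using zero_le_power2[of "P - Q"] by (simp add: power2_eq_square algebra_simps)
    ultimately have "(2 * d)\<^sup>2 \<le> (P + Q)\<^sup>2"
      by (simp add: power_mult_distrib)
    then have "- (2 * d) \<le> P + Q"
      using PQ by (metis abs_le_square_iff abs_of_nonneg add_nonneg_nonneg abs_ge_minus_self order_trans)
    then have "(s - 1) * v x powr (s - 2) * (- (2 * d)) \<le> (s - 1) * v x powr (s - 2) * (P + Q)"
      using s by (intro mult_left_mono) auto
    moreover have "(s - 1) * v x powr (s - 2) * P = (s - 1) * (s - 2) * v x powr (s - 3) * grad_dot v v x * \<psi> x"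
    proof -
      have "v x powr (s - 2) / v x = v x powr (s - 3)"
        using powr_diff[of "v x" "s - 2" 1] vx by simp
      moreover have "(s - 1) * v x powr (s - 2) * P = (s - 1) * (s - 2) * (v x powr (s - 2) / v x) * grad_dot v v x * \<psi> x"
        by (simp add: P_def)
      ultimately show ?thesis by (simp only:)
    qed
    moreover have "(s - 1) * v x powr (s - 2) * Q = (s - 1) * \<kappa> / (s - 2) * (v x powr (s - 1) * bump x ^ n)"
    proof -
      have "v x powr (s - 2) * v x = v x powr (s - 1)"
        using powr_add[of "v x" "s - 2" 1] vx by simp
      moreover have "(s - 1) * v x powr (s - 2) * Q = (s - 1) * \<kappa> / (s - 2) * ((v x powr (s - 2) * v x) * bump x ^ n)"
        by (simp add: Q_def)
      ultimately show ?thesis by (simp only:)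
    qed
    moreover have "- (h x * laplacian \<psi> x) \<le> c * (v x powr (s - 1) * bump x ^ n)"
    proof -
      have "\<bar>laplacian \<psi> x\<bar> \<le> c * bump x ^ n"
        unfolding \<psi>_def c_def by (rule abs_laplacian_bump_power[OF n])
      then have "h x * (- laplacian \<psi> x) \<le> h x * (c * bump x ^ n)"
        by (intro mult_left_mono) (auto simp: h_def)
      then show ?thesis by (simp add: h_def mult_ac)
    qed
    moreover have "- laplacian (\<lambda>x. h x * \<psi> x) x = (s - 1) * (v x powr (s - 2) * u x powr p * \<psi> x)
        - (s - 1) * (s - 2) * v x powr (s - 3) * grad_dot v v x * \<psi> x
        + (s - 1) * v x powr (s - 2) * (- (2 * d)) - h x * laplacian \<psi> x"
    proof -
      have "s - 1 - 1 = s - 2" "s - 1 - 2 = s - 3" by simp_all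
      then show ?thesis
        unfolding laplacian_mult[OF h \<psi>] unfolding h_def
        by (simp only: laplacian_powr[OF C2_v v_pos] grad_dot_powr_left[OF v1 v_pos] laplacian_v d_def)
          (simp add: algebra_simps)
    qed
    ultimately show ?thesis
      by (simp add: algebra_simps)
  qed
  have "(LBINT x. v x powr s * \<psi> x) = (LBINT x. - (h x * \<psi> x * laplacian u x))"
  proof (intro Bochner_Integration.integral_cong refl)
    fix x
    have "v x powr s = h x * v x"
      using powr_add[of "v x" "s - 1" 1] v_pos[of x] by (simp add: h_def)
    then show "v x powr s * \<psi> x = - (h x * \<psi> x * laplacian u x)"
      by (simp add: v_def)
  qed
  also have "\<dots> = (LBINT x. u x * - laplacian (\<lambda>x. h x * \<psi> x) x)"
    using green_second[OF h\<psi> supp C2_u] by (simp add: mult.commute)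
  also have "\<dots> \<le> (LBINT x. (s - 1) * (u x powr (p + 1) * v x powr (s - 2) * \<psi> x)
      + ((s - 1) * \<kappa> / (s - 2) + c) * (u x * v x powr (s - 1) * bump x ^ n))"
  proof (rule integral_mono)
    show "integrable lborel (\<lambda>x. u x * - laplacian (\<lambda>x. h x * \<psi> x) x)"
      by (intro Cc_integrable Cc_mult_left continuous_u Cc_uminus Cc_laplacian h\<psi> supp)
    show "integrable lborel (\<lambda>x. (s - 1) * (u x powr (p + 1) * v x powr (s - 2) * \<psi> x)
      + ((s - 1) * \<kappa> / (s - 2) + c) * (u x * v x powr (s - 1) * bump x ^ n))"
      by (intro Cc_integrable Cc_add Cc_cmult Cc_mult_left continuous_on_mult continuous_u_powr continuous_v_powr
          continuous_u Cc_\<psi> Cc_bump_power n)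
    fix x
    have "u x * - laplacian (\<lambda>x. h x * \<psi> x) x \<le> u x * ((s - 1) * (v x powr (s - 2) * u x powr p * \<psi> x)
        + ((s - 1) * \<kappa> / (s - 2) + c) * (v x powr (s - 1) * bump x ^ n))"
      using bound[of x] u_pos[of x] by (intro mult_left_mono) auto
    moreover have "u x powr (p + 1) = u x * u x powr p"
      using powr_add[of "u x" p 1] u_pos[of x] by simp
    ultimately show "u x * - laplacian (\<lambda>x. h x * \<psi> x) x \<le> (s - 1) * (u x powr (p + 1) * v x powr (s - 2) * \<psi> x)
      + ((s - 1) * \<kappa> / (s - 2) + c) * (u x * v x powr (s - 1) * bump x ^ n)"
      by (simp add: algebra_simps)
  qed
  finally show ?thesis
    by (simp only: \<psi>_def \<kappa>_def c_def)
qed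

end

text \<open>Here \<open>x\<close>, \<open>y\<close>, \<open>b\<close> stand for \<open>u\<close>,
  \<open>v\<close> and the cutoff. The first term on the left has degree \<open>s\<close> in
  \<open>x powr ((p + 1) / 2)\<close> and \<open>y\<close>; the second lacks two powers of
  \<open>b\<close>. Both reduce to the \<open>s\<close>-th power of
  \<open>x powr ((p + 1) / 2)\<close>, which the extra factor \<open>x powr ((p - 1) / 2)\<close> in
  the second term on the right absorbs.\<close>

lemma pointwise_absorption:
  fixes p s A1 A2 \<delta> :: real
  assumes p: "1 < p" and s: "2 < s" and A: "0 < A1" "0 < A2" and \<delta>: "0 < \<delta>"
    and k: "0 < k" "2 * ((p + 1) * s / (p - 1)) + 1 \<le> real (2 * k + 2)"
  obtains C where "0 \<le> C"
    "\<And>x y b. 0 < x \<Longrightarrow> 0 < y \<Longrightarrow> 0 \<le> b \<Longrightarrow> b \<le> 1 \<Longrightarrow>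
      A1 * (x powr (p + 1) * y powr (s - 2) * b ^ (2 * k + 2)) + A2 * (x * y powr (s - 1) * b ^ (2 * k))
      \<le> 1 / 2 * (y powr s * b ^ (2 * k + 2)) + \<delta> * (x powr ((p - 1) / 2 + (p + 1) / 2 * s) * b ^ (2 * k + 4)) + C * b"
proof -
  define D1 D2 where "D1 = A1 * (A1 / (1 / 4)) powr ((s - 2) / 2)" and "D2 = A2 * (A2 / (1 / 4)) powr ((s - 1) / 1)"
  have D: "0 < D1" "0 < D2" using A by (simp_all add: D1_def D2_def)
  \<comment> \<open>Chosen so that raising \<open>X powr s\<close> to the power \<open>1 + e\<close>
    adds exactly the factor \<open>x powr ((p - 1) / 2)\<close>.\<close>
  define e where "e = (p - 1) / ((p + 1) * s)"
  have e: "0 < e" using p s by (simp add: e_def)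
  define C where "C = (D1 + D2) * ((D1 + D2) / \<delta>) powr (1 / e) + D2"
  have C: "0 \<le> C" using D \<delta> by (simp add: C_def)
  define r where "r = (p + 1) / (p - 1)"
  have r: "0 < r" using p by (simp add: r_def)
  show thesis
  proof (rule that[OF C])
    fix x y b :: real assume x: "0 < x" and y: "0 < y" and b01: "0 \<le> b" "b \<le> 1"
    define X where "X = x powr ((p + 1) / 2)"
    have X: "0 < X" using x by (simp add: X_def)
    show "A1 * (x powr (p + 1) * y powr (s - 2) * b ^ (2 * k + 2)) + A2 * (x * y powr (s - 1) * b ^ (2 * k))
      \<le> 1 / 2 * (y powr s * b ^ (2 * k + 2)) + \<delta> * (x powr ((p - 1) / 2 + (p + 1) / 2 * s) * b ^ (2 * k + 4)) + C * b"
    proof (cases "b = 0")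
      case True
      then show ?thesis using k by (simp add: zero_power)
    next
      case False
      then have b: "0 < b" using b01 by simp
      \<comment> \<open>The two missing powers of \<open>b\<close> are charged to \<open>x\<close>,
        so that the second term can be treated with the same cutoff as the first.\<close>
      define \<rho> where "\<rho> = b powr (- 2)"
      have \<rho>: "0 < \<rho>" using b by (simp add: \<rho>_def)
      have b2: "\<rho> * b ^ (2 * k + 2) = b ^ (2 * k)"
        using b by (simp add: \<rho>_def powr_minus power2_eq_square field_simps)
      have i: "A1 * x powr (p + 1) * y powr (s - 2) \<le> 1 / 4 * y powr s + D1 * X powr s"
      proof -
        have "A1 * X powr 2 * y powr (s - 2) \<le> 1 / 4 * y powr s + D1 * X powr s"
          unfolding D1_def by (rule powr_absorb) (use X y s A in auto)
        moreover have "X powr 2 = x powr (p + 1)"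
          unfolding X_def powr_powr by (rule arg_cong[of _ _ "\<lambda>a. x powr a"]) simp
        ultimately show ?thesis by simp
      qed
      have ii: "A2 * (\<rho> * x) * y powr (s - 1) \<le> 1 / 4 * y powr s + D2 * (\<rho> * x) powr s"
        using powr_absorb[of "\<rho> * x" y 1 s A2 "1 / 4"] \<rho> x y s A by (simp add: D2_def)
      \<comment> \<open>If \<open>\<rho>\<close> is at most \<open>x powr ((p - 1) / 2)\<close>,
        then \<open>\<rho> * x \<le> X\<close>; otherwise \<open>x\<close> is bounded by a power of
        \<open>\<rho>\<close>, and only a negative power of \<open>b\<close> remains.\<close>
      have iii: "(\<rho> * x) powr s \<le> X powr s + \<rho> powr (r * s)"
      proof (cases "\<rho> \<le> x powr ((p - 1) / 2)")
        case True
        have "x powr ((p - 1) / 2) * x = X"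
          using powr_add[of x "(p - 1) / 2" 1] x by (simp add: X_def field_simps)
        then have "\<rho> * x \<le> X"
          using mult_right_mono[OF True, of x] x by simp
        then have "(\<rho> * x) powr s \<le> X powr s"
          using \<rho> x s by (intro powr_mono2) auto
        then show ?thesis by (simp add: add_increasing2)
      next
        case False
        then have "(x powr ((p - 1) / 2)) powr (2 / (p - 1)) \<le> \<rho> powr (2 / (p - 1))"
          using p by (intro powr_mono2) auto
        moreover have "(p - 1) / 2 * (2 / (p - 1)) = 1"
          using p by (simp add: field_simps)
        ultimately have "x \<le> \<rho> powr (2 / (p - 1))"
          using x by (simp only: powr_powr powr_one)
        then have "\<rho> * x \<le> \<rho> * \<rho> powr (2 / (p - 1))"
          using \<rho> by (intro mult_left_mono) auto
        also have "\<dots> = \<rho> powr r"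
        proof -
          have "r = 1 + 2 / (p - 1)" using p by (simp add: r_def field_simps)
          then show ?thesis using \<rho> by (simp add: powr_add)
        qed
        finally have "(\<rho> * x) powr s \<le> (\<rho> powr r) powr s"
          using \<rho> x s by (intro powr_mono2) auto
        then show ?thesis by (simp add: powr_powr add_increasing)
      qed
      have iv: "(D1 + D2) * X powr s * b ^ (2 * k + 2)
          \<le> \<delta> * (x powr ((p - 1) / 2 + (p + 1) / 2 * s) * b ^ (2 * k + 4)) + (D1 + D2) * ((D1 + D2) / \<delta>) powr (1 / e) * b"
      proof -
        have "(X powr s) powr (1 + e) = x powr ((p - 1) / 2 + (p + 1) / 2 * s)"
        proof -
          have "(p + 1) / 2 * s * e = (p - 1) / 2"
            using p s by (simp add: e_def)
          then have "(p + 1) / 2 * s * (1 + e) = (p - 1) / 2 + (p + 1) / 2 * s"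
            by (simp only: distrib_left)
          then show ?thesis by (simp only: X_def powr_powr)
        qed
        moreover have "real 2 / e + 1 \<le> real (2 * k + 2)"
          using k(2) p s by (simp add: e_def)
        ultimately have "(D1 + D2) * X powr s * b ^ (2 * k + 2)
            \<le> \<delta> * x powr ((p - 1) / 2 + (p + 1) / 2 * s) * b ^ (2 * k + 2 + 2) + (D1 + D2) * ((D1 + D2) / \<delta>) powr (1 / e) * b"
          using powr_cutoff_bound[of \<delta> e "D1 + D2" 2 "2 * k + 2" "X powr s" b] \<delta> e D b01 by simp
        moreover have "2 * k + 2 + 2 = 2 * k + 4" by simp
        ultimately show ?thesis by (simp only: mult.assoc)
      qed
      have v: "\<rho> powr (r * s) * b ^ (2 * k + 2) \<le> b"
      proof -
        have "\<rho> powr (r * s) * b ^ (2 * k + 2) = b powr (- 2 * (r * s)) * b powr real (2 * k + 2)"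
          unfolding \<rho>_def powr_powr using b by (simp only: powr_realpow)
        also have "\<dots> = b powr (real (2 * k + 2) - 2 * (r * s))"
          by (simp add: powr_add[symmetric])
        also have "\<dots> \<le> b powr 1"
          using k(2) b b01 by (intro powr_mono') (simp_all add: r_def)
        finally show ?thesis using b by simp
      qed
      have "A1 * (x powr (p + 1) * y powr (s - 2) * b ^ (2 * k + 2)) \<le> (1 / 4 * y powr s + D1 * X powr s) * b ^ (2 * k + 2)"
        using mult_right_mono[OF i, of "b ^ (2 * k + 2)"] b by (simp add: mult.assoc)
      moreover have "A2 * (x * y powr (s - 1) * b ^ (2 * k)) \<le> (1 / 4 * y powr s + D2 * (X powr s + \<rho> powr (r * s))) * b ^ (2 * k + 2)"
      proof -
        have "A2 * (x * y powr (s - 1) * b ^ (2 * k)) = A2 * (\<rho> * x) * y powr (s - 1) * b ^ (2 * k + 2)"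
          unfolding b2[symmetric] by (simp only: mult_ac)
        also have "\<dots> \<le> (1 / 4 * y powr s + D2 * (\<rho> * x) powr s) * b ^ (2 * k + 2)"
          using ii b by (intro mult_right_mono) auto
        also have "\<dots> \<le> (1 / 4 * y powr s + D2 * (X powr s + \<rho> powr (r * s))) * b ^ (2 * k + 2)"
          using iii b D by (intro mult_right_mono add_left_mono mult_left_mono) auto
        finally show ?thesis .
      qed
      moreover have "D2 * (\<rho> powr (r * s) * b ^ (2 * k + 2)) \<le> D2 * b"
        using v D by (intro mult_left_mono) auto
      moreover have "(1 / 4 * y powr s + D1 * X powr s) * b ^ (2 * k + 2) + (1 / 4 * y powr s + D2 * (X powr s + \<rho> powr (r * s))) * b ^ (2 * k + 2)
          = 1 / 2 * (y powr s * b ^ (2 * k + 2)) + (D1 + D2) * X powr s * b ^ (2 * k + 2) + D2 * (\<rho> powr (r * s) * b ^ (2 * k + 2))"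
        by (simp only: algebra_simps)
      moreover have "C * b = (D1 + D2) * ((D1 + D2) / \<delta>) powr (1 / e) * b + D2 * b"
        by (simp only: C_def distrib_right)
      ultimately show ?thesis
        using iv by linarith
    qed
  qed
qed

text \<open>The two estimates form a loop: \<open>K\<close> is bounded by a multiple of
  \<open>J\<close>, and \<open>J\<close> by a small multiple of \<open>K\<close> plus a constant.
  All integrals are finite by compact support, so the loop can be closed by subtraction.\<close>

lemma stable_integral_bounded:
  fixes p s e :: real
  assumes p: "1 < p" and s: "2 < s" and e: "e = (p + 1) / 2 * s"
    and gain: "1 < (sqrt p * (4 * (e - 1) / e\<^sup>2)) * (sqrt p * (4 * (s - 1) / s\<^sup>2))"
  obtains M C where "0 < M" "\<And>u::'a::euclidean_space \<Rightarrow> real. stable_lane_emden4 p u \<Longrightarrow>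
    (LBINT x. u x powr ((p - 1) / 2 + (p + 1) / 2 * s) * bump x ^ M) \<le> C"
proof -
  have e1: "1 < e"
  proof -
    have "1 * s < (p + 1) / 2 * s" using p s by (intro mult_strict_right_mono) auto
    then show ?thesis using s unfolding e by linarith
  qed
  define \<alpha> \<beta> where "\<alpha> = sqrt p * (4 * (e - 1) / e\<^sup>2)" and "\<beta> = sqrt p * (4 * (s - 1) / s\<^sup>2)"
  have \<alpha>\<beta>: "0 < \<alpha>" "0 < \<beta>" "1 < \<alpha> * \<beta>"
    using p s e1 gain by (simp_all add: \<alpha>_def \<beta>_def)
  then have "1 / \<beta> < \<alpha>" by (simp add: field_simps)
  \<comment> \<open>The interval of admissible Young parameters is nonempty precisely by the
    hypothesis \<open>gain\<close>.\<close>
  then obtain t where t: "1 / \<beta> < t" "t < \<alpha>" using dense by blast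
  have t0: "0 < t"
    using t(1) \<alpha>\<beta> by (meson order.strict_trans zero_less_divide_1_iff)
  have t1: "1 < t * \<beta>"
    using t(1) \<alpha>\<beta> by (simp add: field_simps)
  define k where "k = nat \<lceil>2 * ((p + 1) * s / (p - 1)) + 1\<rceil> + 1"
  have k: "0 < k" "2 * ((p + 1) * s / (p - 1)) + 1 \<le> real (2 * k + 2)"
    using real_nat_ceiling_ge[of "2 * ((p + 1) * s / (p - 1)) + 1"] by (simp_all add: k_def)
  \<comment> \<open>The shift by one matches the cutoffs: the error weight \<open>2 * m\<close> of
    the coupled estimate is the weight \<open>2 * k + 2\<close> of the estimate for
    \<open>v\<close>.\<close>
  define m where "m = Suc k"
  have m2: "2 * m = 2 * k + 2" "2 * m + 2 = 2 * k + 4" by (simp_all add: m_def)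
  define c0 where "c0 = \<alpha> / t - 1"
  have c0: "0 < c0" using t(2) t0 by (simp add: c0_def field_simps)
  define B where "B = 4 * (e - 1) / e\<^sup>2 * caccioppoli_const e m TYPE('a) * sqrt ((p + 1) / 2) powr s / t
        + 4 * (s - 1) / s\<^sup>2 * caccioppoli_const s m TYPE('a) * t powr (1 - s)"
  have B: "0 \<le> B"
    unfolding B_def using e1 s t0 caccioppoli_const_nonneg[of e m "TYPE('a)"] caccioppoli_const_nonneg[of s m "TYPE('a)"]
    by (intro add_nonneg_nonneg divide_nonneg_pos mult_nonneg_nonneg) auto
  define C3 where "C3 = B / c0"
  have C3: "0 \<le> C3" using B c0 by (simp add: C3_def)
  define A1 A2 where "A1 = s - 1" and "A2 = (s - 1) * (4 * (real (2 * k + 2))\<^sup>2) / (s - 2)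
      + (4 * real (2 * k + 2) * real (2 * k + 1) + 2 * real DIM('a) * real (2 * k + 2))"
  have A: "0 < A1" "0 < A2"
    using s by (auto simp: A1_def A2_def intro!: add_pos_nonneg divide_pos_pos mult_pos_pos)
  \<comment> \<open>Small enough that after passing through both estimates \<open>K\<close> returns
    with a factor at most 1/2.\<close>
  define \<delta> where "\<delta> = 1 / (4 * (C3 + 1))"
  have \<delta>: "0 < \<delta>" using C3 by (simp add: \<delta>_def)
  obtain C where C: "0 \<le> C"
    "\<And>x y b. 0 < x \<Longrightarrow> 0 < y \<Longrightarrow> 0 \<le> b \<Longrightarrow> b \<le> 1 \<Longrightarrow>
      A1 * (x powr (p + 1) * y powr (s - 2) * b ^ (2 * k + 2)) + A2 * (x * y powr (s - 1) * b ^ (2 * k))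
      \<le> 1 / 2 * (y powr s * b ^ (2 * k + 2)) + \<delta> * (x powr ((p - 1) / 2 + (p + 1) / 2 * s) * b ^ (2 * k + 4)) + C * b"
    using pointwise_absorption[OF p s A \<delta> k] by blast
  define I where "I = (LBINT x. bump (x::'a))"
  show thesis
  proof (rule that[of "2 * k + 4" "4 * (C3 * C * I)"])
    fix u :: "'a \<Rightarrow> real" assume "stable_lane_emden4 p u"
    then interpret stable_lane_emden4 p u .
    define K where "K = (LBINT x. u x powr ((p - 1) / 2 + (p + 1) / 2 * s) * bump x ^ (2 * k + 4))"
    define J where "J = (LBINT x. v x powr s * bump x ^ (2 * k + 2))"
    have cc: "Cc (\<lambda>x. u x powr ((p - 1) / 2 + (p + 1) / 2 * s) * bump x ^ (2 * k + 4))" "Cc (\<lambda>x. v x powr s * bump x ^ (2 * k + 2))"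
      "Cc (\<lambda>x. u x powr (p + 1) * v x powr (s - 2) * bump x ^ (2 * k + 2))" "Cc (\<lambda>x. u x * v x powr (s - 1) * bump x ^ (2 * k))"
      "Cc (bump :: 'a \<Rightarrow> real)"
      using k(1) Cc_bump_power[of 1, where 'a='a]
      by (auto intro!: Cc_mult_left continuous_on_mult continuous_u_powr continuous_v_powr continuous_u Cc_bump_power simp del: power_Suc)
    have K0: "0 \<le> K" unfolding K_def by (intro integral_nonneg_AE) auto
    have "c0 * K \<le> B * J"
    proof -
      have "K = (LBINT x. u x powr ((p - 1) / 2) * X x powr s * bump x ^ (2 * m + 2))"
        unfolding K_def m2(2) by (simp add: X_powr powr_add)
      moreover have "J = (LBINT x. v x powr s * bump x ^ (2 * m))"
        unfolding J_def m2(1) ..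
      moreover have "c0 * (LBINT x. u x powr ((p - 1) / 2) * X x powr s * bump x ^ (2 * m + 2))
          \<le> B * (LBINT x. v x powr s * bump x ^ (2 * m))"
        unfolding c0_def \<alpha>_def B_def
        by (rule coupled_estimate[OF _ e e1 _ t0 t(2)[unfolded \<alpha>_def] t1[unfolded \<beta>_def]]) (use s in \<open>simp_all add: m_def\<close>)
      ultimately show ?thesis by (simp only:)
    qed
    then have KJ: "K \<le> C3 * J" using c0 by (simp add: C3_def field_simps)
    have "J \<le> (LBINT x. A1 * (u x powr (p + 1) * v x powr (s - 2) * bump x ^ (2 * k + 2)) + A2 * (u x * v x powr (s - 1) * bump x ^ (2 * k)))"
      unfolding J_def A1_def A2_def by (rule v_power_estimate[OF s]) (use k(1) in simp)
    also have "\<dots> \<le> (LBINT x. 1 / 2 * (v x powr s * bump x ^ (2 * k + 2))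
        + \<delta> * (u x powr ((p - 1) / 2 + (p + 1) / 2 * s) * bump x ^ (2 * k + 4)) + C * bump x)"
      by (intro integral_mono Cc_integrable Cc_add Cc_cmult cc C(2) u_pos v_pos bump_nonneg bump_le_1)
    also have "\<dots> = 1 / 2 * J + \<delta> * K + C * I"
      unfolding J_def K_def I_def using cc[THEN Cc_integrable]
      by (simp only: Bochner_Integration.integral_add integrable_mult_right Bochner_Integration.integrable_add
        Bochner_Integration.integral_mult_right_zero)
    finally have "J \<le> 2 * \<delta> * K + 2 * (C * I)" by simp
    then have "C3 * J \<le> C3 * (2 * \<delta> * K + 2 * (C * I))"
      using C3 by (rule mult_left_mono)
    also have "\<dots> = (2 * \<delta> * C3) * K + 2 * (C3 * C * I)"
      by (simp add: algebra_simps)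
    also have "\<dots> \<le> 1 / 2 * K + 2 * (C3 * C * I)"
      using C3 K0 by (intro add_right_mono mult_right_mono) (simp_all add: \<delta>_def field_simps)
    finally show "K \<le> 4 * (C3 * C * I)"
      using KJ by simp
  qed simp
qed

section \<open>Dilations of stable solutions and the contradiction\<close>

lemma (in stable_lane_emden4) stable_dilation:
  assumes R: "0 < R"
  shows "stable_lane_emden4 p (\<lambda>x. R powr (4 / (p - 1)) * u (0 + R *\<^sub>R x))"
proof -
  interpret U: lane_emden4 p "\<lambda>x. R powr (4 / (p - 1)) * u (0 + R *\<^sub>R x)"
    by (rule dilation(1)[OF R])
  show ?thesis
  proof (intro stable_lane_emden4.intro stable_lane_emden4_axioms.intro U.lane_emden4_axioms)
    fix \<phi> :: "'a \<Rightarrow> real" assume \<phi>: "C_class (Suc 0) \<phi>" "bounded {x. \<phi> x \<noteq> 0}"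
    define \<Phi> where "\<Phi> = (\<lambda>x. \<phi> (0 + inverse R *\<^sub>R x))"
    let ?V = "\<lambda>x. sqrt p * u x powr ((p - 1) / 2)"
    have Cc_\<phi>: "Cc \<phi>" by (rule C_class_Cc[OF \<phi>])
    have Cc_\<Phi>: "Cc \<Phi>" unfolding \<Phi>_def by (rule Cc_affine[OF Cc_\<phi>]) (use R in simp)
    have \<Phi>: "C_class (Suc 0) \<Phi>" "bounded {x. \<Phi> x \<noteq> 0}"
      using C_class_affine[OF \<phi>(1), of 0 "inverse R"] Cc_\<Phi> by (simp_all add: \<Phi>_def Cc_def del: C_class.simps)
    have \<Phi>_R: "\<Phi> (R *\<^sub>R x) = \<phi> x" for x using R by (simp add: \<Phi>_def)
    have grad: "grad_dot \<Phi> \<Phi> (R *\<^sub>R x) = (inverse R)\<^sup>2 * grad_dot \<phi> \<phi> x" for x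
      unfolding \<Phi>_def unfolding grad_dot_affine[OF \<phi>(1) \<phi>(1)] using R by simp
    have meas: "(\<lambda>x. ?V x * (\<Phi> x)\<^sup>2) \<in> borel_measurable borel" "grad_dot \<Phi> \<Phi> \<in> borel_measurable borel"
      using Cc_\<Phi> by (auto intro!: borel_measurable_continuous_onI continuous_on_mult continuous_u_powr continuous_on_power
        continuous_grad_dot[OF \<Phi>(1) \<Phi>(1)] simp: Cc_def simp del: C_class.simps)
    have "R ^ DIM('a) * (LBINT x. ?V (R *\<^sub>R x) * (\<phi> x)\<^sup>2) = (LBINT x. ?V x * (\<Phi> x)\<^sup>2)"
      using integral_lborel_scaleR[OF meas(1), of R] R by (simp add: \<Phi>_R)
    also have "\<dots> \<le> (LBINT x. grad_dot \<Phi> \<Phi> x)"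
      by (rule first_order[OF \<Phi>])
    also have "\<dots> = R ^ DIM('a) * ((inverse R)\<^sup>2 * (LBINT x. grad_dot \<phi> \<phi> x))"
      using integral_lborel_scaleR[OF meas(2), of R] R by (simp add: grad)
    finally have "(LBINT x. ?V (R *\<^sub>R x) * (\<phi> x)\<^sup>2) \<le> (inverse R)\<^sup>2 * (LBINT x. grad_dot \<phi> \<phi> x)"
      using R by simp
    then have le: "R\<^sup>2 * (LBINT x. ?V (R *\<^sub>R x) * (\<phi> x)\<^sup>2) \<le> (LBINT x. grad_dot \<phi> \<phi> x)"
      using R by (simp add: field_simps)
    \<comment> \<open>The potential gains the factor \<open>R\<^sup>2\<close>, which is what the
      gradient form loses under the inverse dilation of the test function.\<close>
    have "(R powr (4 / (p - 1)) * u (0 + R *\<^sub>R x)) powr ((p - 1) / 2) = R\<^sup>2 * u (R *\<^sub>R x) powr ((p - 1) / 2)" for x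
    proof -
      have "4 / (p - 1) * ((p - 1) / 2) = 2" using p by (simp add: field_simps)
      then have "(R powr (4 / (p - 1))) powr ((p - 1) / 2) = R\<^sup>2"
        using R by (simp only: powr_powr powr_numeral)
      then show ?thesis
        using u_pos[of "R *\<^sub>R x"] by (simp add: powr_mult)
    qed
    then have "(LBINT x. sqrt p * (R powr (4 / (p - 1)) * u (0 + R *\<^sub>R x)) powr ((p - 1) / 2) * (\<phi> x)\<^sup>2)
        = (LBINT x. R\<^sup>2 * (?V (R *\<^sub>R x) * (\<phi> x)\<^sup>2))"
      by (simp add: mult_ac)
    with le show "(LBINT x. sqrt p * (R powr (4 / (p - 1)) * u (0 + R *\<^sub>R x)) powr ((p - 1) / 2) * (\<phi> x)\<^sup>2)
        \<le> (LBINT x. grad_dot \<phi> \<phi> x)"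
      by simp
  qed
qed

lemma no_stable_solution:
  fixes u :: "'a::euclidean_space \<Rightarrow> real" and p s e :: real
  assumes p: "1 < p" and s: "2 < s" and e: "e = (p + 1) / 2 * s"
    and gain: "1 < (sqrt p * (4 * (e - 1) / e\<^sup>2)) * (sqrt p * (4 * (s - 1) / s\<^sup>2))"
    and dim: "real DIM('a) < 2 + 2 * ((p + 1) / (p - 1) * s)"
  shows "\<not> stable_solution p u"
proof
  assume "stable_solution p u"
  then interpret stable_lane_emden4 p u
    by (rule stable_solution_imp_locale[OF p])
  define a where "a = (p - 1) / 2 + (p + 1) / 2 * s"
  obtain M C where M: "0 < M" and C: "\<And>w::'a \<Rightarrow> real. stable_lane_emden4 p w \<Longrightarrow> (LBINT x. w x powr a * bump x ^ M) \<le> C"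
    using stable_integral_bounded[OF p s e gain, where 'a='a] unfolding a_def by blast
  define c where "c = (LBINT x. u x powr a * bump x ^ M)"
  have cc: "Cc (\<lambda>x. u x powr a * bump x ^ M)"
    by (intro Cc_mult_left continuous_u_powr Cc_bump_power M)
  have "0 < c"
    unfolding c_def by (rule Cc_integral_pos[OF cc, of 0]) (use u_pos[of 0] in auto)
  moreover have "c \<le> 0"
  proof (rule dilation_bound_imp_nonpos)
    show "0 < 4 / (p - 1) * a - real DIM('a)"
    proof -
      \<comment> \<open>The 2 comes from the potential \<open>u powr ((p - 1) / 2)\<close>, the rest
        from the \<open>s\<close>-th power of \<open>X\<close>.\<close>
      have "4 / (p - 1) * a = 2 + 2 * ((p + 1) / (p - 1) * s)"
        using p by (simp add: a_def field_simps)
      then show ?thesis using dim by simp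
    qed
    fix R :: real assume R: "1 \<le> R"
    have cc': "Cc (\<lambda>x. u x powr a * bump (0 + inverse R *\<^sub>R x) ^ M)"
      by (intro Cc_mult_left continuous_u_powr Cc_affine[OF Cc_bump_power[OF M]]) (use R in simp)
    \<comment> \<open>The cutoff lies below its own dilation, so the fixed integral \<open>c\<close>
      is dominated by one over a large ball, to which the uniform bound applies after
      rescaling.\<close>
    have "c \<le> (LBINT x. u x powr a * bump (0 + inverse R *\<^sub>R x) ^ M)"
      unfolding c_def using bump_power_mono_scaleR[OF R]
      by (intro integral_mono Cc_integrable cc cc' mult_left_mono power_mono) auto
    also have "\<dots> = R ^ DIM('a) * (LBINT x. u (R *\<^sub>R x) powr a * bump x ^ M)"
      using integral_lborel_scaleR[of "\<lambda>x. u x powr a * bump (0 + inverse R *\<^sub>R x) ^ M" R] R Cc_continuous[OF cc']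
      by (simp add: borel_measurable_continuous_onI)
    finally have 1: "R powr (4 / (p - 1) * a - real DIM('a)) * c
        \<le> R powr (4 / (p - 1) * a - real DIM('a)) * (R ^ DIM('a) * (LBINT x. u (R *\<^sub>R x) powr a * bump x ^ M))"
      by (intro mult_left_mono) auto
    have 2: "R powr (4 / (p - 1) * a - real DIM('a)) * R ^ DIM('a) = R powr (4 / (p - 1) * a)"
      using R by (simp add: powr_diff powr_realpow)
    have "(LBINT x. (R powr (4 / (p - 1)) * u (0 + R *\<^sub>R x)) powr a * bump x ^ M) \<le> C"
      by (rule C[OF stable_dilation]) (use R in simp)
    moreover have "(R powr (4 / (p - 1)) * u (0 + R *\<^sub>R x)) powr a = R powr (4 / (p - 1) * a) * u (R *\<^sub>R x) powr a" for x
      using R u_pos[of "R *\<^sub>R x"] by (simp add: powr_mult powr_powr)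
    ultimately have 3: "R powr (4 / (p - 1) * a) * (LBINT x. u (R *\<^sub>R x) powr a * bump x ^ M) \<le> C"
      by (simp add: mult.assoc)
    show "R powr (4 / (p - 1) * a - real DIM('a)) * c \<le> C"
      using 1 3 unfolding mult.assoc[symmetric] 2 by linarith
  qed
  ultimately show False by simp
qed

subsection \<open>The largest root of the quartic\<close>

lemma poly_H_poly: "poly (H_poly p) x = x ^ 4 - 32 * p * (p + 1) / (p - 1)\<^sup>2 * x\<^sup>2
    + 32 * p * (p + 1) * (p + 3) / (p - 1) ^ 3 * x - 64 * p * (p + 1)\<^sup>2 / (p - 1) ^ 4"
  by (simp add: H_poly_def power2_eq_square algebra_simps numeral_eq_Suc)

text \<open>The polynomial has a positive leading coefficient, so a negative value at
  \<open>a\<close> forces a root to the right of \<open>a\<close>. This also shows that the maximum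
  defining \<open>x0\<close> is attained.\<close>

lemma
  shows less_x0: "poly (H_poly p) a < 0 \<Longrightarrow> a < x0 p"
    and root_x0: "poly (H_poly p) a < 0 \<Longrightarrow> poly (H_poly p) (x0 p) = 0"
proof -
  have "H_poly p \<noteq> 0" by (simp add: H_poly_def)
  then have fin: "finite {x. poly (H_poly p) x = 0}"
    by (rule poly_roots_finite)
  have root: "\<exists>x>a. poly (H_poly p) x = 0" if a: "poly (H_poly p) a < 0"
  proof -
    have "0 < lead_coeff (H_poly p)" by (simp add: H_poly_def)
    then obtain n where n: "\<And>x. n \<le> x \<Longrightarrow> lead_coeff (H_poly p) \<le> poly (H_poly p) x"
      using poly_pinfty_gt_lc by blast
    have "0 < poly (H_poly p) (max n (a + 1))"
      using n[of "max n (a + 1)"] \<open>0 < lead_coeff _\<close> by simp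
    then show ?thesis
      using poly_IVT_pos[of a "max n (a + 1)" "H_poly p"] a by (auto simp: less_max_iff_disj)
  qed
  show "a < x0 p" if "poly (H_poly p) a < 0"
    using root[OF that] Max_ge[OF fin] unfolding x0_def by fastforce
  show "poly (H_poly p) (x0 p) = 0" if "poly (H_poly p) a < 0"
    using Max_in[OF fin] root[OF that] unfolding x0_def by blast
qed

context
  fixes p :: real
  assumes p: "1 < p"
begin

text \<open>This point corresponds to \<open>s = 2\<close> and \<open>e = p + 1\<close>, where the
  sign of \<open>H\<close> is that of \<open>(p + 1)\<^sup>2 - 4 * p\<^sup>2\<close>. It guarantees
  that exponents \<open>s > 2\<close> are available below the largest root.\<close>

lemma H_poly_at_critical: "poly (H_poly p) (2 * (p + 1) / (p - 1)) < 0"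
proof -
  define q where "q = p - 1"
  have q: "0 < q" and pq: "p = q + 1" using p by (simp_all add: q_def)
  have "poly (H_poly p) (2 * (p + 1) / (p - 1)) = - (16 * (p + 1)\<^sup>2 * (3 * p + 1) * (p - 1)) / (p - 1) ^ 4"
    unfolding poly_H_poly pq using q by (simp add: divide_simps) (simp add: eval_nat_numeral algebra_simps)
  also have "\<dots> < 0"
    using p by (intro divide_neg_pos) auto
  finally show ?thesis .
qed

lemma x0_gt_critical: "2 * (p + 1) / (p - 1) < x0 p"
  by (rule less_x0[OF H_poly_at_critical])

text \<open>For \<open>p < 7 / 3\<close> the critical point itself lies beyond 5; for larger
  \<open>p\<close> the value of \<open>H\<close> at 5 is negative.\<close>

lemma x0_gt_5: "5 < x0 p"
proof (cases "p < 7 / 3")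
  case True
  then have "5 < 2 * (p + 1) / (p - 1)"
    using p by (simp add: field_simps)
  then show ?thesis using x0_gt_critical by linarith
next
  case False
  define d where "d = p - 1"
  have d: "4 / 3 \<le> d" and pd: "p = d + 1" using False by (simp_all add: d_def)
  \<comment> \<open>The coefficient -15 is the value at 5 of \<open>x^4 - 32 x^2 + 32 x\<close>, the
    limit of \<open>H\<close> as \<open>p\<close> tends to infinity.\<close>
  have "poly (H_poly p) 5 = (- 15 * d ^ 4 - 1344 * d ^ 3 + 320 * d\<^sup>2 + 768 * d - 256) / d ^ 4"
    unfolding poly_H_poly pd using d by (simp add: divide_simps) (simp add: eval_nat_numeral algebra_simps)
  also have "\<dots> < 0"
  proof (rule divide_neg_pos)
    have "4 / 3 * d \<le> d\<^sup>2" using d by (simp add: power2_eq_square)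
    moreover have "4 / 3 * d\<^sup>2 \<le> d ^ 3" using d by (simp add: power2_eq_square power3_eq_cube)
    moreover have "0 \<le> d ^ 4" by simp
    ultimately show "- 15 * d ^ 4 - 1344 * d ^ 3 + 320 * d\<^sup>2 + 768 * d - 256 < 0" using d by linarith
  qed (use d in simp)
  finally show ?thesis by (rule less_x0)
qed

text \<open>In \<open>y = x - 2 (p + 1) / (p - 1)\<close> the coefficients of \<open>H\<close> have exactly one sign change, so
  \<open>H / y\<^sup>2\<close> increases for \<open>y > 0\<close>.\<close>

lemma H_poly_neg_below_x0:
  assumes x: "2 * (p + 1) / (p - 1) < x" "x < x0 p"
  shows "poly (H_poly p) x < 0"
proof -
  define z where "z = 2 * (p + 1) / (p - 1)"
  define A B C where "A = 32 * p * (p + 1) / (p - 1)\<^sup>2" and "B = 32 * p * (p + 1) * (p + 3) / (p - 1) ^ 3"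
    and "C = 64 * p * (p + 1)\<^sup>2 / (p - 1) ^ 4"
  \<comment> \<open>The first-order and constant Taylor coefficients of \<open>H\<close> at
    \<open>z\<close>.\<close>
  define c1 c0 where "c1 = 4 * z ^ 3 - 2 * A * z + B" and "c0 = poly (H_poly p) z"
  have z: "0 < z" using p by (simp add: z_def)
  have c0: "c0 < 0" unfolding c0_def z_def by (rule H_poly_at_critical)
  have c1: "c1 < 0"
  proof -
    define q where "q = p - 1"
    have q: "0 < q" and pq: "p = q + 1" using p by (simp_all add: q_def)
    have "c1 = - (32 * (p + 1) * (2 * p + 1) * (p - 1)) / (p - 1) ^ 3"
      unfolding c1_def A_def B_def z_def pq using q
      by (simp add: divide_simps) (simp add: eval_nat_numeral algebra_simps)
    also have "\<dots> < 0" using p by (intro divide_neg_pos) auto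
    finally show ?thesis .
  qed
  have expand: "poly (H_poly p) (z + y) = y ^ 4 + 4 * z * y ^ 3 + (6 * z\<^sup>2 - A) * y\<^sup>2 + c1 * y + c0" for y
    unfolding c0_def c1_def poly_H_poly A_def[symmetric] B_def[symmetric] C_def[symmetric]
    by (simp add: eval_nat_numeral algebra_simps)
  \<comment> \<open>The coefficient \<open>6 * z\<^sup>2 - A\<close> has the sign of
    \<open>3 - p\<close>. Dividing by \<open>y\<^sup>2\<close> makes it a constant, and every other
    term is increasing in \<open>y\<close>.\<close>
  define F where "F y = y\<^sup>2 + 4 * z * y + (6 * z\<^sup>2 - A) + c1 / y + c0 / y\<^sup>2" for y
  have F: "poly (H_poly p) (z + y) = y\<^sup>2 * F y" if "0 < y" for y
    unfolding expand F_def using that by (simp add: field_simps power2_eq_square power3_eq_cube power4_eq_xxxx)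
  define y y0 where "y = x - z" and "y0 = x0 p - z"
  have y: "0 < y" "y < y0" using x by (simp_all add: y_def y0_def z_def)
  have "F y0 = 0"
    using F[of y0] y root_x0[OF H_poly_at_critical] by (simp add: y0_def)
  moreover have "F y < F y0"
  proof -
    have "y\<^sup>2 < y0\<^sup>2" using y by (intro power_strict_mono) auto
    moreover have "4 * z * y < 4 * z * y0" using y z by simp
    moreover have "c1 / y < c1 / y0" using y c1 by (intro divide_strict_left_mono_neg) auto
    moreover have "c0 / y\<^sup>2 < c0 / y0\<^sup>2"
      using y c0 \<open>y\<^sup>2 < y0\<^sup>2\<close> by (intro divide_strict_left_mono_neg) auto
    ultimately show ?thesis by (simp add: F_def)
  qed
  ultimately have "y\<^sup>2 * F y < 0"
    using y by (intro mult_pos_neg) auto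
  then show ?thesis
    using F[OF y(1)] by (simp add: y_def)
qed

lemma H_poly_neg_imp_gain:
  assumes s: "2 < s" and e: "e = (p + 1) / 2 * s" and neg: "poly (H_poly p) ((p + 1) / (p - 1) * s) < 0"
  shows "1 < (sqrt p * (4 * (e - 1) / e\<^sup>2)) * (sqrt p * (4 * (s - 1) / s\<^sup>2))"
proof -
  define q where "q = p - 1"
  have q: "0 < q" and pq: "p = q + 1" using p by (simp_all add: q_def)
  \<comment> \<open>In the variables \<open>s\<close> and \<open>e\<close> the bracket is the
    numerator of 1 minus the gain
    \<open>16 * p * (e - 1) * (s - 1) / (e\<^sup>2 * s\<^sup>2)\<close>.\<close>
  have "poly (H_poly p) ((p + 1) / (p - 1) * s) = 4 * (p + 1)\<^sup>2 / (p - 1) ^ 4 * (e\<^sup>2 * s\<^sup>2 - 16 * p * (e - 1) * (s - 1))"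
    unfolding poly_H_poly e pq using q
    by (simp add: divide_simps) (simp add: eval_nat_numeral algebra_simps)
  moreover have "0 < 4 * (p + 1)\<^sup>2 / (p - 1) ^ 4" using p by simp
  ultimately have "e\<^sup>2 * s\<^sup>2 - 16 * p * (e - 1) * (s - 1) < 0"
    using neg by (metis mult_less_0_iff order.asym)
  then have "e\<^sup>2 * s\<^sup>2 < 16 * p * (e - 1) * (s - 1)"
    by simp
  moreover have "0 < e\<^sup>2 * s\<^sup>2" using s p by (simp add: e)
  ultimately have "1 < 16 * p * (e - 1) * (s - 1) / (e\<^sup>2 * s\<^sup>2)"
    by (simp add: less_divide_eq)
  also have "\<dots> = (sqrt p * sqrt p) * (4 * (e - 1) / e\<^sup>2) * (4 * (s - 1) / s\<^sup>2)"
    using p by (simp add: algebra_simps)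
  finally show ?thesis by (simp only: mult_ac)
qed

lemma no_stable_solution_below_x0:
  fixes u :: "'a::euclidean_space \<Rightarrow> real"
  assumes "real DIM('a) < 2 + 2 * x0 p"
  shows "\<not> stable_solution p u"
proof -
  \<comment> \<open>The first entry of the maximum ensures \<open>s > 2\<close>, the second a
    positive scaling exponent.\<close>
  define b where "b = max (2 * (p + 1) / (p - 1)) ((real DIM('a) - 2) / 2)"
  have "b < x0 p" using x0_gt_critical assms by (simp add: b_def)
  then obtain x where x: "b < x" "x < x0 p" using dense by blast
  define s where "s = (p - 1) / (p + 1) * x"
  have sx: "(p + 1) / (p - 1) * s = x" using p by (simp add: s_def)
  have xb: "2 * (p + 1) / (p - 1) < x" "(real DIM('a) - 2) / 2 < x" using x(1) by (simp_all add: b_def)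
  have s: "2 < s" using xb(1) p by (simp add: s_def field_simps)
  have gain: "1 < (sqrt p * (4 * ((p + 1) / 2 * s - 1) / ((p + 1) / 2 * s)\<^sup>2)) * (sqrt p * (4 * (s - 1) / s\<^sup>2))"
    by (rule H_poly_neg_imp_gain[OF s refl]) (unfold sx, rule H_poly_neg_below_x0[OF xb(1) x(2)])
  show ?thesis
    by (rule no_stable_solution[OF p s refl gain]) (use xb(2) in \<open>unfold sx, simp add: field_simps\<close>)
qed

end

theorem theorem1p1:
  shows "(\<forall>p>1. 5 \<le> CARD('n::finite) \<and> real CARD('n) < 2 + 2 * x0 p \<longrightarrow>
            \<not> (\<exists>u :: real ^ 'n \<Rightarrow> real. stable_solution p u))
       \<and> (\<forall>p>1. x0 p > 5)
       \<and> (5 \<le> CARD('n) \<and> CARD('n) \<le> 12 \<longrightarrow>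
            (\<forall>p>1. \<not> (\<exists>u :: real ^ 'n \<Rightarrow> real. stable_solution p u)))"
proof (intro conjI allI impI)
  show no: "\<not> (\<exists>u :: real ^ 'n \<Rightarrow> real. stable_solution p u)"
    if "1 < p" "5 \<le> CARD('n) \<and> real CARD('n) < 2 + 2 * x0 p" for p
    using no_stable_solution_below_x0[OF that(1), where 'a="real ^ 'n"] that(2) by simp
  show gt: "5 < x0 p" if "1 < p" for p
    by (rule x0_gt_5[OF that])
  show "\<not> (\<exists>u :: real ^ 'n \<Rightarrow> real. stable_solution p u)"
    if "5 \<le> CARD('n) \<and> CARD('n) \<le> 12" "1 < p" for p
    using no[OF that(2)] gt[OF that(2)] that(1) by simp
qed

end
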